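(* Suppose $H \subset \mathbb{C}^N$ is a $C^\infty$ Levi-flat hypersurface with boundary, and $0 \in \partial H \subset \mathbb{C}^{N-2} \times \mathbb{R}^2$. Then for some neighbourhood $U$ of the origin, there exists a $C^\infty$ Levi-flat hypersurface $\mathcal{H}$ (without boundary) such that $H \cap U \subset \mathcal{H}$. Further, the germ $(\mathcal{H},0)$ is unique in the sense that if $(\mathcal{H}',0)$ is another germ of a $C^\infty$ Levi-flat hypersurface such that $(H,0) \subset (\mathcal{H}',0)$, then $(\mathcal{H}',0) = (\mathcal{H},0)$.
   Context: $\mathbb{C}^{N-2}\times\mathbb{R}^2$ is regarded as a subset of $\mathbb{C}^N = \mathbb{C}^{N-2}\times\mathbb{C}^2$ via the natural embedding. "Hypersurface" means an embedded submanifold of real codimension 1. $C^k$ hypersurface with boundary: a set $H \subset \mathbb{C}^N$ with a subset $\partial H \subset H$ such that $H^o := H\setminus\partial H$ is a $C^k$ hypersurface and for each $p \in \partial H$ there are a neighbourhood $U \subset \mathbb{C}^N$ of $p$ and a $C^k$ diffeomorphism $\varphi\colon U \to \mathbb{R}^{2N}$ with $\varphi(H\cap U) = \{x \mid x_{2N-1}\ge 0,\ x_{2N}=0\}$ and $\varphi(\partial H\cap U) = \{x \mid x_{2N-1}=0,\ x_{2N}=0\}$. With $J$ the complex structure on $\mathbb{C}^N$, $T_p^cH = J(T_pH)\cap T_pH$. A $C^k$ ($k\geq 2$) hypersurface $H$ is Levi-flat if the bundle $T^cH$ is involutive; equivalently, near every point $H$ is foliated by a one-parameter family of complex hypersurfaces.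 A hypersurface with boundary $H$ is Levi-flat if $H^o$ is Levi-flat. *)

theory Defs
  imports "HOL-Analysis.Analysis"
begin

text \<open>
  Complex Euclidean space is \<^typ>\<open>complex ^ 'n\<close> with \<open>N = CARD('n)\<close>, regarded as a real
  vector space of dimension \<open>2 * N\<close>: all derivatives below are real Frechet derivatives.
  Real Euclidean space of dimension \<open>2 * N\<close> is \<^typ>\<open>real ^ ('n + 'n)\<close>.
\<close>

text \<open>The differentiability notions below are meant for open \<open>S\<close>.\<close>

primrec Ck_on ::
  "nat \<Rightarrow> ('a::real_normed_vector \<Rightarrow> 'b::real_normed_vector) \<Rightarrow> 'a set \<Rightarrow> bool" where
  "Ck_on 0 f S \<longleftrightarrow> continuous_on S f"
| "Ck_on (Suc k) f S \<longleftrightarrow>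
     (\<forall>x\<in>S. f differentiable (at x)) \<and>
     (\<forall>v. Ck_on k (\<lambda>x. frechet_derivative f (at x) v) S)"

definition smooth_on ::
  "('a::real_normed_vector \<Rightarrow> 'b::real_normed_vector) \<Rightarrow> 'a set \<Rightarrow> bool" where
  "smooth_on f S \<longleftrightarrow> (\<forall>k. Ck_on k f S)"

definition smooth_diffeo ::
  "'a::real_normed_vector set \<Rightarrow> 'b::real_normed_vector set \<Rightarrow> ('a \<Rightarrow> 'b) \<Rightarrow> bool" where
  "smooth_diffeo U V \<phi> \<longleftrightarrow>
     open U \<and> open V \<and> bij_betw \<phi> U V \<and> smooth_on \<phi> U \<and> smooth_on (inv_into U \<phi>) V"

text \<open>
  An embedded submanifold of real codimension 1, by slice charts. Which coordinate is called
  the last one is immaterial, so the chart may choose it; likewise the last two coordinates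
  \<open>i\<close> and \<open>j\<close> for boundary charts.
\<close>

definition smooth_hypersurface :: "(complex ^ 'n) set \<Rightarrow> bool" where
  "smooth_hypersurface M \<longleftrightarrow>
     (\<forall>p\<in>M. \<exists>U (\<phi> :: complex ^ 'n \<Rightarrow> real ^ ('n + 'n)) j.
        p \<in> U \<and> smooth_diffeo U UNIV \<phi> \<and> \<phi> ` (M \<inter> U) = {x. x $ j = 0})"

definition smooth_hypersurface_with_boundary ::
  "(complex ^ 'n) set \<Rightarrow> (complex ^ 'n) set \<Rightarrow> bool" where
  "smooth_hypersurface_with_boundary H bd \<longleftrightarrow>
     bd \<subseteq> H \<and> smooth_hypersurface (H - bd) \<and>
     (\<forall>p\<in>bd. \<exists>U (\<phi> :: complex ^ 'n \<Rightarrow> real ^ ('n + 'n)) i j.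
        p \<in> U \<and> i \<noteq> j \<and> smooth_diffeo U UNIV \<phi> \<and>
        \<phi> ` (H \<inter> U) = {x. x $ i \<ge> 0 \<and> x $ j = 0} \<and>
        \<phi> ` (bd \<inter> U) = {x. x $ i = 0 \<and> x $ j = 0})"

definition tangent_space :: "(complex ^ 'n) set \<Rightarrow> complex ^ 'n \<Rightarrow> (complex ^ 'n) set" where
  "tangent_space M p =
     {v. \<exists>\<gamma> \<epsilon>. \<epsilon> > 0 \<and> smooth_on \<gamma> {-\<epsilon><..<\<epsilon>} \<and> \<gamma> ` {-\<epsilon><..<\<epsilon>} \<subseteq> M \<and>
           \<gamma> 0 = p \<and> (\<gamma> has_vector_derivative v) (at (0::real))}"

definition complex_structure :: "complex ^ 'n \<Rightarrow> complex ^ 'n" where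
  "complex_structure v = \<i> *s v"

definition complex_tangent_space ::
  "(complex ^ 'n) set \<Rightarrow> complex ^ 'n \<Rightarrow> (complex ^ 'n) set" where
  "complex_tangent_space M p = complex_structure ` tangent_space M p \<inter> tangent_space M p"

definition lie_bracket :: "('a \<Rightarrow> 'a) \<Rightarrow> ('a \<Rightarrow> 'a) \<Rightarrow> 'a \<Rightarrow> 'a::real_normed_vector" where
  "lie_bracket X Y p = frechet_derivative Y (at p) (X p) - frechet_derivative X (at p) (Y p)"

text \<open>
  Local sections of a subbundle \<open>D\<close> of the tangent bundle of \<open>M\<close> are represented by smooth
  extensions to open subsets of the ambient space. Such extensions exist locally because \<open>M\<close>
  is embedded, and on \<open>M\<close> the bracket of fields tangent to \<open>M\<close> does not depend on them.
\<close>

definition involutive ::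
  "'a::real_normed_vector set \<Rightarrow> ('a \<Rightarrow> 'a set) \<Rightarrow> bool" where
  "involutive M D \<longleftrightarrow>
     (\<forall>W X Y. open W \<longrightarrow> smooth_on X W \<longrightarrow> smooth_on Y W \<longrightarrow>
        (\<forall>p\<in>M \<inter> W. X p \<in> D p \<and> Y p \<in> D p) \<longrightarrow>
        (\<forall>p\<in>M \<inter> W. lie_bracket X Y p \<in> D p))"

definition levi_flat_hypersurface :: "(complex ^ 'n) set \<Rightarrow> bool" where
  "levi_flat_hypersurface M \<longleftrightarrow>
     smooth_hypersurface M \<and> involutive M (complex_tangent_space M)"

definition levi_flat_hypersurface_with_boundary ::
  "(complex ^ 'n) set \<Rightarrow> (complex ^ 'n) set \<Rightarrow> bool" where
  "levi_flat_hypersurface_with_boundary H bd \<longleftrightarrow>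
     smooth_hypersurface_with_boundary H bd \<and> levi_flat_hypersurface (H - bd)"

definition germ_subset :: "'a::topological_space \<Rightarrow> 'a set \<Rightarrow> 'a set \<Rightarrow> bool" where
  "germ_subset p A B \<longleftrightarrow> (\<exists>V. open V \<and> p \<in> V \<and> A \<inter> V \<subseteq> B \<inter> V)"

definition germ_eq :: "'a::topological_space \<Rightarrow> 'a set \<Rightarrow> 'a set \<Rightarrow> bool" where
  "germ_eq p A B \<longleftrightarrow> (\<exists>V. open V \<and> p \<in> V \<and> A \<inter> V = B \<inter> V)"

text \<open>
  The product of complex \<open>(N - 2)\<close>-space with the real plane, where \<open>a\<close> and \<open>b\<close> are the indices
  of the two coordinates that are required to be real. Distinct indices \<open>a\<close> and \<open>b\<close> exist
  exactly when \<open>N \<ge> 2\<close>; in particular \<open>N = 2\<close> is allowed.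
\<close>

definition real_in_coords :: "'n \<Rightarrow> 'n \<Rightarrow> (complex ^ 'n) set" where
  "real_in_coords a b = {z. z $ a \<in> \<real> \<and> z $ b \<in> \<real>}"

end

theory Submission imports Defs "HOL-Complex_Analysis.Conformal_Mappings" begin

text \<open>
  The edge contains the origin and lies in the set where \<open>z $ a\<close> and \<open>z $ b\<close> are real; hence near the
  origin, after possibly exchanging \<open>a\<close> and \<open>b\<close>, \<open>H\<close> is the part over a half-space \<open>\<sigma> Im (z $ a) \<ge> 0\<close> of a
  graph \<open>Im (z $ b) = \<rho>\<close>, where \<open>\<rho>\<close> vanishes for \<open>Im (z $ a) = 0\<close>.

  Existence: Levi-flatness says that the lifts of the constant vector fields to the complex tangent bundle of the
  graph commute. This is a first-order system that can be solved for the \<open>Im (z $ a)\<close>-derivatives and is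
  invariant under complex conjugation. Therefore all jets of \<open>\<rho>\<close> along the edge are odd under conjugation, and the
  odd reflection of \<open>\<rho>\<close> is smooth. The new graph is Levi-flat over the other half-space by
  symmetry and over the edge by continuity.

  Uniqueness: in a slice where only \<open>z $ a\<close> and \<open>z $ b\<close> vary, the commuting lifts can be integrated to complex discs.
  These are graphs of holomorphic functions \<open>z $ b = F (z $ a)\<close> that are real on the edge, so the Schwarz reflection
  principle shows that every Levi-flat extension is odd in \<open>Im (z $ a)\<close>, and it is determined by \<open>H\<close>.
\<close>

section \<open>Calculus of smooth functions\<close>

text \<open>A boundary chart is a diffeomorphism of a full neighbourhood, so \<rho> is smooth across
  the edge from the start; only Levi-flatness is one-sided. An identity valid on one open side
  therefore holds to infinite order along the edge, and one-sided derivatives never appear. The Levi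
  condition on \<rho> alone has second order; adjoining the slope \<open>P + i Q\<close> of the
  leaves in the \<open>z $ a\<close> direction makes it first order, so that the order of vanishing
  of the reflection defects can be raised step by step. Comparing jets also avoids proving that
  leaves depend smoothly on parameters. Jets cannot give uniqueness, because they do not determine a
  smooth function on the far side of the edge; there the leaves themselves are needed. Two different
  reflections occur: existence conjugates every coordinate, since this map is antiholomorphic and
  preserves complex tangency, while uniqueness reflects only \<open>z $ a\<close>, since all
  coordinates other than \<open>z $ a\<close> and \<open>z $ b\<close> are constant on the
  discs.\<close>

abbreviation Der :: "('a::real_normed_vector \<Rightarrow> 'b::real_normed_vector) \<Rightarrow> 'a \<Rightarrow> 'a \<Rightarrow> 'b" where
  "Der f x \<equiv> frechet_derivative f (at x)"

section \<open>Closure properties of C^k functions\<close>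

lemma Der_eqI:
  "(f has_derivative f') (at x) \<Longrightarrow> Der f x = f'"
  by (metis frechet_derivative_at)

text \<open>On an open set a derivative depends only on the values inside the set, and this passes
  to all iterated directional derivatives.\<close>

lemma Ck_on_cong:
  assumes "open S" "\<And>x. x \<in> S \<Longrightarrow> f x = g x" "Ck_on k f S"
  shows "Ck_on k g S"
  using assms(2,3)
proof (induction k arbitrary: f g)
  case 0
  then show ?case by (auto cong: continuous_on_cong)
next
  case (Suc k)
  have d: "g differentiable (at x)" "Der g x = Der f x"
    if "x \<in> S" for x
  proof -
    have f: "f differentiable (at x)" using Suc.prems that by simp
    then have "(g has_derivative Der f x) (at x)"
      using has_derivative_transform_within_open[OF _ assms(1) that] Suc.prems(1) frechet_derivative_works
      by blast
    then show "g differentiable (at x)" "Der g x = Der f x"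
      by (auto simp: differentiable_def Der_eqI)
  qed
  have "Ck_on k (\<lambda>x. Der g x v) S" for v
    by (rule Suc.IH[of "\<lambda>x. Der f x v"]) (use d Suc.prems in auto)
  with d show ?case by simp
qed

lemma Ck_on_subset: "Ck_on k f S \<Longrightarrow> T \<subseteq> S \<Longrightarrow> Ck_on k f T"
  by (induction k arbitrary: f) (auto intro: continuous_on_subset)

lemma Ck_on_SucD: "Ck_on (Suc k) f S \<Longrightarrow> Ck_on k f S"
proof (induction k arbitrary: f)
  case 0
  then show ?case
    by (auto intro!: continuous_at_imp_continuous_on differentiable_imp_continuous_within)
next
  case (Suc k)
  then show ?case using Ck_on.simps(2)[of "Suc k" f S] Ck_on.simps(2)[of k f S] by blast
qed

lemma Ck_on_const: "Ck_on k (\<lambda>x. c) S"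
  by (induction k arbitrary: c) auto

lemma Ck_on_bounded_linear: "bounded_linear L \<Longrightarrow> Ck_on k L S"
proof (induction k)
  case 0
  then show ?case by (simp add: linear_continuous_on)
next
  case (Suc k)
  then have L: "(L has_derivative L) (at x)" for x by (simp add: bounded_linear_imp_has_derivative)
  have "Der L x = L" for x using L by (rule Der_eqI)
  with L show ?case by (auto simp: differentiable_def Ck_on_const)
qed

lemma Ck_on_SucI:
  assumes "open S" "\<And>x. x \<in> S \<Longrightarrow> (f has_derivative f' x) (at x)"
    and "\<And>v. Ck_on k (\<lambda>x. f' x v) S"
  shows "Ck_on (Suc k) f S"
proof -
  have "Der f x = f' x" if "x \<in> S" for x
    using assms(2)[OF that] by (rule Der_eqI)
  then have "Ck_on k (\<lambda>x. Der f x v) S" for v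
    using Ck_on_cong[OF assms(1) _ assms(3)[of v]] by auto
  then show ?thesis using assms(2) by (auto simp: differentiable_def)
qed

lemma Ck_on_has_derivative:
  "Ck_on (Suc k) f S \<Longrightarrow> x \<in> S \<Longrightarrow> (f has_derivative Der f x) (at x)"
  by (simp add: frechet_derivative_works)

lemma Ck_on_add:
  assumes "open S" "Ck_on k f S" "Ck_on k g S"
  shows "Ck_on k (\<lambda>x. f x + g x) S"
  using assms(2,3)
proof (induction k arbitrary: f g)
  case 0
  then show ?case by (auto intro: continuous_intros)
next
  case (Suc k)
  show ?case
  proof (rule Ck_on_SucI[OF assms(1)])
    show "((\<lambda>x. f x + g x) has_derivative
        (\<lambda>v. Der f x v + Der g x v)) (at x)" if "x \<in> S" for x
      using that Suc.prems by (intro has_derivative_add Ck_on_has_derivative)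
  qed (use Suc in simp)
qed

lemma Ck_on_bounded_linear_compose:
  assumes "bounded_linear L" "open S" "Ck_on k f S"
  shows "Ck_on k (\<lambda>x. L (f x)) S"
  using assms(3)
proof (induction k arbitrary: f)
  case 0
  then show ?case using assms(1) by (auto intro: bounded_linear.continuous_on)
next
  case (Suc k)
  show ?case
  proof (rule Ck_on_SucI[OF assms(2)])
    show "((\<lambda>x. L (f x)) has_derivative (\<lambda>v. L (Der f x v))) (at x)"
      if "x \<in> S" for x
      using that Suc.prems by (intro bounded_linear.has_derivative[OF assms(1)] Ck_on_has_derivative)
  qed (use Suc in simp)
qed

lemma Ck_on_bilinear:
  assumes B: "bounded_bilinear B" and "open S" "Ck_on k f S" "Ck_on k g S"
  shows "Ck_on k (\<lambda>x. B (f x) (g x)) S"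
  using assms(3,4)
proof (induction k arbitrary: f g)
  case 0
  then show ?case using B by (auto intro: bounded_bilinear.continuous_on)
next
  case (Suc k)
  show ?case
  proof (rule Ck_on_SucI[OF assms(2)])
    fix x assume "x \<in> S"
    then show "((\<lambda>x. B (f x) (g x)) has_derivative
        (\<lambda>v. B (f x) (Der g x v) + B (Der f x v) (g x))) (at x)"
      using Suc.prems by (intro bounded_bilinear.FDERIV[OF B] Ck_on_has_derivative)
  next
    fix v
    have "Ck_on k f S" "Ck_on k g S" using Suc.prems Ck_on_SucD by blast+
    then show "Ck_on k (\<lambda>x. B (f x) (Der g x v) + B (Der f x v) (g x)) S"
      using Suc.prems by (intro Ck_on_add assms(2) Suc.IH) simp_all
  qed
qed

lemma Ck_on_sum:
  assumes "open S" "\<And>i. i \<in> I \<Longrightarrow> Ck_on k (f i) S"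
  shows "Ck_on k (\<lambda>x. \<Sum>i\<in>I. f i x) S"
  using assms(2) by (induction I rule: infinite_finite_induct) (auto intro: Ck_on_const Ck_on_add assms(1))

text \<open>In the chain rule the direction \<open>Der g x v\<close> varies with \<open>x\<close>,
  whereas \<open>Ck_on\<close> controls derivatives in fixed directions only. Expanding the
  direction in \<open>Basis\<close> reduces it to finitely many fixed ones; this is why the middle
  space is Euclidean.\<close>

lemma Ck_on_compose:
  fixes f :: "'b::euclidean_space \<Rightarrow> 'c::real_normed_vector" and g :: "'a::real_normed_vector \<Rightarrow> 'b"
  assumes "open S" "open T" "g ` S \<subseteq> T" "Ck_on k f T" "Ck_on k g S"
  shows "Ck_on k (\<lambda>x. f (g x)) S"
  using assms(4,5)
proof (induction k arbitrary: f)
  case 0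
  then show ?case using assms(3) by (auto intro: continuous_on_compose2)
next
  case (Suc k)
  let ?D = "\<lambda>x v. \<Sum>b\<in>Basis. (Der g x v \<bullet> b) *\<^sub>R Der f (g x) b"
  show ?case
  proof (rule Ck_on_SucI[OF assms(1)])
    fix x assume x: "x \<in> S"
    with assms(3) have gx: "g x \<in> T" by auto
    have f: "(f has_derivative Der f (g x)) (at (g x))"
      using Ck_on_has_derivative[OF Suc.prems(1) gx] .
    have g: "(g has_derivative Der g x) (at x)"
      using Ck_on_has_derivative[OF Suc.prems(2) x] .
    have "Der f (g x) (Der g x v) = ?D x v" for v
    proof -
      interpret linear "Der f (g x)"
        using f by (simp add: has_derivative_linear)
      have "Der f (g x) (Der g x v)
        = Der f (g x) (\<Sum>b\<in>Basis. (Der g x v \<bullet> b) *\<^sub>R b)"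
        by (simp add: euclidean_representation)
      also have "\<dots> = ?D x v" by (simp add: sum scale)
      finally show ?thesis .
    qed
    then show "((\<lambda>x. f (g x)) has_derivative ?D x) (at x)"
      using has_derivative_compose[OF g f] by simp
  next
    fix v
    have "Ck_on k (\<lambda>x. Der f (g x) b) S" for b
      by (rule Suc.IH) (use Suc.prems Ck_on_SucD in auto)
    moreover have "Ck_on k (\<lambda>x. Der g x v) S" using Suc.prems(2) by simp
    ultimately show "Ck_on k (\<lambda>x. ?D x v) S"
      by (intro Ck_on_sum assms(1) Ck_on_bilinear[OF bounded_bilinear_scaleR]
          Ck_on_bounded_linear_compose[OF bounded_linear_inner_left])
  qed
qed

lemma Ck_on_powr: "Ck_on k (\<lambda>x::real. x powr c) {0<..}"
proof (induction k arbitrary: c)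
  case 0
  then show ?case by (auto intro!: continuous_intros)
next
  case (Suc k)
  show ?case
  proof (rule Ck_on_SucI)
    fix x :: real assume "x \<in> {0<..}"
    then have "((\<lambda>x. x powr c) has_real_derivative c * x powr (c - 1)) (at x)"
      by (auto intro: has_real_derivative_powr)
    then show "((\<lambda>x. x powr c) has_derivative (\<lambda>v. (c * v) * x powr (c - 1))) (at x)"
      unfolding has_field_derivative_def by (rule has_derivative_eq_rhs) auto
  next
    show "Ck_on k (\<lambda>x. (c * v) * x powr (c - 1)) {0<..}" for v
      by (rule Ck_on_bilinear[OF bounded_bilinear_mult]) (auto intro: Ck_on_const Suc)
  qed auto
qed

lemma smooth_onD: "smooth_on f S \<Longrightarrow> Ck_on k f S"
  by (simp add: smooth_on_def)

lemma smooth_on_cong: "open S \<Longrightarrow> (\<And>x. x \<in> S \<Longrightarrow> f x = g x) \<Longrightarrow> smooth_on f S \<Longrightarrow> smooth_on g S"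
  unfolding smooth_on_def using Ck_on_cong by blast

lemma smooth_on_subset: "smooth_on f S \<Longrightarrow> T \<subseteq> S \<Longrightarrow> smooth_on f T"
  unfolding smooth_on_def using Ck_on_subset by blast

lemma smooth_on_continuous_on: "smooth_on f S \<Longrightarrow> continuous_on S f"
  using smooth_onD[of f S 0] by simp

lemma smooth_on_has_derivative:
  "smooth_on f S \<Longrightarrow> x \<in> S \<Longrightarrow> (f has_derivative Der f x) (at x)"
  using smooth_onD Ck_on_has_derivative by blast

lemma smooth_on_linear_derivative:
  "smooth_on f S \<Longrightarrow> x \<in> S \<Longrightarrow> linear (Der f x)"
  using smooth_on_has_derivative has_derivative_linear by blast

lemma smooth_on_derivative: "smooth_on f S \<Longrightarrow> smooth_on (\<lambda>x. Der f x v) S"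
proof -
  assume "smooth_on f S"
  then have "Ck_on (Suc k) f S" for k by (rule smooth_onD)
  then show ?thesis by (simp add: smooth_on_def)
qed

lemma smooth_on_const: "smooth_on (\<lambda>x. c) S"
  by (simp add: smooth_on_def Ck_on_const)

lemma smooth_on_bounded_linear: "bounded_linear L \<Longrightarrow> smooth_on L S"
  by (simp add: smooth_on_def Ck_on_bounded_linear)

lemma smooth_on_add:
  "open S \<Longrightarrow> smooth_on f S \<Longrightarrow> smooth_on g S \<Longrightarrow> smooth_on (\<lambda>x. f x + g x) S"
  by (simp add: smooth_on_def Ck_on_add)

lemma smooth_on_bounded_linear_compose:
  "bounded_linear L \<Longrightarrow> open S \<Longrightarrow> smooth_on f S \<Longrightarrow> smooth_on (\<lambda>x. L (f x)) S"
  by (simp add: smooth_on_def Ck_on_bounded_linear_compose)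

lemma smooth_on_bilinear:
  "bounded_bilinear B \<Longrightarrow> open S \<Longrightarrow> smooth_on f S \<Longrightarrow> smooth_on g S \<Longrightarrow> smooth_on (\<lambda>x. B (f x) (g x)) S"
  by (simp add: smooth_on_def Ck_on_bilinear)

lemmas smooth_on_scaleR = smooth_on_bilinear[OF bounded_bilinear_scaleR]
  and smooth_on_mult = smooth_on_bilinear[OF bounded_bilinear_mult]
  and smooth_on_inner = smooth_on_bilinear[OF bounded_bilinear_inner]

lemma smooth_on_minus: "open S \<Longrightarrow> smooth_on f S \<Longrightarrow> smooth_on (\<lambda>x. - f x) S"
  by (rule smooth_on_bounded_linear_compose[OF bounded_linear_minus[OF bounded_linear_ident]])

lemma smooth_on_diff:
  "open S \<Longrightarrow> smooth_on f S \<Longrightarrow> smooth_on g S \<Longrightarrow> smooth_on (\<lambda>x. f x - g x) S"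
  using smooth_on_add[of S f "\<lambda>x. - g x"] smooth_on_minus by auto

lemma smooth_on_compose:
  fixes f :: "'b::euclidean_space \<Rightarrow> 'c::real_normed_vector" and g :: "'a::real_normed_vector \<Rightarrow> 'b"
  shows "open S \<Longrightarrow> open T \<Longrightarrow> g ` S \<subseteq> T \<Longrightarrow> smooth_on f T \<Longrightarrow> smooth_on g S \<Longrightarrow> smooth_on (\<lambda>x. f (g x)) S"
  unfolding smooth_on_def using Ck_on_compose by blast

lemma smooth_on_powr:
  "open S \<Longrightarrow> smooth_on f S \<Longrightarrow> (\<And>x. x \<in> S \<Longrightarrow> (0::real) < f x) \<Longrightarrow> smooth_on (\<lambda>x. f x powr c) S"
  by (rule smooth_on_compose[where T = "{0<..}" and f = "\<lambda>x::real. x powr c"]) (auto simp: smooth_on_def Ck_on_powr)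

text \<open>Writing \<open>f / g\<close> as \<open>f * g * (g * g) powr (-1)\<close> makes the base
  of the power positive, so denominators of either sign are covered.\<close>

lemma smooth_on_divide:
  fixes f g :: "'a::real_normed_vector \<Rightarrow> real"
  assumes "open S" "smooth_on f S" "smooth_on g S" "\<And>x. x \<in> S \<Longrightarrow> g x \<noteq> 0"
  shows "smooth_on (\<lambda>x. f x / g x) S"
proof (rule smooth_on_cong[OF assms(1)])
  have "0 < g x * g x" if "x \<in> S" for x
    using assms(4)[OF that] by (metis not_real_square_gt_zero)
  then show "smooth_on (\<lambda>x. f x * (g x * (g x * g x) powr (-1))) S"
    by (intro smooth_on_mult smooth_on_powr assms(1-3))
  show "f x * (g x * (g x * g x) powr - 1) = f x / g x" if "x \<in> S" for x
    using assms(4)[OF that] by (simp add: powr_minus divide_simps)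
qed

section \<open>Symmetry of second derivatives\<close>

lemma has_vector_derivative_along_line:
  assumes "(f has_derivative f') (at (c + s *\<^sub>R v))"
  shows "((\<lambda>s. f (c + s *\<^sub>R v)) has_vector_derivative f' v) (at s)"
proof -
  have "((\<lambda>s. c + s *\<^sub>R v) has_derivative (\<lambda>s. s *\<^sub>R v)) (at s)"
    by (auto intro!: derivative_eq_intros)
  from has_derivative_compose[OF this assms]
  have "((\<lambda>s. f (c + s *\<^sub>R v)) has_derivative (\<lambda>s. f' (s *\<^sub>R v))) (at s)" .
  moreover have "(\<lambda>s. f' (s *\<^sub>R v)) = (\<lambda>s. s *\<^sub>R f' v)"
    using assms has_derivative_linear linear_scale by blast
  ultimately show ?thesis by (simp add: has_vector_derivative_def)
qed

text \<open>The mean value theorem is applied twice: to the increment in direction \<open>w\<close>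
  as a function of the \<open>v\<close>-parameter, then to the resulting difference of first
  derivatives.\<close>

lemma second_difference:
  fixes f :: "'a::real_normed_vector \<Rightarrow> real"
  assumes f: "smooth_on f S" and "0 < h" and sub: "cball x (h * (norm v + norm w)) \<subseteq> S"
  shows "\<exists>y. dist x y \<le> h * (norm v + norm w) \<and>
    f (x + h *\<^sub>R v + h *\<^sub>R w) - f (x + h *\<^sub>R v) - f (x + h *\<^sub>R w) + f x
      = h * h * Der (\<lambda>x. Der f x v) y w"
proof -
  let ?Dv = "\<lambda>x. Der f x v"
  have near: "dist x (x + s *\<^sub>R v + t *\<^sub>R w) \<le> h * (norm v + norm w)"
    if "0 \<le> s" "s \<le> h" "0 \<le> t" "t \<le> h" for s t
  proof -
    have "dist x (x + s *\<^sub>R v + t *\<^sub>R w) = norm (s *\<^sub>R v + t *\<^sub>R w)"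
      by (simp add: dist_norm norm_minus_commute algebra_simps)
    also have "\<dots> \<le> s * norm v + t * norm w"
      using norm_triangle_ineq[of "s *\<^sub>R v" "t *\<^sub>R w"] that by simp
    also have "\<dots> \<le> h * norm v + h * norm w"
      using that by (intro add_mono mult_right_mono) auto
    finally show ?thesis by (simp add: distrib_left)
  qed
  have inS: "x + s *\<^sub>R v + t *\<^sub>R w \<in> S" if "0 \<le> s" "s \<le> h" "0 \<le> t" "t \<le> h" for s t
    using near[OF that] sub by auto
  have d1: "((\<lambda>s. f (x + s *\<^sub>R v + t *\<^sub>R w)) has_real_derivative ?Dv (x + s *\<^sub>R v + t *\<^sub>R w)) (at s)"
    if "0 \<le> s" "s \<le> h" "0 \<le> t" "t \<le> h" for s t
    using has_vector_derivative_along_line[of f _ "x + t *\<^sub>R w" s v]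
      smooth_on_has_derivative[OF f inS[OF that]]
    by (simp add: has_real_derivative_iff_has_vector_derivative add_ac)
  have "\<exists>z>0. z < h \<and> (f (x + h *\<^sub>R v + h *\<^sub>R w) - f (x + h *\<^sub>R v)) - (f (x + 0 *\<^sub>R v + h *\<^sub>R w) - f (x + 0 *\<^sub>R v)) =
      (h - 0) * (?Dv (x + z *\<^sub>R v + h *\<^sub>R w) - ?Dv (x + z *\<^sub>R v))"
    using \<open>0 < h\<close> d1[of _ h] d1[of _ 0]
    by (intro MVT2[where f = "\<lambda>s. f (x + s *\<^sub>R v + h *\<^sub>R w) - f (x + s *\<^sub>R v)"])
       (auto intro!: DERIV_diff)
  then obtain z where z: "0 < z" "z < h"
    and e1: "(f (x + h *\<^sub>R v + h *\<^sub>R w) - f (x + h *\<^sub>R v)) - (f (x + h *\<^sub>R w) - f x) =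
      h * (?Dv (x + z *\<^sub>R v + h *\<^sub>R w) - ?Dv (x + z *\<^sub>R v))" by auto
  have d2: "((\<lambda>t. ?Dv (x + z *\<^sub>R v + t *\<^sub>R w)) has_real_derivative
      Der ?Dv (x + z *\<^sub>R v + t *\<^sub>R w) w) (at t)"
    if "0 \<le> t" "t \<le> h" for t
    using has_vector_derivative_along_line[of ?Dv _ "x + z *\<^sub>R v" t w]
      smooth_on_has_derivative[OF smooth_on_derivative[OF f] inS[of z t]] z that
    by (simp add: has_real_derivative_iff_has_vector_derivative)
  have "\<exists>t>0. t < h \<and> ?Dv (x + z *\<^sub>R v + h *\<^sub>R w) - ?Dv (x + z *\<^sub>R v + 0 *\<^sub>R w) =
      (h - 0) * Der ?Dv (x + z *\<^sub>R v + t *\<^sub>R w) w"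
    using \<open>0 < h\<close> d2 by (intro MVT2[where f = "\<lambda>t. ?Dv (x + z *\<^sub>R v + t *\<^sub>R w)"]) auto
  then obtain t where t: "0 < t" "t < h"
    and e2: "?Dv (x + z *\<^sub>R v + h *\<^sub>R w) - ?Dv (x + z *\<^sub>R v) =
      h * Der ?Dv (x + z *\<^sub>R v + t *\<^sub>R w) w" by auto
  show ?thesis
    using near[of z t] z t e1 e2
    by (intro exI[of _ "x + z *\<^sub>R v + t *\<^sub>R w"]) (auto simp: algebra_simps)
qed

text \<open>The second difference is symmetric in \<open>v\<close> and \<open>w\<close>, so the two
  mixed derivatives take a common value at points arbitrarily close to \<open>x\<close>; continuity
  of both concludes.\<close>

lemma Der_commute:
  fixes f :: "'a::real_normed_vector \<Rightarrow> real"
  assumes S: "open S" "x \<in> S" and f: "smooth_on f S"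
  shows "Der (\<lambda>x. Der f x v) x w
       = Der (\<lambda>x. Der f x w) x v"
proof -
  let ?A = "\<lambda>v w x. Der (\<lambda>x. Der f x v) x w"
  have "\<bar>?A v w x - ?A w v x\<bar> \<le> e" if "0 < e" for e
  proof -
    have "continuous (at x) (?A u u')" for u u'
      using smooth_on_continuous_on[OF smooth_on_derivative[OF smooth_on_derivative[OF f]]] S
      by (simp add: continuous_on_eq_continuous_at)
    then have "\<exists>d>0. \<forall>y. dist y x < d \<longrightarrow> dist (?A u u' y) (?A u u' x) < e / 2" for u u'
      using that unfolding continuous_at_eps_delta by (meson half_gt_zero)
    then obtain d1 d2 where d: "0 < d1" "0 < d2"
      "\<And>y. dist y x < d1 \<Longrightarrow> dist (?A v w y) (?A v w x) < e / 2"
      "\<And>y. dist y x < d2 \<Longrightarrow> dist (?A w v y) (?A w v x) < e / 2"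
      by metis
    obtain r where r: "0 < r" "cball x r \<subseteq> S" using S open_contains_cball by blast
    define m where "m = min r (min (d1 / 2) (d2 / 2))"
    \<comment> \<open>The parallelogram then stays within distance \<open>m\<close> of
      \<open>x\<close>; the summand 1 keeps the denominator positive when both directions
      vanish.\<close>
    define h where "h = m / (norm v + norm w + 1)"
    have m: "0 < m" "m \<le> r" "m < d1" "m < d2" using r d by (auto simp: m_def min_def)
    have h: "0 < h" using m(1) by (simp add: h_def add_nonneg_pos)
    have hm: "h * (norm v + norm w) \<le> m"
    proof -
      have "h * (norm v + norm w) = m * ((norm v + norm w) / (norm v + norm w + 1))" by (simp add: h_def)
      also have "\<dots> \<le> m * 1"
        using m(1) by (intro mult_left_mono) (auto simp: divide_le_eq add_nonneg_pos)
      finally show ?thesis by simp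
    qed
    then have "cball x (h * (norm v + norm w)) \<subseteq> S" "cball x (h * (norm w + norm v)) \<subseteq> S"
      using r m by (auto simp: add.commute)
    from second_difference[OF f h this(1)] second_difference[OF f h this(2)]
    obtain y z where y: "dist x y \<le> h * (norm v + norm w)"
        "f (x + h *\<^sub>R v + h *\<^sub>R w) - f (x + h *\<^sub>R v) - f (x + h *\<^sub>R w) + f x = h * h * ?A v w y"
      and z: "dist x z \<le> h * (norm v + norm w)"
        "f (x + h *\<^sub>R w + h *\<^sub>R v) - f (x + h *\<^sub>R w) - f (x + h *\<^sub>R v) + f x = h * h * ?A w v z"
      by (auto simp: add.commute)
    have "h * h * ?A v w y = h * h * ?A w v z" using y(2) z(2) by (simp add: algebra_simps)
    then have "?A v w y = ?A w v z" using h by simp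
    moreover have "dist (?A v w y) (?A v w x) < e / 2" "dist (?A w v z) (?A w v x) < e / 2"
      using d(3)[of y] d(4)[of z] y(1) z(1) hm m by (auto simp: dist_commute)
    ultimately show ?thesis unfolding dist_real_def by linarith
  qed
  then have "\<bar>?A v w x - ?A w v x\<bar> \<le> 0" by (rule field_le_epsilon) simp
  then show ?thesis by simp
qed

section \<open>Functions that vanish to infinite order on a hyperplane\<close>

text \<open>Only derivatives in one transversal direction \<open>e\<close> are recorded, of orders 0
  to \<open>n\<close> inclusive. Tangential derivatives vanish automatically, so this expresses
  vanishing of the whole \<open>n\<close>-jet along the hyperplane \<open>l = 0\<close>.\<close>

primrec vanishes_to_order ::
  "('a::real_normed_vector \<Rightarrow> real) \<Rightarrow> 'a \<Rightarrow> 'a set \<Rightarrow> nat \<Rightarrow> ('a \<Rightarrow> real) \<Rightarrow> bool" where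
  "vanishes_to_order l e S 0 f \<longleftrightarrow> (\<forall>x\<in>S. l x = 0 \<longrightarrow> f x = 0)"
| "vanishes_to_order l e S (Suc n) f \<longleftrightarrow> (\<forall>x\<in>S. l x = 0 \<longrightarrow> f x = 0) \<and>
     vanishes_to_order l e S n (\<lambda>x. Der f x e)"

context
  fixes l :: "'a::real_normed_vector \<Rightarrow> real" and e :: 'a and S :: "'a set"
  assumes l: "bounded_linear l" and le: "l e = 1" and S: "open S"
begin

private abbreviation "van \<equiv> vanishes_to_order l e S"

lemma vanishes_to_order_0: "van n f \<Longrightarrow> x \<in> S \<Longrightarrow> l x = 0 \<Longrightarrow> f x = 0"
  by (cases n) auto

lemma vanishes_to_order_SucD: "van (Suc n) f \<Longrightarrow> van n f"
  by (induction n arbitrary: f) auto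

lemma vanishes_to_order_cong:
  assumes "\<And>x. x \<in> S \<Longrightarrow> f x = g x" "van n f" "smooth_on f S"
  shows "van n g"
  using assms
proof (induction n arbitrary: f g)
  case (Suc n)
  have "Der f x e = Der g x e" if "x \<in> S" for x
  proof -
    have "(g has_derivative Der f x) (at x)"
      by (rule has_derivative_transform_within_open[OF smooth_on_has_derivative[OF Suc.prems(3) that] S that])
         (rule Suc.prems(1))
    then show ?thesis by (simp add: Der_eqI)
  qed
  then have "van n (\<lambda>x. Der g x e)"
    by (rule Suc.IH[of "\<lambda>x. Der f x e"]) (use Suc.prems smooth_on_derivative in auto)
  then show ?case using Suc.prems by auto
qed auto

lemma vanishes_to_order_add:
  assumes "smooth_on f S" "smooth_on g S" "van n f" "van n g"
  shows "van n (\<lambda>x. f x + g x)"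
  using assms
proof (induction n arbitrary: f g)
  case (Suc n)
  have "Der f x e + Der g x e = Der (\<lambda>x. f x + g x) x e" if "x \<in> S" for x
    using Der_eqI[OF has_derivative_add[OF smooth_on_has_derivative[OF Suc.prems(1) that]
        smooth_on_has_derivative[OF Suc.prems(2) that]]] by simp
  moreover have "van n (\<lambda>x. Der f x e + Der g x e)" using Suc.prems by (intro Suc.IH smooth_on_derivative) auto
  moreover have "smooth_on (\<lambda>x. Der f x e + Der g x e) S"
    using Suc.prems S by (intro smooth_on_add smooth_on_derivative)
  ultimately have "van n (\<lambda>x. Der (\<lambda>x. f x + g x) x e)" by (rule vanishes_to_order_cong)
  then show ?case using Suc.prems by auto
qed auto

lemma vanishes_to_order_mult:
  assumes "smooth_on f S" "smooth_on g S" "van n f"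
  shows "van n (\<lambda>x. g x * f x)"
  using assms
proof (induction n arbitrary: f g)
  case (Suc n)
  have "g x * Der f x e + Der g x e * f x = Der (\<lambda>x. g x * f x) x e" if "x \<in> S" for x
    using Der_eqI[OF has_derivative_mult[OF smooth_on_has_derivative[OF Suc.prems(2) that]
        smooth_on_has_derivative[OF Suc.prems(1) that]]] by simp
  moreover have "van n (\<lambda>x. g x * Der f x e + Der g x e * f x)"
    using Suc.prems vanishes_to_order_SucD[OF Suc.prems(3)] S
    by (intro vanishes_to_order_add Suc.IH smooth_on_mult smooth_on_derivative) auto
  moreover have "smooth_on (\<lambda>x. g x * Der f x e + Der g x e * f x) S"
    using Suc.prems S by (intro smooth_on_add smooth_on_mult smooth_on_derivative)
  ultimately have "van n (\<lambda>x. Der (\<lambda>x. g x * f x) x e)" by (rule vanishes_to_order_cong)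
  then show ?case using Suc.prems by auto
qed auto

text \<open>Along a direction inside the hyperplane the function is constantly zero, and symmetry of
  second derivatives moves the transversal derivatives past the tangential one. No order is
  lost.\<close>

lemma vanishes_to_order_tangential:
  assumes "smooth_on f S" "van n f" "l v = 0"
  shows "van n (\<lambda>x. Der f x v)"
  using assms
proof (induction n arbitrary: f)
  case (0 f)
  have "Der f x v = 0" if x: "x \<in> S" "l x = 0" for x
  proof -
    have "((\<lambda>s. f (x + s *\<^sub>R v)) has_vector_derivative Der f x v) (at 0)"
      using has_vector_derivative_along_line[of f _ x 0 v] smooth_on_has_derivative[OF 0(1) x(1)] by simp
    moreover have "((\<lambda>s. f (x + s *\<^sub>R v)) has_vector_derivative 0) (at 0)"
    proof (rule has_vector_derivative_transform_within_open)
      show "((\<lambda>s. 0::real) has_vector_derivative 0) (at 0)" by simp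
      have "continuous_on UNIV (\<lambda>s. x + s *\<^sub>R v)" by (intro continuous_intros)
      then show "open ((\<lambda>s. x + s *\<^sub>R v) -` S)" using S open_vimage by blast
      show "(0::real) = f (x + s *\<^sub>R v)" if "s \<in> (\<lambda>s. x + s *\<^sub>R v) -` S" for s
      proof -
        have "l (x + s *\<^sub>R v) = 0"
          using x 0(3) l by (simp add: linear_simps)
        then show ?thesis using that 0(2) by auto
      qed
    qed (use x in auto)
    ultimately show ?thesis by (rule vector_derivative_unique_at)
  qed
  then show ?case by simp
next
  case (Suc n f)
  have "Der (\<lambda>x. Der f x e) x v = Der (\<lambda>x. Der f x v) x e" if "x \<in> S" for x
    by (rule Der_commute[OF S that Suc.prems(1)])
  moreover have "van n (\<lambda>x. Der (\<lambda>x. Der f x e) x v)"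
    using Suc.prems by (intro Suc.IH smooth_on_derivative) auto
  moreover have "smooth_on (\<lambda>x. Der (\<lambda>x. Der f x e) x v) S"
    using Suc.prems by (intro smooth_on_derivative)
  ultimately have "van n (\<lambda>x. Der (\<lambda>x. Der f x v) x e)"
    by (rule vanishes_to_order_cong)
  moreover have "van n (\<lambda>x. Der f x v)"
    using Suc vanishes_to_order_SucD by blast
  ultimately show ?case by (auto intro: vanishes_to_order_0)
qed

text \<open>After splitting \<open>v\<close> along \<open>e\<close> and the hyperplane, only the
  \<open>e\<close>-component costs an order.\<close>

lemma vanishes_to_order_derivative:
  assumes f: "smooth_on f S" and n: "van (Suc n) f"
  shows "van n (\<lambda>x. Der f x v)"
proof -
  define w where "w = v - l v *\<^sub>R e"
  have v: "v = l v *\<^sub>R e + w" by (simp add: w_def)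
  have lw: "l w = 0" using l le by (simp add: w_def linear_simps)
  have "l v * Der f x e + Der f x w = Der f x v" if "x \<in> S" for x
  proof -
    interpret linear "Der f x" using f that by (rule smooth_on_linear_derivative)
    show ?thesis by (subst (2) v) (simp add: add scale)
  qed
  moreover have "van n (\<lambda>x. l v * Der f x e + Der f x w)"
    using vanishes_to_order_tangential[OF f vanishes_to_order_SucD[OF n] lw] n f S
    by (intro vanishes_to_order_add vanishes_to_order_mult smooth_on_mult smooth_on_derivative smooth_on_const) auto
  moreover have "smooth_on (\<lambda>x. l v * Der f x e + Der f x w) S"
    using f S by (intro smooth_on_add smooth_on_mult smooth_on_derivative smooth_on_const)
  ultimately show ?thesis by (rule vanishes_to_order_cong)
qed

text \<open>Points of the hyperplane are limits from the open half-space, and the transversal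
  derivative inherits the vanishing there. This turns one-sided identities into statements about
  jets.\<close>

lemma vanishes_to_order_if_zero_half_space:
  assumes "smooth_on f S" "\<And>x. x \<in> S \<Longrightarrow> 0 < l x \<Longrightarrow> f x = 0"
  shows "van n f"
  using assms
proof (induction n arbitrary: f)
  case (0 f)
  have "f x = 0" if x: "x \<in> S" "l x = 0" for x
  proof (rule tendsto_unique)
    have "continuous (at x) f"
      using smooth_on_continuous_on[OF 0(1)] S x continuous_on_eq_continuous_at by blast
    moreover have t: "((\<lambda>s. x + s *\<^sub>R e) \<longlongrightarrow> x) (at_right 0)" by (auto intro!: tendsto_eq_intros)
    ultimately show "((\<lambda>s. f (x + s *\<^sub>R e)) \<longlongrightarrow> f x) (at_right 0)"
      using isCont_tendsto_compose by blast
    have "\<forall>\<^sub>F s in at_right 0. x + s *\<^sub>R e \<in> S" using topological_tendstoD[OF t S x(1)] .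
    moreover have "\<forall>\<^sub>F s in at_right 0. 0 < (s::real)" by (simp add: eventually_at_right_less)
    ultimately have "\<forall>\<^sub>F s in at_right 0. 0 = f (x + s *\<^sub>R e)"
    proof eventually_elim
      case (elim s)
      have "l (x + s *\<^sub>R e) = s" using l le x by (simp add: linear_simps)
      then show ?case using 0(2)[of "x + s *\<^sub>R e"] elim by simp
    qed
    with tendsto_const show "((\<lambda>s. f (x + s *\<^sub>R e)) \<longlongrightarrow> 0) (at_right 0)"
      by (rule Lim_transform_eventually)
  qed auto
  then show ?case by simp
next
  case (Suc n f)
  have "Der f x e = 0" if x: "x \<in> S" "0 < l x" for x
  proof -
    have "open {x. 0 < l x}"
      by (intro open_Collect_less continuous_intros linear_continuous_on l)
    then have op: "open (S \<inter> {x. 0 < l x})" using S by blast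
    have "(f has_derivative (\<lambda>v. 0)) (at x)"
      by (rule has_derivative_transform_within_open[OF has_derivative_const[of 0] op])
         (use x Suc.prems in auto)
    then show ?thesis by (simp add: Der_eqI)
  qed
  then have "van n (\<lambda>x. Der f x e)" using Suc.prems by (intro Suc.IH smooth_on_derivative) auto
  moreover have "van n f" using Suc by blast
  ultimately show ?case using vanishes_to_order_0[of n f] by simp
qed

text \<open>The derivative of the cut-off is the cut-off of the derivative, which is again flat to
  all orders, so an induction on \<open>k\<close> closes. On the hyperplane itself the difference
  quotient is dominated by that of \<open>f\<close>, whose value and derivative vanish.\<close>

lemma smooth_on_cut_off:
  assumes "smooth_on f S" "\<And>n. van n f"
  shows "smooth_on (\<lambda>x. if l x < 0 then f x else 0) S"
proof -
  have lt: "open {x. l x < 0}"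
    by (intro open_Collect_less continuous_intros linear_continuous_on l)
  have gt: "open {x. 0 < l x}"
    by (intro open_Collect_less continuous_intros linear_continuous_on l)
  have der: "((\<lambda>x. if l x < 0 then f x else 0) has_derivative
      (\<lambda>v. if l x < 0 then Der f x v else 0)) (at x)"
    if f: "smooth_on f S" and van: "\<And>n. van n f" and x: "x \<in> S" for f x
  proof -
    have fx: "(f has_derivative Der f x) (at x)"
      using f x by (rule smooth_on_has_derivative)
    consider "l x < 0" | "0 < l x" | "l x = 0" by linarith
    then show ?thesis
    proof cases
      case 1
      then show ?thesis using has_derivative_transform_within_open[OF fx lt] by simp
    next
      case 2
      show ?thesis
        by (rule has_derivative_eq_rhs[OF has_derivative_transform_within_open[OF has_derivative_const[of 0] gt]])
           (use 2 in auto)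
    next
      case 3
      have "Der f x = (\<lambda>v. 0)"
        using vanishes_to_order_derivative[OF f van, THEN vanishes_to_order_0] x 3 by blast
      moreover have "f x = 0" using vanishes_to_order_0[OF van x 3] .
      ultimately have "((\<lambda>y. norm (f y) / norm (y - x)) \<longlongrightarrow> 0) (at x)"
        using fx by (simp add: has_derivative_iff_norm)
      then have "((\<lambda>y. norm (if l y < 0 then f y else 0) / norm (y - x)) \<longlongrightarrow> 0) (at x)"
        by (rule tendsto_0_le[where K = 1]) (auto intro!: always_eventually)
      then show ?thesis using 3 by (simp add: has_derivative_iff_norm)
    qed
  qed
  have "Ck_on k (\<lambda>x. if l x < 0 then f x else 0) S" for k
    using assms
  proof (induction k arbitrary: f)
    case (0 f)
    then show ?case
      using der[OF 0] by (auto intro!: continuous_at_imp_continuous_on has_derivative_continuous)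
  next
    case (Suc k f)
    show ?case
    proof (rule Ck_on_SucI[OF S der[OF Suc.prems]])
      show "Ck_on k (\<lambda>x. if l x < 0 then Der f x v else 0) S" for v
        using Suc.prems(1) vanishes_to_order_derivative[OF Suc.prems] by (intro Suc.IH smooth_on_derivative) auto
    qed
  qed
  then show ?thesis by (simp add: smooth_on_def)
qed

end

section \<open>Integral surfaces of commuting vector fields\<close>

lemma norm_diff_le_vector_derivative_bound:
  fixes f :: "real \<Rightarrow> 'a::real_normed_vector"
  assumes "\<And>t. t \<in> {a..b} \<Longrightarrow> (f has_vector_derivative f' t) (at t within {a..b})"
    and "\<And>t. t \<in> {a..b} \<Longrightarrow> norm (f' t) \<le> B" and "s \<in> {a..b}" "t \<in> {a..b}"
  shows "norm (f t - f s) \<le> B * \<bar>t - s\<bar>"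
proof -
  have "norm (f t - f s) \<le> B * norm (t - s)"
  proof (rule differentiable_bound[where S = "{a..b}" and f' = "\<lambda>t h. h *\<^sub>R f' t"])
    show "(f has_derivative (\<lambda>h. h *\<^sub>R f' t)) (at t within {a..b})" if "t \<in> {a..b}" for t
      using assms(1)[OF that] by (simp add: has_vector_derivative_def)
    show "onorm (\<lambda>h. h *\<^sub>R f' t) \<le> B" if "t \<in> {a..b}" for t
      using assms(2)[OF that] onorm_scaleR_left[OF bounded_linear_ident, of "f' t"] onorm_id[where 'a = real]
      by (simp add: onorm_bound mult.commute mult_left_mono)
  qed (use assms in auto)
  then show ?thesis by simp
qed

text \<open>On an interval with \<open>K * \<tau> \<le> 1/2\<close> the contribution of the maximum
  of \<open>norm (f t)\<close> can be absorbed on the left-hand side, so a factor 2 takes the place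
  of an exponential.\<close>

lemma short_time_gronwall:
  fixes f :: "real \<Rightarrow> 'a::real_normed_vector"
  assumes der: "\<And>t. t \<in> {-\<tau>..\<tau>} \<Longrightarrow> (f has_vector_derivative f' t) (at t within {-\<tau>..\<tau>})"
    and bd: "\<And>t. t \<in> {-\<tau>..\<tau>} \<Longrightarrow> norm (f' t) \<le> K * norm (f t) + \<eta>"
    and K: "0 \<le> K" "K * \<tau> \<le> 1/2" and \<tau>: "0 < \<tau>" and t: "t \<in> {-\<tau>..\<tau>}"
  shows "norm (f t) \<le> 2 * (norm (f 0) + \<tau> * \<eta>)"
proof -
  have "continuous_on {-\<tau>..\<tau>} f"
    using der by (rule continuous_on_vector_derivative)
  then have "continuous_on {-\<tau>..\<tau>} (\<lambda>t. norm (f t))" by (rule continuous_on_norm)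
  then obtain m where m: "m \<in> {-\<tau>..\<tau>}" "\<And>t. t \<in> {-\<tau>..\<tau>} \<Longrightarrow> norm (f t) \<le> norm (f m)"
    using continuous_attains_sup[of "{-\<tau>..\<tau>}" "\<lambda>t. norm (f t)"] \<tau> by auto
  have B: "norm (f' t) \<le> K * norm (f m) + \<eta>" if "t \<in> {-\<tau>..\<tau>}" for t
    using bd[OF that] m(2)[OF that] mult_left_mono[OF m(2)[OF that] K(1)] by linarith
  have nn: "0 \<le> K * norm (f m) + \<eta>" using B[OF m(1)] norm_ge_zero order_trans by blast
  have "norm (f m - f 0) \<le> (K * norm (f m) + \<eta>) * \<bar>m - 0\<bar>"
    using der B m(1) \<tau> by (intro norm_diff_le_vector_derivative_bound[where a = "-\<tau>" and b = \<tau>]) auto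
  also have "\<dots> \<le> (K * norm (f m) + \<eta>) * \<tau>"
    using m(1) nn by (intro mult_left_mono) auto
  also have "\<dots> = (K * \<tau>) * norm (f m) + \<tau> * \<eta>" by (simp add: algebra_simps)
  also have "\<dots> \<le> norm (f m) / 2 + \<tau> * \<eta>"
    using mult_right_mono[OF K(2), of "norm (f m)"] by simp
  finally have "norm (f m) \<le> 2 * (norm (f 0) + \<tau> * \<eta>)"
    using norm_triangle_ineq2[of "f m" "f 0"] by (simp add: algebra_simps)
  with m(2)[OF t] show ?thesis by linarith
qed

text \<open>Picard iteration is a contraction with factor 1/2 because
  \<open>K * \<tau> \<le> 1/2\<close>, and \<open>C * \<tau> \<le> R\<close> keeps the iterates in
  the ball.\<close>

lemma picard_lindelof:
  fixes Y :: "'a::banach \<Rightarrow> 'a"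
  assumes lip: "\<And>x y. x \<in> cball x0 R \<Longrightarrow> y \<in> cball x0 R \<Longrightarrow> norm (Y x - Y y) \<le> K * norm (x - y)"
    and bd: "\<And>x. x \<in> cball x0 R \<Longrightarrow> norm (Y x) \<le> C"
    and \<tau>: "0 < \<tau>" "C * \<tau> \<le> R" "K * \<tau> \<le> 1/2" and R: "0 \<le> R" and K: "0 \<le> K"
  shows "\<exists>f. f 0 = x0 \<and> (\<forall>t\<in>{-\<tau>..\<tau>}. f t \<in> cball x0 R \<and>
    (f has_vector_derivative Y (f t)) (at t within {-\<tau>..\<tau>}))"
proof -
  define I where "I = {-\<tau>..\<tau>}"
  \<comment> \<open>Clamping time to the interval lets the iteration run in the complete space of
    bounded continuous functions on the whole real line.\<close>
  define c where "c t = max (-\<tau>) (min \<tau> t)" for t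
  define S :: "(real \<Rightarrow>\<^sub>C 'a) set" where "S = PiC UNIV (\<lambda>_. cball x0 R)"
  define G where "G f t = integral {-\<tau>..t} (\<lambda>u. Y (apply_bcontfun f u))" for f t
  \<comment> \<open>Integrating from \<open>-\<tau>\<close> and subtracting the value at 0 gives the
    integral from 0 to \<open>t\<close> for both signs of \<open>t\<close>.\<close>
  define T where "T f t = x0 + (G f (c t) - G f 0)" for f t
  have cI: "c t \<in> I" "0 \<in> I" for t using \<tau>(1) by (auto simp: c_def I_def)
  have c_id: "c t = t" if "t \<in> I" for t using that by (auto simp: c_def I_def)
  have c_abs: "\<bar>c t\<bar> \<le> \<tau>" for t using \<tau>(1) by (auto simp: c_def)
  have C: "0 \<le> C" using order_trans[OF norm_ge_zero bd[of x0]] R by simp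
  have inS: "apply_bcontfun f t \<in> cball x0 R" if "f \<in> S" for f t
    using that by (auto simp: S_def mem_PiC_iff)
  have contY: "continuous_on (cball x0 R) Y"
  proof (rule lipschitz_on_continuous_on)
    show "K-lipschitz_on (cball x0 R) Y" using lip K by (auto intro!: lipschitz_onI simp: dist_norm)
  qed
  have contYf: "continuous_on UNIV (\<lambda>u. Y (apply_bcontfun f u))" if "f \<in> S" for f
    using inS[OF that] by (intro continuous_on_compose2[OF contY]) auto
  have derG: "(G f has_vector_derivative Y (apply_bcontfun f t)) (at t within I)" if "f \<in> S" "t \<in> I" for f t
    unfolding G_def I_def
    by (rule integral_has_vector_derivative) (use contYf[OF that(1)] that(2) in \<open>auto simp: I_def intro: continuous_on_subset\<close>)
  have T_in_ball: "T f t \<in> cball x0 R" if "f \<in> S" for f t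
  proof -
    have "norm (G f (c t) - G f 0) \<le> C * \<bar>c t - 0\<bar>"
      using derG[OF that] bd[OF inS[OF that]] cI unfolding I_def
      by (intro norm_diff_le_vector_derivative_bound[where a = "-\<tau>" and b = \<tau>]) auto
    also have "\<dots> \<le> C * \<tau>" using c_abs C by (intro mult_left_mono) auto
    finally show ?thesis using \<tau>(2) by (simp add: T_def dist_norm norm_minus_commute)
  qed
  have T_bcont: "T f \<in> bcontfun" if "f \<in> S" for f
  proof -
    have "continuous_on I (G f)" using derG[OF that] by (rule continuous_on_vector_derivative)
    then have "continuous_on UNIV (\<lambda>t. G f (c t))"
      by (rule continuous_on_compose2) (use cI in \<open>auto simp: c_def intro!: continuous_intros\<close>)
    then have "continuous_on UNIV (T f)" unfolding T_def by (intro continuous_intros)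
    moreover have "range (T f) \<subseteq> cball x0 R" using T_in_ball[OF that] by auto
    then have "bounded (range (T f))" using bounded_cball bounded_subset by blast
    ultimately show ?thesis by (simp add: bcontfun_def)
  qed
  have apply_T: "apply_bcontfun (Bcontfun (T f)) = T f" if "f \<in> S" for f
    using T_bcont[OF that] by (simp add: Bcontfun_inverse)
  have "\<exists>!f\<in>S. Bcontfun (T f) = f"
  proof (rule Banach_fix[where c = "1/2"])
    show "complete S" by (simp add: S_def complete_eq_closed closed_PiC)
    have "const_bcontfun x0 \<in> S" using R by (simp add: S_def mem_PiC_iff const_bcontfun.rep_eq)
    then show "S \<noteq> {}" by auto
    show "(\<lambda>f. Bcontfun (T f)) ` S \<subseteq> S"
      using apply_T T_in_ball by (auto simp: S_def mem_PiC_iff)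
    show "dist (Bcontfun (T f)) (Bcontfun (T g)) \<le> 1/2 * dist f g" if f: "f \<in> S" and g: "g \<in> S" for f g
    proof (rule dist_bound)
      fix t
      have "norm (G f (c t) - G g (c t) - (G f 0 - G g 0)) \<le> K * dist f g * \<bar>c t - 0\<bar>"
      proof (rule norm_diff_le_vector_derivative_bound[where a = "-\<tau>" and b = \<tau>])
        show "((\<lambda>t. G f t - G g t) has_vector_derivative Y (apply_bcontfun f s) - Y (apply_bcontfun g s)) (at s within {-\<tau>..\<tau>})"
          if "s \<in> {-\<tau>..\<tau>}" for s
          using derG[OF f] derG[OF g] that unfolding I_def by (intro has_vector_derivative_diff) auto
        show "norm (Y (apply_bcontfun f s) - Y (apply_bcontfun g s)) \<le> K * dist f g" for s
          using lip[OF inS[OF f, of s] inS[OF g, of s]] mult_left_mono[OF dist_bounded[of f s g] K]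
          by (simp add: dist_norm)
      qed (use cI in \<open>auto simp: I_def\<close>)
      also have "\<dots> \<le> K * dist f g * \<tau>" using c_abs K by (intro mult_left_mono) auto
      also have "\<dots> \<le> 1/2 * dist f g" using mult_right_mono[OF \<tau>(3), of "dist f g"] by (simp add: mult_ac)
      finally show "dist (apply_bcontfun (Bcontfun (T f)) t) (apply_bcontfun (Bcontfun (T g)) t) \<le> 1/2 * dist f g"
        by (simp add: apply_T f g T_def dist_norm algebra_simps)
    qed
  qed auto
  then obtain f where f: "f \<in> S" "Bcontfun (T f) = f" by blast
  then have fT: "apply_bcontfun f t = T f t" for t using apply_T by metis
  show ?thesis
  proof (intro exI[of _ "apply_bcontfun f"] conjI ballI)
    show "apply_bcontfun f 0 = x0" using fT[of 0] c_id cI by (simp add: T_def)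
    show "apply_bcontfun f t \<in> cball x0 R" for t using inS[OF f(1)] .
    show "(apply_bcontfun f has_vector_derivative Y (apply_bcontfun f t)) (at t within {-\<tau>..\<tau>})"
      if t: "t \<in> {-\<tau>..\<tau>}" for t
    proof (rule has_vector_derivative_transform[OF t])
      show "((\<lambda>s. x0 + (G f s - G f 0)) has_vector_derivative Y (apply_bcontfun f t)) (at t within {-\<tau>..\<tau>})"
        using derG[OF f(1)] t unfolding I_def by (auto intro!: derivative_eq_intros)
      show "apply_bcontfun f s = x0 + (G f s - G f 0)" if "s \<in> {-\<tau>..\<tau>}" for s
        using fT[of s] c_id[of s] that by (simp add: T_def I_def)
    qed
  qed
qed

section \<open>Uniform estimates on compact convex sets\<close>

lemma linear_norm_le_sum_Basis:
  fixes L :: "'a::euclidean_space \<Rightarrow> 'b::real_normed_vector"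
  assumes "linear L"
  shows "norm (L v) \<le> (\<Sum>b\<in>Basis. norm (L b)) * norm v"
proof -
  have "L v = L (\<Sum>b\<in>Basis. (v \<bullet> b) *\<^sub>R b)" by (simp add: euclidean_representation)
  also have "\<dots> = (\<Sum>b\<in>Basis. (v \<bullet> b) *\<^sub>R L b)"
    by (simp add: linear_sum[OF assms] linear_scale[OF assms])
  finally have "norm (L v) \<le> (\<Sum>b\<in>Basis. norm ((v \<bullet> b) *\<^sub>R L b))"
    using norm_sum[of "\<lambda>b. (v \<bullet> b) *\<^sub>R L b" Basis] by simp
  also have "\<dots> \<le> (\<Sum>b\<in>Basis. norm (L b) * norm v)"
  proof (rule sum_mono)
    show "norm ((v \<bullet> b) *\<^sub>R L b) \<le> norm (L b) * norm v" if "b \<in> Basis" for b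
      using mult_right_mono[OF Basis_le_norm[OF that, of v], of "norm (L b)"] by (simp add: mult.commute)
  qed
  finally show ?thesis by (simp add: sum_distrib_right)
qed

lemma smooth_on_compact_bounds:
  fixes f :: "'a::euclidean_space \<Rightarrow> 'b::real_normed_vector"
  assumes f: "smooth_on f S" and A: "compact A" "convex A" "A \<subseteq> S"
  obtains K where "0 < K" "\<And>x. x \<in> A \<Longrightarrow> norm (f x) \<le> K"
    "\<And>x v. x \<in> A \<Longrightarrow> norm (Der f x v) \<le> K * norm v"
    "\<And>x y. x \<in> A \<Longrightarrow> y \<in> A \<Longrightarrow> norm (f x - f y) \<le> K * norm (x - y)"
proof -
  have bdd: "\<exists>M. \<forall>x\<in>A. norm (g x) \<le> M" if "smooth_on g S" for g :: "'a \<Rightarrow> 'b"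
  proof -
    have "continuous_on A g" using smooth_on_continuous_on[OF that] A(3) continuous_on_subset by blast
    then have "bounded (g ` A)" using A(1) compact_continuous_image compact_imp_bounded by blast
    then show ?thesis by (auto simp: bounded_iff)
  qed
  obtain M0 where M0: "\<And>x. x \<in> A \<Longrightarrow> norm (f x) \<le> M0" using bdd[OF f] by blast
  have "\<forall>b. \<exists>M. \<forall>x\<in>A. norm (Der f x b) \<le> M"
    using bdd[OF smooth_on_derivative[OF f]] by blast
  then obtain M where M: "\<And>b x. x \<in> A \<Longrightarrow> norm (Der f x b) \<le> M b" by metis
  define K where "K = max 1 (max M0 (\<Sum>b\<in>Basis. M b))"
  have D: "norm (Der f x v) \<le> K * norm v" if "x \<in> A" for x v
  proof -
    have "norm (Der f x v) \<le> (\<Sum>b\<in>Basis. norm (Der f x b)) * norm v"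
      using smooth_on_linear_derivative[OF f] A(3) that by (intro linear_norm_le_sum_Basis) auto
    also have "\<dots> \<le> (\<Sum>b\<in>Basis. M b) * norm v"
      using M[OF that] by (intro mult_right_mono sum_mono) auto
    also have "\<dots> \<le> K * norm v" by (intro mult_right_mono) (auto simp: K_def)
    finally show ?thesis .
  qed
  show thesis
  proof (rule that[of K])
    show "0 < K" by (simp add: K_def)
    show "norm (f x) \<le> K" if "x \<in> A" for x using M0[OF that] by (simp add: K_def)
    show "norm (Der f x v) \<le> K * norm v" if "x \<in> A" for x v using D that .
    show "norm (f x - f y) \<le> K * norm (x - y)" if "x \<in> A" "y \<in> A" for x y
    proof (rule differentiable_bound[OF A(2) _ _ that])
      show "(f has_derivative Der f z) (at z within A)" if "z \<in> A" for z
        using smooth_on_has_derivative[OF f] A(3) that has_derivative_at_withinI by blast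
      show "onorm (Der f z) \<le> K" if "z \<in> A" for z
        using D[OF that] by (rule onorm_le)
    qed
  qed
qed

text \<open>The finitely many derivatives in \<open>Basis\<close> directions are uniformly
  continuous on the compact set, so one radius controls the first-order remainder at all base
  points.\<close>

lemma smooth_on_uniform_linearization:
  fixes f :: "'a::euclidean_space \<Rightarrow> 'b::real_normed_vector"
  assumes f: "smooth_on f S" and A: "compact A" "convex A" "A \<subseteq> S" and "0 < e"
  obtains d where "0 < d"
    "\<And>x y. x \<in> A \<Longrightarrow> y \<in> A \<Longrightarrow> dist x y < d \<Longrightarrow> norm (f y - f x - Der f x (y - x)) \<le> e * norm (y - x)"
proof -
  let ?D = "\<lambda>x. Der f x"
  define e' where "e' = e / (real (card (Basis :: 'a set)) + 1)"
  have e': "0 < e'" using \<open>0 < e\<close> by (simp add: e'_def)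
  have "\<exists>d>0. \<forall>x\<in>A. \<forall>y\<in>A. dist y x < d \<longrightarrow> dist (?D y b) (?D x b) < e'" for b
  proof -
    have "continuous_on A (\<lambda>x. ?D x b)"
      using smooth_on_continuous_on[OF smooth_on_derivative[OF f]] A(3) continuous_on_subset by blast
    then have "uniformly_continuous_on A (\<lambda>x. ?D x b)" using A(1) compact_uniformly_continuous by blast
    then show ?thesis using e' unfolding uniformly_continuous_on_def by blast
  qed
  then obtain d where d: "\<And>b. 0 < d b"
    "\<And>b x y. x \<in> A \<Longrightarrow> y \<in> A \<Longrightarrow> dist y x < d b \<Longrightarrow> dist (?D y b) (?D x b) < e'" by metis
  define d0 where "d0 = Min (d ` Basis)"
  have d0: "0 < d0" using d(1) by (simp add: d0_def)
  have d0_le: "d0 \<le> d b" if "b \<in> Basis" for b using that by (simp add: d0_def)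
  have D: "onorm (\<lambda>v. ?D y v - ?D x v) \<le> e" if xy: "x \<in> A" "y \<in> A" "dist y x < d0" for x y
  proof (rule onorm_le)
    fix v
    have "linear (\<lambda>v. ?D y v - ?D x v)"
      using xy A(3) smooth_on_linear_derivative[OF f] by (intro linear_compose_sub) auto
    then have "norm (?D y v - ?D x v) \<le> (\<Sum>b\<in>Basis. norm (?D y b - ?D x b)) * norm v"
      by (rule linear_norm_le_sum_Basis)
    also have "\<dots> \<le> (\<Sum>b\<in>(Basis :: 'a set). e') * norm v"
    proof (intro mult_right_mono sum_mono)
      show "norm (?D y b - ?D x b) \<le> e'" if "b \<in> Basis" for b
        using d(2)[OF xy(1,2), of b] d0_le[OF that] xy(3) by (simp add: dist_norm)
    qed simp
    also have "\<dots> \<le> e * norm v"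
      using \<open>0 < e\<close> by (intro mult_right_mono) (auto simp: e'_def field_simps)
    finally show "norm (?D y v - ?D x v) \<le> e * norm v" .
  qed
  show thesis
  proof (rule that[OF d0])
    fix x y assume xy: "x \<in> A" "y \<in> A" "dist x y < d0"
    have "norm (f y - f x - ?D x (y - x)) \<le> norm (y - x) * e"
    proof (rule differentiable_bound_linearization[where S = "A \<inter> ball x d0"])
      show "x + t *\<^sub>R (y - x) \<in> A \<inter> ball x d0" if "t \<in> {0..1}" for t
      proof
        have "(1 - t) *\<^sub>R x + t *\<^sub>R y \<in> A" using A(2) xy that by (intro convexD) auto
        then show "x + t *\<^sub>R (y - x) \<in> A" by (simp add: algebra_simps)
        have "norm (t *\<^sub>R (y - x)) \<le> norm (y - x)" using that by (simp add: mult_left_le_one_le)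
        then show "x + t *\<^sub>R (y - x) \<in> ball x d0" using xy(3) by (simp add: dist_norm norm_minus_commute)
      qed
      show "(f has_derivative ?D z) (at z within A \<inter> ball x d0)" if "z \<in> A \<inter> ball x d0" for z
        using smooth_on_has_derivative[OF f] A(3) that has_derivative_at_withinI by blast
      show "onorm (?D z - ?D x) \<le> e" if "z \<in> A \<inter> ball x d0" for z
        using D[of x z] that xy by (auto simp: fun_diff_def dist_commute)
      show "x \<in> A \<inter> ball x d0" using xy d0 by auto
    qed
    then show "norm (f y - f x - ?D x (y - x)) \<le> e * norm (y - x)" by (simp add: mult.commute)
  qed
qed

text \<open>The surface first follows \<open>X\<close> from the starting point and then
  \<open>Y\<close>. Only the \<open>s\<close>-derivative is in question: for a small step the defect
  from motion along \<open>X\<close> obeys, because the bracket vanishes, a nearly linear equation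
  in \<open>t\<close> with small initial value, and the Gronwall estimate controls it.
  Differentiability of a flow in its initial value is thus never invoked.\<close>

lemma commuting_fields_integral_surface:
  fixes X Y :: "'a::euclidean_space \<Rightarrow> 'a"
  assumes B: "open B" "y0 \<in> B" and X: "smooth_on X B" and Y: "smooth_on Y B"
    and comm: "\<And>x. x \<in> B \<Longrightarrow> lie_bracket X Y x = 0"
  shows "\<exists>\<tau>>0. \<exists>\<delta>>0. \<forall>x0\<in>ball y0 \<delta>. \<exists>\<Gamma>. \<Gamma> (0, 0) = x0 \<and>
       (\<forall>s t. \<bar>s\<bar> < \<tau> \<longrightarrow> \<bar>t\<bar> < \<tau> \<longrightarrow> \<Gamma> (s, t) \<in> B \<and>
          (\<Gamma> has_derivative (\<lambda>(h, k). h *\<^sub>R X (\<Gamma> (s, t)) + k *\<^sub>R Y (\<Gamma> (s, t)))) (at (s, t)))"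
    (is "\<exists>\<tau>>0. \<exists>\<delta>>0. \<forall>x0\<in>ball y0 \<delta>. ?S \<tau> x0")
proof -
  obtain r where r: "0 < r" "cball y0 r \<subseteq> B" using B open_contains_cball by blast
  \<comment> \<open>The starting point, the \<open>X\<close>-curve and the \<open>Y\<close>-curve
    each use up at most one third of the radius.\<close>
  define R where "R = r / 3"
  have R: "0 < R" using r by (simp add: R_def)
  let ?A = "cball y0 r"
  let ?DX = "\<lambda>x. Der X x" and ?DY = "\<lambda>x. Der Y x"
  have A: "compact ?A" "convex ?A" by auto
  obtain KX where KX: "0 < KX" "\<And>x. x \<in> ?A \<Longrightarrow> norm (X x) \<le> KX"
    "\<And>x y. x \<in> ?A \<Longrightarrow> y \<in> ?A \<Longrightarrow> norm (X x - X y) \<le> KX * norm (x - y)"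
    using smooth_on_compact_bounds[OF X A r(2)] by metis
  obtain KY where KY: "0 < KY" "\<And>x. x \<in> ?A \<Longrightarrow> norm (Y x) \<le> KY"
    "\<And>x v. x \<in> ?A \<Longrightarrow> norm (?DY x v) \<le> KY * norm v"
    "\<And>x y. x \<in> ?A \<Longrightarrow> y \<in> ?A \<Longrightarrow> norm (Y x - Y y) \<le> KY * norm (x - y)"
    using smooth_on_compact_bounds[OF Y A r(2)] by metis
  define K where "K = max KX KY"
  have K: "0 < K" "KX \<le> K" "KY \<le> K" using KX(1) by (auto simp: K_def)
  define \<tau> where "\<tau> = min (R / K) (1 / (2 * K))"
  have \<tau>: "0 < \<tau>" using R K by (simp add: \<tau>_def)
  have "K * \<tau> \<le> R" "K * \<tau> \<le> 1/2"
    using K(1) by (auto simp: \<tau>_def min_def field_simps)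
  then have K\<tau>: "KX * \<tau> \<le> R" "KX * \<tau> \<le> 1/2" "KY * \<tau> \<le> R" "KY * \<tau> \<le> 1/2"
    using mult_right_mono[OF K(2), of \<tau>] mult_right_mono[OF K(3), of \<tau>] \<tau> by linarith+
  let ?I = "{-\<tau>..\<tau>}"
  have "?S \<tau> x0"
    if x0: "x0 \<in> ball y0 R" for x0
  proof -
    have sub1: "cball x0 R \<subseteq> ?A"
    proof
      fix y assume "y \<in> cball x0 R"
      then show "y \<in> ?A" using x0 r dist_triangle[of y0 y x0] by (simp add: R_def)
    qed
    have "\<exists>\<alpha>. \<alpha> 0 = x0 \<and> (\<forall>s\<in>?I. \<alpha> s \<in> cball x0 R \<and>
        (\<alpha> has_vector_derivative X (\<alpha> s)) (at s within ?I))"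
      by (rule picard_lindelof[where K = KX and C = KX]) (use KX subsetD[OF sub1] K\<tau> \<tau> R in \<open>auto simp del: mem_cball\<close>)
    then obtain \<alpha> where \<alpha>: "\<alpha> 0 = x0" "\<And>s. s \<in> ?I \<Longrightarrow> \<alpha> s \<in> cball x0 R"
      "\<And>s. s \<in> ?I \<Longrightarrow> (\<alpha> has_vector_derivative X (\<alpha> s)) (at s within ?I)" by blast
    have sub2: "cball (\<alpha> s) R \<subseteq> ?A" if "s \<in> ?I" for s
    proof
      fix y assume "y \<in> cball (\<alpha> s) R"
      then have "dist y0 y \<le> R + R + R"
        using \<alpha>(2)[OF that] x0 dist_triangle[of y0 y x0] dist_triangle[of x0 y "\<alpha> s"] by auto
      then show "y \<in> ?A" by (simp add: R_def)
    qed
    have "\<exists>\<beta>. \<beta> 0 = \<alpha> s \<and> (\<forall>t\<in>?I. \<beta> t \<in> ?A \<and> (\<beta> has_vector_derivative Y (\<beta> t)) (at t within ?I))"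
      if s: "s \<in> ?I" for s
    proof -
      have "\<exists>\<beta>. \<beta> 0 = \<alpha> s \<and> (\<forall>t\<in>?I. \<beta> t \<in> cball (\<alpha> s) R \<and>
          (\<beta> has_vector_derivative Y (\<beta> t)) (at t within ?I))"
        by (rule picard_lindelof[where K = KY and C = KY]) (use KY subsetD[OF sub2[OF s]] K\<tau> \<tau> R in \<open>auto simp del: mem_cball\<close>)
      with sub2[OF s] show ?thesis by blast
    qed
    then obtain \<beta> where \<beta>: "\<And>s. s \<in> ?I \<Longrightarrow> \<beta> s 0 = \<alpha> s"
      "\<And>s t. s \<in> ?I \<Longrightarrow> t \<in> ?I \<Longrightarrow> \<beta> s t \<in> ?A"
      "\<And>s t. s \<in> ?I \<Longrightarrow> t \<in> ?I \<Longrightarrow> (\<beta> s has_vector_derivative Y (\<beta> s t)) (at t within ?I)"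
      by metis
    have X\<alpha>: "norm (X (\<alpha> s)) \<le> KX" if "s \<in> ?I" for s using KX(2) sub1 \<alpha>(2)[OF that] by blast
    have I0: "0 \<in> ?I" using \<tau> by simp
    have lip_s: "norm (\<beta> s' t - \<beta> s t) \<le> 2 * KX * \<bar>s' - s\<bar>" if s: "s \<in> ?I" "s' \<in> ?I" and t: "t \<in> ?I" for s s' t
    proof -
      have "norm (\<beta> s' t - \<beta> s t) \<le> 2 * (norm (\<beta> s' 0 - \<beta> s 0) + \<tau> * 0)"
      proof (rule short_time_gronwall[where \<tau> = \<tau> and K = KY])
        show "((\<lambda>t. \<beta> s' t - \<beta> s t) has_vector_derivative Y (\<beta> s' t) - Y (\<beta> s t)) (at t within ?I)"
          if "t \<in> ?I" for t using \<beta>(3) s that by (intro has_vector_derivative_diff) auto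
        show "norm (Y (\<beta> s' t) - Y (\<beta> s t)) \<le> KY * norm (\<beta> s' t - \<beta> s t) + 0" if "t \<in> ?I" for t
          using KY(4) \<beta>(2) s that by simp
      qed (use K\<tau> KY \<tau> t in auto)
      also have "norm (\<beta> s' 0 - \<beta> s 0) \<le> KX * \<bar>s' - s\<bar>"
        unfolding \<beta>(1)[OF s(1)] \<beta>(1)[OF s(2)] using \<alpha>(3) X\<alpha> s
        by (intro norm_diff_le_vector_derivative_bound[where a = "-\<tau>" and b = \<tau>]) auto
      finally show ?thesis by simp
    qed
    have lip_t: "norm (\<beta> s t' - \<beta> s t) \<le> KY * \<bar>t' - t\<bar>" if "s \<in> ?I" "t \<in> ?I" "t' \<in> ?I" for s t t'
      using \<beta>(2,3) KY(2) that by (intro norm_diff_le_vector_derivative_bound[where a = "-\<tau>" and b = \<tau>]) auto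
    have ds: "((\<lambda>s. \<beta> s t) has_vector_derivative X (\<beta> s t)) (at s within ?I)"
      if s: "s \<in> ?I" and t: "t \<in> ?I" for s t
      unfolding has_vector_derivative_def has_derivative_within_alt
    proof (intro conjI allI impI)
      show "bounded_linear (\<lambda>h. h *\<^sub>R X (\<beta> s t))" by (rule bounded_linear_scaleR_left)
      fix e :: real assume e: "0 < e"
      \<comment> \<open>The Gronwall bound is the sum of twice \<open>e2\<close> and of
        \<open>4 * KX * \<tau> * e1\<close>, each at most \<open>e / 2\<close>; the summand 4 keeps
        the denominator positive.\<close>
      define e1 where "e1 = e / (8 * KX * \<tau> + 4)"
      define e2 where "e2 = e / 4"
      have e2: "0 < e2" using e by (simp add: e2_def)
      have pos: "0 < 8 * KX * \<tau> + 4" using KX(1) \<tau> by (intro add_nonneg_pos) auto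
      have e1: "0 < e1" "\<tau> * (4 * KX * e1) \<le> e / 2"
        using e pos KX(1) \<tau> by (auto simp: e1_def field_simps)
      obtain dX where dX: "0 < dX" "\<And>x y. x \<in> ?A \<Longrightarrow> y \<in> ?A \<Longrightarrow> dist x y < dX \<Longrightarrow>
          norm (X y - X x - ?DX x (y - x)) \<le> e1 * norm (y - x)"
        using smooth_on_uniform_linearization[OF X A r(2) e1(1)] by metis
      obtain dY where dY: "0 < dY" "\<And>x y. x \<in> ?A \<Longrightarrow> y \<in> ?A \<Longrightarrow> dist x y < dY \<Longrightarrow>
          norm (Y y - Y x - ?DY x (y - x)) \<le> e1 * norm (y - x)"
        using smooth_on_uniform_linearization[OF Y A r(2) e1(1)] by metis
      have "\<exists>d>0. \<forall>s'\<in>?I. norm (s' - s) < d \<longrightarrow> norm (\<alpha> s' - \<alpha> s - (s' - s) *\<^sub>R X (\<alpha> s)) \<le> e2 * norm (s' - s)"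
        using \<alpha>(3)[OF s] e2 unfolding has_vector_derivative_def has_derivative_within_alt by blast
      then obtain d\<alpha> where d\<alpha>: "0 < d\<alpha>"
        "\<And>s'. s' \<in> ?I \<Longrightarrow> \<bar>s' - s\<bar> < d\<alpha> \<Longrightarrow> norm (\<alpha> s' - \<alpha> s - (s' - s) *\<^sub>R X (\<alpha> s)) \<le> e2 * \<bar>s' - s\<bar>"
        by auto
      define d where "d = min d\<alpha> (dY / (2 * KX))"
      have d: "0 < d" using d\<alpha>(1) dY(1) KX(1) by (simp add: d_def)
      have "norm (\<beta> s' t - \<beta> s t - (s' - s) *\<^sub>R X (\<beta> s t)) \<le> e * \<bar>s' - s\<bar>"
        if s': "s' \<in> ?I" and near: "\<bar>s' - s\<bar> < d" for s'
      proof -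
        define h where "h = s' - s"
        have small: "dist (\<beta> s t) (\<beta> s' t) < dY" if "t \<in> ?I" for t
        proof -
          have "dist (\<beta> s t) (\<beta> s' t) \<le> 2 * KX * \<bar>s' - s\<bar>"
            using lip_s[OF s s' that] by (simp add: dist_norm norm_minus_commute)
          also have "\<dots> < dY" using near KX(1) by (simp add: d_def field_simps)
          finally show ?thesis .
        qed
        have "norm (\<beta> s' t - \<beta> s t - h *\<^sub>R X (\<beta> s t))
            \<le> 2 * (norm (\<beta> s' 0 - \<beta> s 0 - h *\<^sub>R X (\<beta> s 0)) + \<tau> * (2 * KX * e1 * \<bar>h\<bar>))"
        proof (rule short_time_gronwall[where \<tau> = \<tau> and K = KY])
          fix t assume t: "t \<in> ?I"
          have x: "\<beta> s t \<in> ?A" "\<beta> s' t \<in> ?A" "\<beta> s t \<in> B" using \<beta>(2) s s' t r(2) by auto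
          have "((\<lambda>t. X (\<beta> s t)) has_vector_derivative ?DX (\<beta> s t) (Y (\<beta> s t))) (at t within ?I)"
            using vector_derivative_diff_chain_within[OF \<beta>(3)[OF s t],
                OF has_derivative_at_withinI[OF smooth_on_has_derivative[OF X x(3)]]]
            by (simp add: o_def)
          then show "((\<lambda>t. \<beta> s' t - \<beta> s t - h *\<^sub>R X (\<beta> s t)) has_vector_derivative
              Y (\<beta> s' t) - Y (\<beta> s t) - h *\<^sub>R ?DX (\<beta> s t) (Y (\<beta> s t))) (at t within ?I)"
            using \<beta>(3)[OF s t] \<beta>(3)[OF s' t] by (auto intro!: derivative_eq_intros)
          interpret linear "?DY (\<beta> s t)" using smooth_on_linear_derivative[OF Y x(3)] .
          \<comment> \<open>The only use of commutation: the time derivative of \<open>X\<close>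
            along the \<open>Y\<close>-curve becomes the linearization of \<open>Y\<close> applied
            to \<open>X\<close>, so the defect satisfies the linearized equation up to the
            remainder.\<close>
          have "?DX (\<beta> s t) (Y (\<beta> s t)) = ?DY (\<beta> s t) (X (\<beta> s t))"
            using comm[OF x(3)] by (simp add: lie_bracket_def)
          then have "Y (\<beta> s' t) - Y (\<beta> s t) - h *\<^sub>R ?DX (\<beta> s t) (Y (\<beta> s t)) =
              (Y (\<beta> s' t) - Y (\<beta> s t) - ?DY (\<beta> s t) (\<beta> s' t - \<beta> s t))
              + ?DY (\<beta> s t) (\<beta> s' t - \<beta> s t - h *\<^sub>R X (\<beta> s t))"
            by (simp add: diff scale)
          also have "norm \<dots> \<le> e1 * norm (\<beta> s' t - \<beta> s t) + KY * norm (\<beta> s' t - \<beta> s t - h *\<^sub>R X (\<beta> s t))"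
            using dY(2)[OF x(1,2) small[OF t]] KY(3)[OF x(1), of "\<beta> s' t - \<beta> s t - h *\<^sub>R X (\<beta> s t)"] by (rule norm_triangle_mono)
          also have "e1 * norm (\<beta> s' t - \<beta> s t) \<le> e1 * (2 * KX * \<bar>h\<bar>)"
            unfolding h_def using lip_s[OF s s' t] e1(1) by (intro mult_left_mono) auto
          finally show "norm (Y (\<beta> s' t) - Y (\<beta> s t) - h *\<^sub>R ?DX (\<beta> s t) (Y (\<beta> s t)))
              \<le> KY * norm (\<beta> s' t - \<beta> s t - h *\<^sub>R X (\<beta> s t)) + 2 * KX * e1 * \<bar>h\<bar>"
            by (simp add: algebra_simps)
        qed (use K\<tau> KY \<tau> t in auto)
        also have "norm (\<beta> s' 0 - \<beta> s 0 - h *\<^sub>R X (\<beta> s 0)) \<le> e2 * \<bar>h\<bar>"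
          unfolding \<beta>(1)[OF s] \<beta>(1)[OF s'] h_def using d\<alpha>(2)[OF s'] near by (simp add: d_def)
        also have "2 * (e2 * \<bar>h\<bar> + \<tau> * (2 * KX * e1 * \<bar>h\<bar>)) = (e / 2 + \<tau> * (4 * KX * e1)) * \<bar>h\<bar>"
          by (simp add: e2_def algebra_simps)
        also have "\<dots> \<le> e * \<bar>h\<bar>" using e1(2) by (intro mult_right_mono) auto
        finally show ?thesis by (simp add: h_def)
      qed
      with d show "\<exists>d>0. \<forall>s'\<in>?I. norm (s' - s) < d \<longrightarrow>
          norm (\<beta> s' t - \<beta> s t - (s' - s) *\<^sub>R X (\<beta> s t)) \<le> e * norm (s' - s)" by auto
    qed
    define \<Gamma> where "\<Gamma> = (\<lambda>(s, t). \<beta> s t)"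
    have "(\<Gamma> has_derivative (\<lambda>(h, k). h *\<^sub>R X (\<Gamma> (s, t)) + k *\<^sub>R Y (\<Gamma> (s, t)))) (at (s, t))"
      if st: "\<bar>s\<bar> < \<tau>" "\<bar>t\<bar> < \<tau>" for s t
    proof -
      have st': "s \<in> ?I" "t \<in> ?I" using st by auto
      \<comment> \<open>Both partial derivatives exist; continuity of the one in \<open>t\<close> is
        enough for a total derivative.\<close>
      have "((\<lambda>(s, t). \<beta> s t) has_derivative
          (\<lambda>(h, k). h *\<^sub>R X (\<beta> s t) + blinfun_apply (blinfun_scaleR_left (Y (\<beta> s t))) k))
          (at (s, t) within ?I \<times> ?I)"
      proof (rule has_derivative_partialsI)
        show "((\<lambda>s. \<beta> s t) has_derivative (\<lambda>h. h *\<^sub>R X (\<beta> s t))) (at s within ?I)"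
          using ds[OF st'] by (simp add: has_vector_derivative_def)
        show "(\<beta> s has_derivative blinfun_apply (blinfun_scaleR_left (Y (\<beta> s t)))) (at t within ?I)"
          if "s \<in> ?I" "t \<in> ?I" for s t
          using \<beta>(3)[OF that] by (simp add: has_vector_derivative_def)
        have cont\<beta>: "continuous_on (?I \<times> ?I) (\<lambda>(s, t). \<beta> s t)"
          unfolding continuous_on_iff
        proof safe
          fix s t and e :: real assume st: "s \<in> ?I" "t \<in> ?I" and e: "0 < e"
          have "dist (\<beta> s' t') (\<beta> s t) < e"
            if "s' \<in> ?I" "t' \<in> ?I" "dist (s', t') (s, t) < e / (2 * KX + KY)" for s' t'
          proof -
            have "\<bar>s' - s\<bar> \<le> dist (s', t') (s, t)" "\<bar>t' - t\<bar> \<le> dist (s', t') (s, t)"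
              using dist_fst_le[of "(s', t')" "(s, t)"] dist_snd_le[of "(s', t')" "(s, t)"]
              by (auto simp: dist_real_def)
            then have "2 * KX * \<bar>s' - s\<bar> + KY * \<bar>t' - t\<bar> \<le> (2 * KX + KY) * dist (s', t') (s, t)"
              using KX(1) KY(1) by (simp add: distrib_right add_mono)
            also have "\<dots> < e" using that(3) KX(1) KY(1) by (simp add: field_simps add_pos_pos)
            finally show ?thesis
              using lip_s[OF st(1) that(1,2)] lip_t[OF st(1,2) that(2)]
                norm_triangle_ineq[of "\<beta> s' t' - \<beta> s t'" "\<beta> s t' - \<beta> s t"]
              by (simp add: dist_norm)
          qed
          moreover have "0 < e / (2 * KX + KY)" using e KX(1) KY(1) by simp
          ultimately show "\<exists>d>0. \<forall>x'\<in>?I \<times> ?I. dist x' (s, t) < d \<longrightarrow>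
              dist (case x' of (s, t) \<Rightarrow> \<beta> s t) (\<beta> s t) < e"
            by (intro exI[of _ "e / (2 * KX + KY)"]) auto
        qed
        have contY: "continuous_on ?A Y"
          using smooth_on_continuous_on[OF Y] r(2) continuous_on_subset by blast
        have "continuous_on (?I \<times> ?I) (\<lambda>p. Y (case p of (s, t) \<Rightarrow> \<beta> s t))"
          by (rule continuous_on_compose2[OF contY cont\<beta>]) (use \<beta>(2) in \<open>auto simp del: mem_cball\<close>)
        then have "continuous_on (?I \<times> ?I) (\<lambda>(s, t). blinfun_scaleR_left (Y (\<beta> s t)))"
          unfolding case_prod_beta
          by (rule bounded_linear.continuous_on[OF bounded_linear_blinfun_scaleR_left])
        then show "continuous (at (s, t) within ?I \<times> ?I) (\<lambda>(s, t). blinfun_scaleR_left (Y (\<beta> s t)))"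
          using st' by (simp add: continuous_on_eq_continuous_within)
      qed (use st' in auto)
      moreover have "at (s, t) within ?I \<times> ?I = at (s, t)"
        by (rule at_within_interior) (use st in \<open>auto simp: interior_Times\<close>)
      ultimately show ?thesis by (simp only: \<Gamma>_def split_conv blinfun_scaleR_left.rep_eq)
    qed
    moreover have "\<Gamma> (s, t) \<in> B" if "\<bar>s\<bar> < \<tau>" "\<bar>t\<bar> < \<tau>" for s t
    proof -
      have "s \<in> ?I" "t \<in> ?I" using that by auto
      then show ?thesis using \<beta>(2) r(2) by (auto simp: \<Gamma>_def)
    qed
    moreover have "\<Gamma> (0, 0) = x0" using \<beta>(1)[OF I0] \<alpha>(1) by (simp add: \<Gamma>_def)
    ultimately show ?thesis by blast
  qed
  with \<tau> R show ?thesis by blast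
qed

section \<open>Graphs over a real hyperplane of complex space\<close>

lemma smooth_on_derivative_apply:
  fixes f :: "'a::euclidean_space \<Rightarrow> 'b::real_normed_vector"
  assumes S: "open S" and f: "smooth_on f S" and g: "smooth_on g S"
  shows "smooth_on (\<lambda>x. Der f x (g x)) S"
proof (rule smooth_on_cong[OF S])
  show "(\<Sum>b\<in>Basis. (g x \<bullet> b) *\<^sub>R Der f x b) = Der f x (g x)"
    if "x \<in> S" for x
  proof -
    interpret linear "Der f x" using smooth_on_linear_derivative[OF f that] .
    have "Der f x (g x) = Der f x (\<Sum>b\<in>Basis. (g x \<bullet> b) *\<^sub>R b)"
      by (simp add: euclidean_representation)
    then show ?thesis by (simp add: sum scale)
  qed
  have "Ck_on k (\<lambda>x. \<Sum>b\<in>Basis. (g x \<bullet> b) *\<^sub>R Der f x b) S" for k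
    by (intro Ck_on_sum S Ck_on_bilinear[OF bounded_bilinear_scaleR] Ck_on_bilinear[OF bounded_bilinear_inner]
        Ck_on_const smooth_onD smooth_on_derivative f g)
  then show "smooth_on (\<lambda>x. \<Sum>b\<in>Basis. (g x \<bullet> b) *\<^sub>R Der f x b) S"
    by (simp add: smooth_on_def)
qed

lemma smooth_on_lie_bracket:
  fixes X Y :: "'a::euclidean_space \<Rightarrow> 'a"
  shows "open S \<Longrightarrow> smooth_on X S \<Longrightarrow> smooth_on Y S \<Longrightarrow> smooth_on (lie_bracket X Y) S"
  unfolding lie_bracket_def[abs_def] by (intro smooth_on_diff smooth_on_derivative_apply)

lemma Der_eq_0_if_invariant:
  assumes "f differentiable (at x)" "\<And>t. f (x + t *\<^sub>R v) = f x"
  shows "Der f x v = 0"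
proof -
  have "((\<lambda>t. f (x + t *\<^sub>R v)) has_vector_derivative Der f x v) (at 0)"
    using has_vector_derivative_along_line[of f _ x 0 v] assms(1) by (simp add: frechet_derivative_works)
  moreover have "((\<lambda>t. f (x + t *\<^sub>R v)) has_vector_derivative 0) (at 0)"
    using assms(2) by simp
  ultimately show ?thesis by (rule vector_derivative_unique_at)
qed

text \<open>The two points have the same set of derivatives, so the choice inside
  \<open>frechet_derivative\<close> returns the same value, even where no derivative exists. The
  invariance rules derived from this hold at all points, not only in the cylinder.\<close>

lemma Der_translation_invariant:
  assumes "\<And>y. f (y + c) = f y"
  shows "Der f (x + c) = Der f x"
proof -
  have *: "(f has_derivative f') (at y)"
    if inv: "\<And>y. f (y + d) = f y" and f: "(f has_derivative f') (at (y + d))" for f' y d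
  proof -
    have "((\<lambda>y. y + d) has_derivative (\<lambda>v. v)) (at y)" by (auto intro!: derivative_eq_intros)
    from has_derivative_compose[OF this f] show ?thesis by (simp add: inv)
  qed
  have "f (y + - c) = f y" for y using assms[of "y + - c"] by simp
  then have "(f has_derivative f') (at (x + c)) \<longleftrightarrow> (f has_derivative f') (at x)" for f'
    using *[of c f' x] *[of "- c" f' "x + c"] assms by auto
  then show ?thesis unfolding frechet_derivative_def by simp
qed

lemma bounded_linear_Re_nth: "bounded_linear (\<lambda>x :: complex ^ 'n. Re (x $ i))"
  and bounded_linear_Im_nth: "bounded_linear (\<lambda>x :: complex ^ 'n. Im (x $ i))"
  by (intro bounded_linear_compose[OF bounded_linear_Re bounded_linear_vec_nth]
      bounded_linear_compose[OF bounded_linear_Im bounded_linear_vec_nth])+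

abbreviation J :: "complex ^ 'n \<Rightarrow> complex ^ 'n" where "J \<equiv> complex_structure"

lemma bounded_linear_complex_structure: "bounded_linear J"
proof -
  have "linear (J :: complex ^ 'n \<Rightarrow> complex ^ 'n)"
    by (rule linearI) (simp_all add: complex_structure_def vec_eq_iff algebra_simps)
  then show ?thesis by (rule linear_conv_bounded_linear[THEN iffD1])
qed

lemma complex_structure_nth [simp]: "J v $ i = \<i> * v $ i"
  by (simp add: complex_structure_def)

lemma complex_structure_twice [simp]: "J (J v) = - v"
  by (simp add: vec_eq_iff)

section \<open>Coordinates adapted to the edge\<close>

locale two_coords =
  fixes a b :: "'n::finite"
  assumes ab: "a \<noteq> b"
begin

definition re_a :: "complex ^ 'n" where "re_a = axis a 1"
definition im_a :: "complex ^ 'n" where "im_a = axis a \<i>"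
definition re_b :: "complex ^ 'n" where "re_b = axis b 1"
definition im_b :: "complex ^ 'n" where "im_b = axis b \<i>"

definition pr :: "complex ^ 'n \<Rightarrow> complex ^ 'n" where "pr x = x - Im (x $ b) *\<^sub>R im_b"

text \<open>A function on a ball of the hyperplane \<open>Im (x $ b) = 0\<close> is encoded as a
  function invariant under \<open>im_b\<close> on the cylinder over that ball. This domain is open
  in the whole space, so the ambient calculus applies without a separate type for the
  hyperplane.\<close>

definition cyl :: "real \<Rightarrow> (complex ^ 'n) set" where "cyl r = {x. norm (pr x) < r}"

lemma dirs_nth [simp]:
  "re_a $ i = (if i = a then 1 else 0)" "im_a $ i = (if i = a then \<i> else 0)"
  "re_b $ i = (if i = b then 1 else 0)" "im_b $ i = (if i = b then \<i> else 0)"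
  by (auto simp: re_a_def im_a_def re_b_def im_b_def axis_def)

lemma a_neq_b [simp]: "a \<noteq> b" "b \<noteq> a" using ab by auto

lemma complex_structure_dirs [simp]:
  "J re_a = im_a" "J re_b = im_b"
  "J im_a = - re_a" "J im_b = - re_b"
  by (auto simp: vec_eq_iff)

lemma pr_nth: "pr x $ i = (if i = b then complex_of_real (Re (x $ b)) else x $ i)"
  by (auto simp: pr_def complex_eq_iff)

lemma pr_simps [simp]: "pr (pr x) = pr x" "pr (x + t *\<^sub>R im_b) = pr x" "Im (pr x $ b) = 0" "pr 0 = 0"
  by (simp_all add: vec_eq_iff pr_nth)

lemma pr_plus: "pr x + Im (x $ b) *\<^sub>R im_b = x" by (simp add: pr_def)

lemma bounded_linear_pr: "bounded_linear pr"
proof -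
  have "linear pr" by (rule linearI) (simp_all add: vec_eq_iff pr_nth scaleR_conv_of_real[symmetric] algebra_simps)
  then show ?thesis by (rule linear_conv_bounded_linear[THEN iffD1])
qed

lemmas has_derivative_pr = bounded_linear_imp_has_derivative[OF bounded_linear_pr]

lemma open_cyl: "open (cyl r)"
  unfolding cyl_def
  by (intro open_Collect_less continuous_intros linear_continuous_on[OF bounded_linear_pr])

lemma convex_cyl: "convex (cyl r)"
proof -
  have "cyl r = pr -` ball 0 r" by (auto simp: cyl_def)
  then show ?thesis using convex_linear_vimage[OF bounded_linear.linear[OF bounded_linear_pr]] by (metis convex_ball)
qed

lemma cyl_pr [simp]: "pr x \<in> cyl r \<longleftrightarrow> x \<in> cyl r" "x + t *\<^sub>R im_b \<in> cyl r \<longleftrightarrow> x \<in> cyl r"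
  by (simp_all add: cyl_def)

lemma cyl_mono: "r \<le> r' \<Longrightarrow> cyl r \<subseteq> cyl r'" by (auto simp: cyl_def)

lemma zero_in_cyl: "0 < r \<Longrightarrow> 0 \<in> cyl r" by (simp add: cyl_def)

end

section \<open>The complex tangent bundle of a graph\<close>

locale graph_function = two_coords a b for a b :: "'n::finite" +
  fixes \<rho> :: "complex ^ 'n \<Rightarrow> real" and r :: real
  assumes smooth_\<rho>: "smooth_on \<rho> (cyl r)" and \<rho>_inv: "\<And>x t. \<rho> (x + t *\<^sub>R im_b) = \<rho> x"
begin

abbreviation D\<rho> :: "complex ^ 'n \<Rightarrow> complex ^ 'n \<Rightarrow> real" where
  "D\<rho> v x \<equiv> Der \<rho> x v"

definition p :: "complex ^ 'n \<Rightarrow> complex ^ 'n \<Rightarrow> real" where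
  "p e x = (D\<rho> (J e) x - D\<rho> re_b x * D\<rho> e x) / (1 + D\<rho> re_b x * D\<rho> re_b x)"

definition q :: "complex ^ 'n \<Rightarrow> complex ^ 'n \<Rightarrow> real" where
  "q e x = (D\<rho> e x + D\<rho> re_b x * D\<rho> (J e) x) / (1 + D\<rho> re_b x * D\<rho> re_b x)"

text \<open>The lift of the constant field \<open>e\<close>, which has no \<open>b\<close>-component, to the complex tangent bundle of the
  graph: \<open>p\<close> and \<open>q\<close> solve the two tangency conditions \<open>D\<rho> e = q - D\<rho> re_b p\<close> and
  \<open>D\<rho> (J e) = p + D\<rho> re_b q\<close>.\<close>

definition cr_lift :: "complex ^ 'n \<Rightarrow> complex ^ 'n \<Rightarrow> complex ^ 'n" where
  "cr_lift e x = e + p e x *\<^sub>R re_b + q e x *\<^sub>R im_b"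

definition graph :: "(complex ^ 'n) set" where
  "graph = {x \<in> cyl r. Im (x $ b) = \<rho> x}"

lemma \<rho>_pr [simp]: "\<rho> (pr x) = \<rho> x"
  using \<rho>_inv[of "pr x" "Im (x $ b)"] by (simp add: pr_plus)

lemma denominator_pos: "0 < 1 + D\<rho> re_b x * D\<rho> re_b x"
  by (simp add: add_pos_nonneg)

lemma linear_D\<rho>: "x \<in> cyl r \<Longrightarrow> linear (\<lambda>v. D\<rho> v x)"
  using smooth_on_linear_derivative[OF smooth_\<rho>] by simp

lemma D\<rho>_inv [simp]: "D\<rho> v (x + t *\<^sub>R im_b) = D\<rho> v x"
  by (subst Der_translation_invariant) (simp_all add: \<rho>_inv)

lemma p_inv: "p e (x + t *\<^sub>R im_b) = p e x" and q_inv: "q e (x + t *\<^sub>R im_b) = q e x"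
  by (simp_all add: p_def q_def)

lemma cr_lift_inv: "cr_lift e (x + t *\<^sub>R im_b) = cr_lift e x"
  by (simp add: cr_lift_def p_inv q_inv)

lemma D\<rho>_im_b: "x \<in> cyl r \<Longrightarrow> D\<rho> im_b x = 0"
  by (rule Der_eq_0_if_invariant[OF differentiableI[OF smooth_on_has_derivative[OF smooth_\<rho>]] \<rho>_inv])

lemma smooth_D\<rho>: "smooth_on (D\<rho> v) (cyl r)"
  by (rule smooth_on_derivative[OF smooth_\<rho>])

lemma smooth_p: "smooth_on (p e) (cyl r)" and smooth_q: "smooth_on (q e) (cyl r)"
proof -
  have nz: "1 + D\<rho> re_b x * D\<rho> re_b x \<noteq> 0" for x using denominator_pos[of x] by simp
  show "smooth_on (p e) (cyl r)" "smooth_on (q e) (cyl r)"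
    unfolding p_def[abs_def] q_def[abs_def]
    by (intro smooth_on_divide smooth_on_diff smooth_on_add smooth_on_mult smooth_on_const smooth_D\<rho> open_cyl nz)+
qed

lemma smooth_cr_lift: "smooth_on (cr_lift e) (cyl r)"
  unfolding cr_lift_def[abs_def]
  by (intro smooth_on_add smooth_on_scaleR smooth_on_const smooth_p smooth_q open_cyl)

lemma D\<rho>_eq: "D\<rho> e x = q e x - D\<rho> re_b x * p e x"
  and D\<rho>_J_eq: "D\<rho> (J e) x = p e x + D\<rho> re_b x * q e x"
  using denominator_pos[of x] by (simp_all add: p_def q_def divide_simps) (simp_all add: algebra_simps)

lemma p_J: "x \<in> cyl r \<Longrightarrow> p (J e) x = - q e x"
  and q_J: "x \<in> cyl r \<Longrightarrow> q (J e) x = p e x"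
  using linear_neg[OF linear_D\<rho>, of x e] by (simp_all add: p_def q_def minus_divide_left)

text \<open>The formulas \<open>p_J\<close> and \<open>q_J\<close> are exactly complex linearity of
  the added \<open>b\<close>-component. It makes the integral surfaces of the lifts of
  \<open>re_a\<close> and \<open>im_a\<close> complex curves.\<close>

lemma cr_lift_J: "x \<in> cyl r \<Longrightarrow> cr_lift (J e) x = J (cr_lift e x)"
  using p_J[of x e] q_J[of x e] by (simp add: cr_lift_def vec_eq_iff algebra_simps complex_eq_iff)

lemma cr_lift_nth: "e $ b = 0 \<Longrightarrow> cr_lift e x $ i = (if i = b then Complex (p e x) (q e x) else e $ i)"
  by (simp add: cr_lift_def complex_eq_iff)

lemma D_cr_lift:
  assumes x: "x \<in> cyl r"
  shows "Der (cr_lift e) x v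
    = Der (p e) x v *\<^sub>R re_b + Der (q e) x v *\<^sub>R im_b"
proof -
  have "(cr_lift e has_derivative (\<lambda>v. 0 + Der (p e) x v *\<^sub>R re_b
      + Der (q e) x v *\<^sub>R im_b)) (at x)"
    unfolding cr_lift_def[abs_def]
    by (intro has_derivative_add has_derivative_const has_derivative_scaleR_left
        smooth_on_has_derivative[OF smooth_p x] smooth_on_has_derivative[OF smooth_q x])
  then show ?thesis by (simp add: Der_eqI)
qed

lemma D_along_cr_lift:
  fixes f :: "complex ^ 'n \<Rightarrow> real"
  assumes "x \<in> cyl r" "smooth_on f (cyl r)" "\<And>x t. f (x + t *\<^sub>R im_b) = f x"
  shows "Der f x (cr_lift e x)
    = Der f x e + p e x * Der f x re_b" 
proof -
  interpret linear "Der f x" using smooth_on_linear_derivative[OF assms(2,1)] .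
  have "Der f x im_b = 0"
    by (rule Der_eq_0_if_invariant[OF differentiableI[OF smooth_on_has_derivative[OF assms(2,1)]] assms(3)])
  then show ?thesis by (simp add: cr_lift_def add scale)
qed

lemma lie_bracket_cr_lift:
  assumes "x \<in> cyl r"
  shows "lie_bracket (cr_lift e) (cr_lift e') x =
     (Der (p e') x (cr_lift e x) - Der (p e) x (cr_lift e' x)) *\<^sub>R re_b
   + (Der (q e') x (cr_lift e x) - Der (q e) x (cr_lift e' x)) *\<^sub>R im_b"
  using assms by (simp add: lie_bracket_def D_cr_lift algebra_simps)

lemma lie_bracket_cr_lift_inv:
  assumes "x \<in> cyl r"
  shows "lie_bracket (cr_lift e) (cr_lift e') (x + t *\<^sub>R im_b) = lie_bracket (cr_lift e) (cr_lift e') x"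
proof -
  have "Der (cr_lift e) (x + t *\<^sub>R im_b) = Der (cr_lift e) x" for e
    by (rule Der_translation_invariant) (simp add: cr_lift_inv)
  then show ?thesis by (simp add: lie_bracket_def cr_lift_inv)
qed

lemma continuous_at_\<rho>: "x \<in> cyl r \<Longrightarrow> continuous (at x) \<rho>"
  using smooth_on_continuous_on[OF smooth_\<rho>] open_cyl continuous_on_eq_continuous_at by blast

text \<open>One inclusion differentiates the graph equation along a curve, the other lifts a line to
  the graph. Agreement of \<open>M\<close> with the graph is required only on \<open>V\<close>, so
  that the result applies to the interior of the given hypersurface and to competing
  extensions.\<close>

lemma tangent_space_graph:
  assumes V: "open V" "x \<in> V" "M \<inter> V = graph \<inter> V" and x: "x \<in> graph"
  shows "tangent_space M x = {w. Im (w $ b) = D\<rho> w x}"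
proof (intro equalityI subsetI CollectI)
  have xr: "x \<in> cyl r" and xb: "Im (x $ b) = \<rho> x" using x by (auto simp: graph_def)
  have D: "(\<rho> has_derivative (\<lambda>v. D\<rho> v x)) (at x)"
    using smooth_on_has_derivative[OF smooth_\<rho> xr] .
  {
    fix w assume "w \<in> tangent_space M x"
    then obtain \<gamma> \<epsilon> where g: "\<epsilon> > 0" "\<gamma> ` {-\<epsilon><..<\<epsilon>} \<subseteq> M" "\<gamma> 0 = x"
      "(\<gamma> has_vector_derivative w) (at (0::real))"
      unfolding tangent_space_def by blast
    have d1: "((\<lambda>t. Im (\<gamma> t $ b)) has_vector_derivative Im (w $ b)) (at 0)"
      by (rule bounded_linear.has_vector_derivative[OF bounded_linear_Im_nth g(4)])
    have d2: "((\<rho> \<circ> \<gamma>) has_vector_derivative D\<rho> w x) (at 0)"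
      using vector_derivative_diff_chain_within[OF g(4), of \<rho> "\<lambda>v. D\<rho> v x"] D g(3)
      by (simp add: has_derivative_at_withinI)
    have "(\<gamma> \<longlongrightarrow> x) (at 0)"
      using has_vector_derivative_continuous[OF g(4)] g(3) by (simp add: continuous_within)
    then have "\<forall>\<^sub>F t in at 0. \<gamma> t \<in> V" using V topological_tendstoD by blast
    moreover have "\<forall>\<^sub>F t in at 0. t \<in> {-\<epsilon><..<\<epsilon>}" using g(1) by (intro eventually_at_in_open') auto
    ultimately have "\<forall>\<^sub>F t in at 0. Im (\<gamma> t $ b) = (\<rho> \<circ> \<gamma>) t"
    proof eventually_elim
      case (elim t)
      then have "\<gamma> t \<in> graph" using g(2) V(3) by blast
      then show ?case by (simp add: graph_def)
    qed
    then have "((\<rho> \<circ> \<gamma>) has_vector_derivative Im (w $ b)) (at 0)"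
      using d1 g(3) xb unfolding has_vector_derivative_def
      by (intro has_derivative_transform_eventually[OF d1[unfolded has_vector_derivative_def]]) auto
    with d2 show "Im (w $ b) = D\<rho> w x" using vector_derivative_unique_at by blast
  }
  {
    fix w assume "w \<in> {w. Im (w $ b) = D\<rho> w x}"
    then have w: "Im (w $ b) = D\<rho> w x" by simp
    \<comment> \<open>Replacing the \<open>im_b\<close>-component of the line by \<rho> puts it on
      the graph; its velocity is \<open>pr w + D\<rho> w x *\<^sub>R im_b\<close>, which is
      \<open>w\<close>.\<close>
    define \<gamma> where "\<gamma> t = pr (x + t *\<^sub>R w) + \<rho> (x + t *\<^sub>R w) *\<^sub>R im_b" for t
    let ?T = "(\<lambda>t. x + t *\<^sub>R w) -` cyl r"
    have T: "open ?T"
      by (intro open_vimage open_cyl continuous_intros)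
    have line: "smooth_on (\<lambda>t::real. x + t *\<^sub>R w) ?T"
      by (intro smooth_on_add[OF T] smooth_on_const smooth_on_bounded_linear bounded_linear_scaleR_left)
    have sm: "smooth_on \<gamma> ?T"
      unfolding \<gamma>_def
      by (intro smooth_on_add[OF T] smooth_on_bounded_linear_compose[OF bounded_linear_pr T line]
          smooth_on_scaleR[OF T] smooth_on_const smooth_on_compose[OF T open_cyl _ smooth_\<rho> line]) auto
    have 0: "0 \<in> ?T" using xr by simp
    have \<gamma>0: "\<gamma> 0 = x" by (simp add: \<gamma>_def xb[symmetric] pr_plus)
    have "(\<gamma> \<longlongrightarrow> x) (at 0)"
      using smooth_on_continuous_on[OF sm] T 0 \<gamma>0 continuous_on_eq_continuous_at
      by (metis continuous_at)
    then have "\<forall>\<^sub>F t in at 0. \<gamma> t \<in> V" using V topological_tendstoD by blast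
    moreover have "\<forall>\<^sub>F t in at 0. t \<in> ?T" using T 0 by (intro eventually_at_in_open')
    ultimately have "\<forall>\<^sub>F t in at 0. \<gamma> t \<in> V \<and> t \<in> ?T" by eventually_elim auto
    then obtain \<epsilon> where \<epsilon>: "0 < \<epsilon>" "\<And>t. t \<noteq> 0 \<Longrightarrow> dist t 0 < \<epsilon> \<Longrightarrow> \<gamma> t \<in> V \<and> t \<in> ?T"
      unfolding eventually_at by auto
    have in_VT: "\<gamma> t \<in> V" "t \<in> ?T" if "t \<in> {-\<epsilon><..<\<epsilon>}" for t
      using \<epsilon>(2)[of t] 0 V(2) \<gamma>0 that by (cases "t = 0"; auto simp: dist_real_def)+
    have "\<gamma> t \<in> M" if "t \<in> {-\<epsilon><..<\<epsilon>}" for t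
    proof -
      have "\<rho> (\<gamma> t) = \<rho> (x + t *\<^sub>R w)" by (simp only: \<gamma>_def \<rho>_inv \<rho>_pr)
      then have "\<gamma> t \<in> graph" using in_VT(2)[OF that] by (simp add: graph_def \<gamma>_def)
      then show ?thesis using in_VT(1)[OF that] V(3) by blast
    qed
    moreover have "smooth_on \<gamma> {-\<epsilon><..<\<epsilon>}" using sm in_VT(2) smooth_on_subset by blast
    moreover have "(\<gamma> has_vector_derivative w) (at 0)"
    proof -
      have "((\<lambda>t. \<rho> (x + t *\<^sub>R w)) has_vector_derivative D\<rho> w x) (at 0)"
        using has_vector_derivative_along_line[of \<rho> "\<lambda>v. D\<rho> v x" x 0 w] D by simp
      moreover have "((\<lambda>t. pr (x + t *\<^sub>R w)) has_vector_derivative pr w) (at 0)"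
        using has_vector_derivative_along_line[of pr pr x 0 w]
          has_derivative_pr by simp
      ultimately have "(\<gamma> has_vector_derivative pr w + D\<rho> w x *\<^sub>R im_b) (at 0)"
        unfolding \<gamma>_def[abs_def]
        by (intro has_vector_derivative_add bounded_linear.has_vector_derivative[OF bounded_linear_scaleR_left])
      then show ?thesis using w by (metis pr_plus)
    qed
    ultimately show "w \<in> tangent_space M x"
      unfolding tangent_space_def using \<epsilon>(1) \<gamma>0 by blast
  }
qed

lemma complex_tangent_space_graph:
  assumes "open V" "x \<in> V" "M \<inter> V = graph \<inter> V" and x: "x \<in> graph"
  shows "complex_tangent_space M x =
    {w. Im (w $ b) = D\<rho> w x \<and> Re (w $ b) = D\<rho> (J w) x}"
proof -
  have "x \<in> cyl r" using x by (simp add: graph_def)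
  note neg = linear_neg[OF linear_D\<rho>[OF this]]
  have "w \<in> J ` {w. Im (w $ b) = D\<rho> w x} \<longleftrightarrow> Re (w $ b) = D\<rho> (J w) x" for w
  proof
    assume "w \<in> J ` {w. Im (w $ b) = D\<rho> w x}"
    then obtain u where "w = J u" "Im (u $ b) = D\<rho> u x" by auto
    then show "Re (w $ b) = D\<rho> (J w) x" by (simp add: neg)
  next
    assume "Re (w $ b) = D\<rho> (J w) x"
    then have "w = J (- J w)"
      "- J w \<in> {w. Im (w $ b) = D\<rho> w x}"
      by (simp_all add: neg vec_eq_iff)
    then show "w \<in> J ` {w. Im (w $ b) = D\<rho> w x}" by blast
  qed
  then show ?thesis
    unfolding complex_tangent_space_def tangent_space_graph[OF assms] by blast
qed

lemma cr_lift_in_complex_tangent_space: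
  assumes "x \<in> cyl r" "e $ b = 0"
  shows "Im (cr_lift e x $ b) = D\<rho> (cr_lift e x) x"
    "Re (cr_lift e x $ b) = D\<rho> (J (cr_lift e x)) x"
proof -
  have "D\<rho> (cr_lift e x) x = D\<rho> e x + p e x * D\<rho> re_b x" for e
    using D_along_cr_lift[OF assms(1) smooth_\<rho> \<rho>_inv] .
  from this[of e] this[of "J e"] show
    "Im (cr_lift e x $ b) = D\<rho> (cr_lift e x) x"
    "Re (cr_lift e x $ b) = D\<rho> (J (cr_lift e x)) x"
    using assms D\<rho>_eq[of x e] D\<rho>_J_eq[of x e]
    by (simp_all add: cr_lift_nth cr_lift_J[symmetric] p_J mult.commute)
qed

text \<open>The constant parts of the lifts drop out of the bracket, which therefore has only a
  \<open>b\<close>-component. A graph over \<open>im_b\<close> has no nonzero complex tangent vector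
  in that complex line, so a bracket that is again complex tangent must vanish. Invariance under
  \<open>im_b\<close> carries this from the graph to the point \<open>x\<close> of the
  cylinder.\<close>

lemma lie_bracket_cr_lift_eq_0:
  assumes V: "open V" "M \<inter> V = graph \<inter> V" and M: "involutive M (complex_tangent_space M)"
    and x: "x \<in> cyl r" "pr x + \<rho> x *\<^sub>R im_b \<in> V" and e: "e $ b = 0" "e' $ b = 0"
  shows "lie_bracket (cr_lift e) (cr_lift e') x = 0"
proof -
  define y where "y = pr x + \<rho> x *\<^sub>R im_b"
  have \<rho>y: "\<rho> y = \<rho> x" by (simp only: y_def \<rho>_inv \<rho>_pr)
  have yr: "y \<in> cyl r" using x(1) by (simp add: y_def)
  then have y: "y \<in> graph" by (simp add: graph_def \<rho>y) (simp add: y_def)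
  have yV: "y \<in> V" using x(2) by (simp add: y_def)
  have tan: "cr_lift e z \<in> complex_tangent_space M z" if "z \<in> M \<inter> (V \<inter> cyl r)" "e $ b = 0" for e z
  proof -
    have "z \<in> graph" using that V(2) by blast
    then have "complex_tangent_space M z =
        {w. Im (w $ b) = D\<rho> w z \<and> Re (w $ b) = D\<rho> (J w) z}"
      using complex_tangent_space_graph[OF V(1) _ V(2)] that by blast
    then show ?thesis using cr_lift_in_complex_tangent_space[of z e] that by simp
  qed
  have "lie_bracket (cr_lift e) (cr_lift e') y \<in> complex_tangent_space M y"
  proof -
    have sm: "smooth_on (cr_lift e) (V \<inter> cyl r)" for e using smooth_cr_lift smooth_on_subset by blast
    have "open (V \<inter> cyl r)" using V(1) open_cyl by blast
    moreover have "y \<in> M \<inter> (V \<inter> cyl r)" using y yV yr V(2) by blast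
    moreover have "\<forall>z\<in>M \<inter> (V \<inter> cyl r). cr_lift e z \<in> complex_tangent_space M z \<and> cr_lift e' z \<in> complex_tangent_space M z"
      using tan e by blast
    ultimately show ?thesis using M sm unfolding involutive_def by blast
  qed
  then have in_T: "Im (lie_bracket (cr_lift e) (cr_lift e') y $ b) = D\<rho> (lie_bracket (cr_lift e) (cr_lift e') y) y"
    "Re (lie_bracket (cr_lift e) (cr_lift e') y $ b) = D\<rho> (J (lie_bracket (cr_lift e) (cr_lift e') y)) y"
    unfolding complex_tangent_space_graph[OF V(1) yV V(2) y] by auto
  obtain \<alpha> \<beta> where L: "lie_bracket (cr_lift e) (cr_lift e') y = \<alpha> *\<^sub>R re_b + \<beta> *\<^sub>R im_b"
    using lie_bracket_cr_lift[OF yr] by blast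
  interpret linear "\<lambda>v. D\<rho> v y" using linear_D\<rho>[OF yr] .
  have "J (\<alpha> *\<^sub>R re_b + \<beta> *\<^sub>R im_b) = \<alpha> *\<^sub>R im_b + (- \<beta>) *\<^sub>R re_b"
    by (simp add: vec_eq_iff complex_eq_iff)
  with in_T have 1: "\<beta> = \<alpha> * D\<rho> re_b y" and 2: "\<alpha> = - \<beta> * D\<rho> re_b y"
    unfolding L by (simp_all add: add scale neg diff D\<rho>_im_b[OF yr])
  have "\<alpha> * (1 + D\<rho> re_b y * D\<rho> re_b y) = 0" using 1 2 by (simp add: algebra_simps)
  then have "\<alpha> = 0" using denominator_pos[of y] by simp
  with 1 have "lie_bracket (cr_lift e) (cr_lift e') y = 0" by (simp add: L)
  moreover have "x = y + (Im (x $ b) - \<rho> x) *\<^sub>R im_b"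
    by (simp add: y_def pr_def algebra_simps)
  ultimately show ?thesis using lie_bracket_cr_lift_inv[OF yr] by metis
qed

end

section \<open>Graphs as embedded hypersurfaces\<close>

lemma powr_minus_half: "0 < s \<Longrightarrow> s powr (-1/2) * s powr (-1/2) * s = (1::real)"
  unfolding powr_add[symmetric] by (simp add: powr_minus)

definition to_real :: "complex ^ 'n \<Rightarrow> real ^ ('n + 'n)" where
  "to_real x = (\<chi> k. case k of Inl i \<Rightarrow> Re (x $ i) | Inr i \<Rightarrow> Im (x $ i))"

definition of_real_vec :: "real ^ ('n + 'n) \<Rightarrow> complex ^ 'n" where
  "of_real_vec y = (\<chi> i. Complex (y $ Inl i) (y $ Inr i))"

lemma to_real_nth [simp]: "to_real x $ Inl i = Re (x $ i)" "to_real x $ Inr i = Im (x $ i)"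
  by (simp_all add: to_real_def)

lemma to_real_inverse [simp]: "of_real_vec (to_real x) = x" "to_real (of_real_vec y) = y"
  by (auto simp: vec_eq_iff of_real_vec_def to_real_def complex_eq_iff split: sum.split)

lemma bounded_linear_to_real: "bounded_linear (to_real :: complex ^ 'n \<Rightarrow> real ^ ('n + 'n))"
  and bounded_linear_of_real_vec: "bounded_linear (of_real_vec :: real ^ ('n + 'n) \<Rightarrow> complex ^ 'n)"
proof -
  have "linear (to_real :: complex ^ 'n \<Rightarrow> real ^ ('n + 'n))"
    by (rule linearI) (auto simp: vec_eq_iff to_real_def split: sum.split)
  then show "bounded_linear (to_real :: complex ^ 'n \<Rightarrow> real ^ ('n + 'n))"
    by (rule linear_conv_bounded_linear[THEN iffD1])
  have "linear (of_real_vec :: real ^ ('n + 'n) \<Rightarrow> complex ^ 'n)"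
    by (rule linearI) (auto simp: vec_eq_iff of_real_vec_def complex_eq_iff)
  then show "bounded_linear (of_real_vec :: real ^ ('n + 'n) \<Rightarrow> complex ^ 'n)"
    by (rule linear_conv_bounded_linear[THEN iffD1])
qed

context graph_function
begin

text \<open>A chart has to map onto the whole of real \<open>2 N\<close>-space. The factor
  \<open>c\<close> stretches the ball of radius \<open>r\<close> onto the hyperplane by
  \<open>x / sqrt (r^2 - |x|^2)\<close>, with inverse \<open>r z / sqrt (1 + |z|^2)\<close> given by
  \<open>w\<close>; subtracting \<rho> in the remaining direction straightens the graph, so one
  chart suffices.\<close>

lemma smooth_hypersurface_graph:
  assumes r: "0 < r"
  shows "smooth_hypersurface graph"
proof -
  define c where "c x = (r\<^sup>2 - pr x \<bullet> pr x) powr (-1/2)" for x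
  define d where "d x = (1 + pr x \<bullet> pr x) powr (-1/2)" for x
  define \<phi> where "\<phi> x = to_real (c x *\<^sub>R pr x + (Im (x $ b) - \<rho> x) *\<^sub>R im_b)" for x
  define w where "w z = (r * d z) *\<^sub>R pr z" for z
  define g where "g y = w (of_real_vec y) + (Im (of_real_vec y $ b) + \<rho> (w (of_real_vec y))) *\<^sub>R im_b" for y
  have sm_pr: "smooth_on pr S" for S by (rule smooth_on_bounded_linear[OF bounded_linear_pr])
  have pos: "0 < r\<^sup>2 - pr x \<bullet> pr x" if "x \<in> cyl r" for x
    using that r power_strict_mono[of "norm (pr x)" r 2] by (simp add: cyl_def power2_norm_eq_inner)
  have pos1: "0 < 1 + pr x \<bullet> pr x" for x by (simp add: add_pos_nonneg)
  have pr_scale: "pr (t *\<^sub>R pr z) = t *\<^sub>R pr z" for t z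
    using linear_scale[OF bounded_linear.linear[OF bounded_linear_pr], of t "pr z"] by simp
  have pr_w: "pr (w z) = w z" for z by (simp add: w_def pr_scale)
  have c_sq: "c x * c x * (r\<^sup>2 - pr x \<bullet> pr x) = 1" if "x \<in> cyl r" for x
    unfolding c_def by (rule powr_minus_half[OF pos[OF that]])
  have d_sq: "d x * d x * (1 + pr x \<bullet> pr x) = 1" for x
    unfolding d_def by (rule powr_minus_half[OF pos1])
  have c_pos: "0 < c x" if "x \<in> cyl r" for x using pos[OF that] by (simp add: c_def)
  have d_pos: "0 < d x" for x using pos1[of x] by (simp add: d_def)
  have w_norm: "r\<^sup>2 - w z \<bullet> w z = r\<^sup>2 * (d z * d z)" for z
  proof -
    have "r\<^sup>2 * (d z * d z * (1 + pr z \<bullet> pr z)) = r\<^sup>2" by (simp only: d_sq mult_1_right)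
    then show ?thesis by (simp add: w_def power2_eq_square algebra_simps)
  qed
  have w_cyl: "w z \<in> cyl r" for z
  proof -
    have "0 < r\<^sup>2 - w z \<bullet> w z" using w_norm[of z] r d_pos[of z] by simp
    then have "(norm (w z))\<^sup>2 < r\<^sup>2" by (simp add: power2_norm_eq_inner)
    then show ?thesis using r by (simp add: cyl_def pr_w power2_less_imp_less)
  qed
  have \<phi>_b: "\<phi> x $ Inr b = Im (x $ b) - \<rho> x" for x by (simp add: \<phi>_def)
  have g_cyl: "g y \<in> cyl r" for y using w_cyl by (simp add: g_def)
  have pr_g: "pr (g y) = w (of_real_vec y)" for y by (simp add: g_def pr_w)
  have g_b: "Im (g y $ b) = y $ Inr b + \<rho> (g y)" for y
  proof -
    have "Im (w z $ b) = 0" for z using pr_simps(3)[of "w z"] by (simp add: pr_w)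
    then show ?thesis by (simp add: g_def \<rho>_inv of_real_vec_def)
  qed
  have \<phi>_g: "\<phi> (g y) = y" for y
  proof -
    define z where "z = of_real_vec y"
    have "c (g y) * c (g y) * (r\<^sup>2 * (d z * d z)) = 1"
      using c_sq[OF g_cyl] by (simp add: pr_g w_norm z_def)
    then have "(c (g y) * (r * d z))\<^sup>2 = 1\<^sup>2" by (simp add: power2_eq_square mult_ac)
    moreover have "0 \<le> c (g y) * (r * d z)"
      using c_pos[OF g_cyl, of y] d_pos[of z] r by simp
    ultimately have "c (g y) * (r * d z) = 1" by (rule power2_eq_imp_eq[OF _ _ zero_le_one])
    then have "c (g y) *\<^sub>R w z = pr z" by (simp add: w_def)
    then have "\<phi> (g y) = to_real (pr z + (Im (z $ b)) *\<^sub>R im_b)"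
      by (simp add: \<phi>_def pr_g g_b z_def of_real_vec_def)
    then show ?thesis by (simp add: pr_plus z_def)
  qed
  have g_\<phi>: "g (\<phi> x) = x" if x: "x \<in> cyl r" for x
  proof -
    define z where "z = of_real_vec (\<phi> x)"
    have z: "z = c x *\<^sub>R pr x + (Im (x $ b) - \<rho> x) *\<^sub>R im_b" by (simp add: z_def \<phi>_def)
    have pz: "pr z = c x *\<^sub>R pr x" by (simp add: z pr_scale)
    have zb: "Im (z $ b) = Im (x $ b) - \<rho> x" by (simp add: z)
    have "d z * d z * (1 + c x * c x * (pr x \<bullet> pr x)) = 1" using d_sq[of z] by (simp add: pz mult_ac)
    moreover have "1 + c x * c x * (pr x \<bullet> pr x) = c x * c x * r\<^sup>2"
      using c_sq[OF x] by (simp add: algebra_simps)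
    ultimately have "d z * d z * (c x * c x * r\<^sup>2) = 1" by simp
    then have "(r * d z * c x)\<^sup>2 = 1\<^sup>2" by (simp add: power2_eq_square mult_ac)
    moreover have "0 \<le> r * d z * c x"
      using c_pos[OF x] d_pos[of z] r by simp
    ultimately have "r * d z * c x = 1" by (rule power2_eq_imp_eq[OF _ _ zero_le_one])
    then have w: "w z = pr x" by (simp add: w_def pz)
    show ?thesis unfolding g_def z_def[symmetric] by (simp add: w zb pr_plus)
  qed
  have sm_c: "smooth_on c (cyl r)"
    unfolding c_def[abs_def] using pos
    by (intro smooth_on_powr smooth_on_diff smooth_on_const smooth_on_inner sm_pr open_cyl) auto
  have sm_d: "smooth_on d UNIV"
    unfolding d_def[abs_def] using pos1
    by (intro smooth_on_powr smooth_on_add smooth_on_const smooth_on_inner sm_pr) auto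
  have sm_\<phi>: "smooth_on \<phi> (cyl r)"
    unfolding \<phi>_def[abs_def]
    by (intro smooth_on_bounded_linear_compose[OF bounded_linear_to_real] smooth_on_add smooth_on_scaleR sm_c sm_pr
        smooth_on_diff smooth_\<rho> smooth_on_const smooth_on_bounded_linear[OF bounded_linear_Im_nth] open_cyl)
  have sm_w: "smooth_on w UNIV"
    unfolding w_def[abs_def] by (intro smooth_on_scaleR smooth_on_mult smooth_on_const sm_d sm_pr open_UNIV)
  have sm_of: "smooth_on of_real_vec UNIV" by (rule smooth_on_bounded_linear[OF bounded_linear_of_real_vec])
  have sm_w': "smooth_on (\<lambda>y. w (of_real_vec y)) UNIV"
    by (rule smooth_on_compose[OF open_UNIV open_UNIV _ sm_w sm_of]) simp
  have sm_Im: "smooth_on (\<lambda>y. Im (of_real_vec y $ b)) UNIV"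
    by (rule smooth_on_bounded_linear_compose[OF bounded_linear_Im_nth open_UNIV sm_of])
  have sm_\<rho>w: "smooth_on (\<lambda>y. \<rho> (w (of_real_vec y))) UNIV"
    by (rule smooth_on_compose[OF open_UNIV open_cyl _ smooth_\<rho> sm_w']) (use w_cyl in auto)
  have sm_g: "smooth_on g UNIV"
    unfolding g_def[abs_def]
    by (intro smooth_on_add[OF open_UNIV] smooth_on_scaleR[OF open_UNIV] smooth_on_const sm_w' sm_\<rho>w sm_Im)
  have bij: "bij_betw \<phi> (cyl r) UNIV"
    by (rule bij_betwI[where g = g]) (use g_cyl g_\<phi> \<phi>_g in auto)
  have "inv_into (cyl r) \<phi> y = g y" for y
    using bij g_cyl[of y] \<phi>_g[of y] by (metis bij_betw_imp_inj_on inv_into_f_f)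
  then have "smooth_diffeo (cyl r) UNIV \<phi>"
    using smooth_on_cong[OF open_UNIV _ sm_g] sm_\<phi> bij open_cyl by (simp add: smooth_diffeo_def)
  moreover have "\<phi> ` (graph \<inter> cyl r) = {y. y $ Inr b = 0}"
  proof
    show "\<phi> ` (graph \<inter> cyl r) \<subseteq> {y. y $ Inr b = 0}" by (auto simp: \<phi>_b graph_def)
    show "{y. y $ Inr b = 0} \<subseteq> \<phi> ` (graph \<inter> cyl r)"
    proof
      fix y :: "real ^ ('n + 'n)" assume "y \<in> {y. y $ Inr b = 0}"
      then have "g y \<in> graph \<inter> cyl r" using g_cyl[of y] g_b[of y] by (simp add: graph_def)
      then show "y \<in> \<phi> ` (graph \<inter> cyl r)" using \<phi>_g[of y] by force
    qed
  qed
  ultimately show ?thesis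
    unfolding smooth_hypersurface_def
    by (intro ballI exI[of _ "cyl r"] exI[of _ \<phi>] exI[of _ "Inr b"] conjI) (auto simp only: graph_def)
qed

end

section \<open>Levi-flat graphs over a flat edge are odd\<close>

text \<open>Since \<open>F\<close> is already holomorphic on both sides of the line
  \<open>Im w = - t\<close>, the identity theorem is enough: after moving the line to the real axis,
  \<open>F1\<close> and its conjugate reflection agree on a real segment. Evaluation at
  \<open>Complex 0 t\<close> compares the points \<open>0\<close> and \<open>- 2 * i * t\<close> of
  the original variable.\<close>

lemma schwarz_reflection_value:
  assumes F: "F holomorphic_on {w. \<bar>Re w\<bar> < \<tau> \<and> \<bar>Im w\<bar> < \<tau>}" and t: "2 * \<bar>t\<bar> < \<tau>"
    and real: "\<And>w. \<bar>Re w\<bar> < \<tau> \<Longrightarrow> Im w = - t \<Longrightarrow> Im (F w) = 0"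
  shows "F (Complex 0 (- 2 * t)) = cnj (F 0)"
proof -
  \<comment> \<open>Shrinking the height by \<open>\<bar>t\<bar>\<close> keeps shifted arguments in
    the square while leaving \<open>A\<close> symmetric under conjugation.\<close>
  define A where "A = {w. \<bar>Re w\<bar> < \<tau> \<and> \<bar>Im w\<bar> < \<tau> - \<bar>t\<bar>}"
  define F1 where "F1 z = F (z - \<i> * of_real t)" for z
  define G where "G z = F1 z - cnj (F1 (cnj z))" for z
  have "open {w. \<bar>Re w\<bar> < \<tau>}" "open {w. \<bar>Im w\<bar> < \<tau> - \<bar>t\<bar>}"
    by (auto intro!: open_Collect_less continuous_intros)
  then have A: "open A" unfolding A_def by (simp add: Collect_conj_eq open_Int)
  have "A = {w. Re w < \<tau>} \<inter> {w. Re w > -\<tau>} \<inter> {w. Im w < \<tau> - \<bar>t\<bar>} \<inter> {w. Im w > - (\<tau> - \<bar>t\<bar>)}"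
    by (auto simp: A_def)
  then have "convex A"
    by (simp add: convex_Int convex_halfspace_Re_lt convex_halfspace_Re_gt convex_halfspace_Im_lt convex_halfspace_Im_gt)
  then have "connected A" by (rule convex_connected)
  have holF1: "F1 holomorphic_on A"
    unfolding F1_def
    by (rule holomorphic_on_compose_gen[OF _ F, unfolded o_def]) (auto intro!: holomorphic_intros simp: A_def)
  have "cnj ` A = A"
    by (auto simp: A_def image_iff intro!: exI[of _ "cnj _"])
  then have "(cnj \<circ> F1 \<circ> cnj) holomorphic_on A"
    using holomorphic_on_compose_cnj_cnj[of F1 A] holF1 A by simp
  then have "G holomorphic_on A"
    unfolding G_def using holF1 by (intro holomorphic_intros) (simp_all add: o_def)
  moreover have "0 \<in> A" using t abs_ge_zero[of t] by (simp add: A_def del: abs_ge_zero)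
  moreover have "0 islimpt A \<inter> \<real>"
    unfolding islimpt_approachable
  proof (intro allI impI)
    fix e :: real assume "0 < e"
    define s where "s = min (e / 2) (\<tau> / 2)"
    have "0 < s" "s < e" "s < \<tau>" using \<open>0 < e\<close> t by (auto simp: s_def min_def)
    then show "\<exists>x'\<in>A \<inter> \<real>. x' \<noteq> 0 \<and> dist x' 0 < e"
      using t by (intro bexI[of _ "of_real s"]) (auto simp: A_def)
  qed
  moreover have "G z = 0" if "z \<in> A \<inter> \<real>" for z
  proof -
    have "Im z = 0" using that by (simp add: complex_is_Real_iff)
    then have "cnj z = z" by (simp add: complex_eq_iff)
    have "Im (F1 z) = 0" using that \<open>Im z = 0\<close> by (auto simp: F1_def A_def intro!: real)
    then show ?thesis unfolding G_def \<open>cnj z = z\<close> by (simp add: complex_eq_iff)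
  qed
  moreover have "Complex 0 t \<in> A" using t by (auto simp: A_def)
  ultimately have "G (Complex 0 t) = 0"
    using analytic_continuation[of G A "A \<inter> \<real>" 0 "Complex 0 t"] A \<open>connected A\<close> by auto
  moreover have "Complex 0 t - \<i> * of_real t = 0" "cnj (Complex 0 t) - \<i> * of_real t = Complex 0 (- 2 * t)"
    by (auto simp: complex_eq_iff)
  ultimately show ?thesis by (simp add: G_def F1_def)
qed

context graph_function
begin

text \<open>Through each point of the graph there is a complex disc in the direction of the \<open>a\<close>- and
  \<open>b\<close>-coordinates, that is, the graph of a holomorphic function. On the edge it is real, so it extends by
  Schwarz reflection, and the lower half of the disc is the mirror image of the upper half.\<close>

lemma odd_if_levi_flat:
  assumes r: "0 < r" and edge: "\<And>x. x \<in> cyl r \<Longrightarrow> Im (x $ a) = 0 \<Longrightarrow> \<rho> x = 0"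
    and comm: "\<And>x. x \<in> cyl r \<Longrightarrow> lie_bracket (cr_lift re_a) (cr_lift im_a) x = 0"
  shows "\<exists>r'>0. r' \<le> r \<and> (\<forall>x\<in>cyl r'. \<rho> (x - (2 * Im (x $ a)) *\<^sub>R im_a) = - \<rho> x)"
proof -
  obtain \<tau> \<delta> where \<tau>: "0 < \<tau>" "0 < \<delta>" and surf:
    "\<And>x0. x0 \<in> ball 0 \<delta> \<Longrightarrow> \<exists>\<Gamma>. \<Gamma> (0, 0) = x0 \<and>
       (\<forall>s t. \<bar>s\<bar> < \<tau> \<longrightarrow> \<bar>t\<bar> < \<tau> \<longrightarrow> \<Gamma> (s, t) \<in> cyl r \<and>
          (\<Gamma> has_derivative (\<lambda>(h, k). h *\<^sub>R cr_lift re_a (\<Gamma> (s, t)) + k *\<^sub>R cr_lift im_a (\<Gamma> (s, t)))) (at (s, t)))"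
    using commuting_fields_integral_surface[OF open_cyl zero_in_cyl[OF r] smooth_cr_lift smooth_cr_lift comm]
    by blast
  have "\<rho> 0 = 0" using edge[OF zero_in_cyl[OF r]] by simp
  then obtain d where d: "0 < d" "\<And>x. norm x < d \<Longrightarrow> \<bar>\<rho> x\<bar> < \<delta> / 2"
    using continuous_at_\<rho>[OF zero_in_cyl[OF r]] \<tau>(2) unfolding continuous_at_eps_delta
    by (metis dist_0_norm dist_commute dist_real_def diff_zero half_gt_zero)
  \<comment> \<open>\<open>\<tau> / 2\<close> keeps the mirror parameter in the square,
    \<open>d\<close> bounds \<rho> by \<open>\<delta> / 2\<close>, and the last
    \<open>\<delta> / 2\<close> then puts the starting point of the disc into the ball.\<close>
  define r' where "r' = min r (min (\<tau> / 2) (min d (\<delta> / 2)))"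
  have r': "0 < r'" "r' \<le> r" "r' \<le> \<tau> / 2" "r' \<le> d" "r' \<le> \<delta> / 2" using r \<tau> d by (auto simp: r'_def)
  have "\<rho> (x - (2 * Im (x $ a)) *\<^sub>R im_a) = - \<rho> x" if x: "x \<in> cyl r'" for x
  proof -
    define x0 where "x0 = pr x + \<rho> x *\<^sub>R im_b"
    define t0 where "t0 = Im (x $ a)"
    have pr: "norm (pr x) < r'" using x by (simp add: cyl_def)
    have xr: "x \<in> cyl r" using x r'(2) cyl_mono by blast
    have "\<bar>t0\<bar> \<le> norm (pr x $ a)" by (simp add: t0_def pr_nth abs_Im_le_cmod)
    then have t0: "2 * \<bar>t0\<bar> < \<tau>" using pr r'(3) Finite_Cartesian_Product.norm_nth_le[of "pr x" a] by linarith
    have "\<bar>\<rho> x\<bar> < \<delta> / 2" using d(2)[of "pr x"] pr r'(4) by simp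
    moreover have "norm im_b = 1" by (simp add: im_b_def norm_eq_sqrt_inner inner_axis_axis inner_complex_def)
    ultimately have "x0 \<in> ball 0 \<delta>"
      using pr r'(5) norm_triangle_ineq[of "pr x" "\<rho> x *\<^sub>R im_b"] by (simp add: x0_def)
    then obtain \<Gamma> where \<Gamma>0: "\<Gamma> (0, 0) = x0"
      and \<Gamma>r: "\<And>s t. \<bar>s\<bar> < \<tau> \<Longrightarrow> \<bar>t\<bar> < \<tau> \<Longrightarrow> \<Gamma> (s, t) \<in> cyl r"
      and \<Gamma>': "\<And>s t. \<bar>s\<bar> < \<tau> \<Longrightarrow> \<bar>t\<bar> < \<tau> \<Longrightarrow>
          (\<Gamma> has_derivative (\<lambda>(h, k). h *\<^sub>R cr_lift re_a (\<Gamma> (s, t)) + k *\<^sub>R cr_lift im_a (\<Gamma> (s, t)))) (at (s, t))"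
      using surf by metis
    define Q where "Q = {w. \<bar>Re w\<bar> < \<tau> \<and> \<bar>Im w\<bar> < \<tau>}"
    have "Q = {w. Re w < \<tau>} \<inter> {w. Re w > -\<tau>} \<inter> {w. Im w < \<tau>} \<inter> {w. Im w > - \<tau>}" by (auto simp: Q_def)
    then have convQ: "convex Q" and openQ: "open Q"
      by (simp_all add: convex_Int convex_halfspace_Re_lt convex_halfspace_Re_gt convex_halfspace_Im_lt
          convex_halfspace_Im_gt open_Int open_halfspace_Re_lt open_halfspace_Re_gt open_halfspace_Im_lt
          open_halfspace_Im_gt)
    define \<Lambda> where "\<Lambda> w = \<Gamma> (Re w, Im w)" for w
    have \<Lambda>r: "\<Lambda> w \<in> cyl r" if "w \<in> Q" for w using that \<Gamma>r by (simp add: \<Lambda>_def Q_def)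
    have \<Lambda>': "(\<Lambda> has_derivative (\<lambda>h. Re h *\<^sub>R cr_lift re_a (\<Lambda> w) + Im h *\<^sub>R J (cr_lift re_a (\<Lambda> w)))) (at w)"
      if w: "w \<in> Q" for w
    proof -
      have "((\<lambda>w. (Re w, Im w)) has_derivative (\<lambda>h. (Re h, Im h))) (at w)"
        by (intro has_derivative_Pair bounded_linear_imp_has_derivative bounded_linear_Re bounded_linear_Im)
      from has_derivative_compose[OF this \<Gamma>'] w show ?thesis
        using cr_lift_J[OF \<Lambda>r[OF w], of re_a] by (simp add: \<Lambda>_def[abs_def] Q_def)
    qed
    have \<Lambda>0: "\<Lambda> 0 = x0" by (simp add: \<Lambda>_def \<Gamma>0)
    have Q0: "0 \<in> Q" using \<tau> by (simp add: Q_def)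
    have \<Lambda>_nth: "((\<lambda>w. \<Lambda> w $ i) has_derivative (\<lambda>h. h * (cr_lift re_a (\<Lambda> w) $ i))) (at w)" if "w \<in> Q" for w i
    proof (rule has_derivative_eq_rhs)
      show "((\<lambda>w. \<Lambda> w $ i) has_derivative
          (\<lambda>h. (Re h *\<^sub>R cr_lift re_a (\<Lambda> w) + Im h *\<^sub>R J (cr_lift re_a (\<Lambda> w))) $ i)) (at w)"
        by (rule bounded_linear.has_derivative[OF bounded_linear_vec_nth \<Lambda>'[OF that]])
    qed (auto simp: fun_eq_iff complex_eq_iff algebra_simps)
    \<comment> \<open>Outside \<open>b\<close> the lift of \<open>re_a\<close> is constant, so
      \<open>\<Lambda>\<close> moves only in the two relevant coordinates and its
      \<open>a\<close>-coordinate is \<open>w\<close> up to translation.\<close>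
    have \<Lambda>_other: "\<Lambda> w $ i = x0 $ i + (if i = a then w else 0)" if w: "w \<in> Q" and "i \<noteq> b" for w i
    proof -
      have "\<Lambda> w $ i - (if i = a then w else 0) = \<Lambda> 0 $ i - (if i = a then 0 else 0)"
      proof (rule has_derivative_zero_unique[OF convQ _ w Q0])
        fix w assume "w \<in> Q"
        have "((\<lambda>w. if i = a then w else 0) has_derivative (\<lambda>h. if i = a then h else 0)) (at w)"
          by (cases "i = a") simp_all
        then have "((\<lambda>w. \<Lambda> w $ i - (if i = a then w else 0)) has_derivative
            (\<lambda>h. h * (cr_lift re_a (\<Lambda> w) $ i) - (if i = a then h else 0))) (at w)"
          by (intro has_derivative_diff \<Lambda>_nth \<open>w \<in> Q\<close>)
        moreover have "h * (cr_lift re_a (\<Lambda> w) $ i) - (if i = a then h else 0) = 0" for h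
          using \<open>i \<noteq> b\<close> by (cases "i = a") (simp_all add: cr_lift_nth)
        ultimately show "((\<lambda>w. \<Lambda> w $ i - (if i = a then w else 0)) has_derivative (\<lambda>h. 0)) (at w within Q)"
          by (simp only: has_derivative_at_withinI)
      qed
      then show ?thesis by (simp add: \<Lambda>0 algebra_simps)
    qed
    have on_graph: "Im (\<Lambda> w $ b) = \<rho> (\<Lambda> w)" if w: "w \<in> Q" for w
    proof -
      have "Im (\<Lambda> w $ b) - \<rho> (\<Lambda> w) = Im (\<Lambda> 0 $ b) - \<rho> (\<Lambda> 0)"
      proof (rule has_derivative_zero_unique[OF convQ _ w Q0])
        fix w assume w: "w \<in> Q"
        let ?v = "\<lambda>h. Re h *\<^sub>R cr_lift re_a (\<Lambda> w) + Im h *\<^sub>R J (cr_lift re_a (\<Lambda> w))"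
        have "((\<lambda>w. Im (\<Lambda> w $ b) - \<rho> (\<Lambda> w)) has_derivative (\<lambda>h. Im (?v h $ b) - D\<rho> (?v h) (\<Lambda> w))) (at w)"
          by (intro has_derivative_diff bounded_linear.has_derivative[OF bounded_linear_Im_nth \<Lambda>'[OF w]]
              has_derivative_compose[OF \<Lambda>'[OF w] smooth_on_has_derivative[OF smooth_\<rho> \<Lambda>r[OF w]]])
        moreover have "Im (?v h $ b) - D\<rho> (?v h) (\<Lambda> w) = 0" for h
        proof -
          define c where "c = cr_lift re_a (\<Lambda> w)"
          have c: "Im (c $ b) = D\<rho> c (\<Lambda> w)" "Re (c $ b) = D\<rho> (J c) (\<Lambda> w)"
            unfolding c_def by (rule cr_lift_in_complex_tangent_space[OF \<Lambda>r[OF w]]; simp)+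
          have "D\<rho> (Re h *\<^sub>R c + Im h *\<^sub>R J c) (\<Lambda> w)
              = Re h * D\<rho> c (\<Lambda> w) + Im h * D\<rho> (J c) (\<Lambda> w)"
            by (simp only: linear_add[OF linear_D\<rho>[OF \<Lambda>r[OF w]]] linear_scale[OF linear_D\<rho>[OF \<Lambda>r[OF w]]]
                real_scaleR_def)
          then show ?thesis unfolding c_def[symmetric] by (simp add: c[symmetric])
        qed
        ultimately show "((\<lambda>w. Im (\<Lambda> w $ b) - \<rho> (\<Lambda> w)) has_derivative (\<lambda>h. 0)) (at w within Q)"
          by (simp only: has_derivative_at_withinI)
      qed
      moreover have "\<rho> x0 = \<rho> x" by (simp only: x0_def \<rho>_inv \<rho>_pr)
      ultimately show ?thesis by (simp add: \<Lambda>0) (simp add: x0_def)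
    qed
    have hol: "(\<lambda>w. \<Lambda> w $ b) holomorphic_on Q"
    proof -
      have "((\<lambda>w. \<Lambda> w $ b) has_field_derivative (cr_lift re_a (\<Lambda> w) $ b)) (at w)" if "w \<in> Q" for w
        using \<Lambda>_nth[OF that, of b] unfolding has_field_derivative_def
        by (rule has_derivative_eq_rhs) (simp add: fun_eq_iff)
      then show ?thesis using openQ holomorphic_on_open by blast
    qed
    \<comment> \<open>The line \<open>Im w = - t0\<close> is where the disc lies over the edge, so
      its \<open>b\<close>-coordinate is real there.\<close>
    have real: "Im (\<Lambda> w $ b) = 0" if "\<bar>Re w\<bar> < \<tau>" "Im w = - t0" for w
    proof -
      have w: "w \<in> Q" using that t0 by (simp add: Q_def)
      have "Im (\<Lambda> w $ a) = 0" using \<Lambda>_other[OF w, of a] that by (simp add: x0_def pr_nth t0_def)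
      then show ?thesis using on_graph[OF w] edge[OF \<Lambda>r[OF w]] by simp
    qed
    have refl: "\<Lambda> (Complex 0 (- 2 * t0)) $ b = cnj (\<Lambda> 0 $ b)"
      using schwarz_reflection_value[OF hol[unfolded Q_def] t0 real] .
    \<comment> \<open>The parameter at which the disc passes over the mirror image of
      \<open>x\<close>, the edge parameter \<open>- t0\<close> being midway between it and
      0.\<close>
    define w1 where "w1 = Complex 0 (- 2 * t0)"
    have w1: "w1 \<in> Q" using t0 \<tau>(1) by (simp add: w1_def Q_def abs_mult)
    have "\<Lambda> w1 $ i = (x - (2 * t0) *\<^sub>R im_a + (- \<rho> x - Im (x $ b)) *\<^sub>R im_b) $ i" for i
    proof (cases "i = b")
      case True
      have "\<Lambda> w1 $ b = cnj (x0 $ b)" using refl by (simp add: w1_def \<Lambda>0)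
      then show ?thesis using True by (simp add: x0_def pr_nth complex_eq_iff)
    next
      case False
      then show ?thesis
        using \<Lambda>_other[OF w1 False] by (auto simp: x0_def pr_nth w1_def complex_eq_iff)
    qed
    then have "\<Lambda> w1 = x - (2 * t0) *\<^sub>R im_a + (- \<rho> x - Im (x $ b)) *\<^sub>R im_b" by (simp add: vec_eq_iff)
    then have "\<rho> (\<Lambda> w1) = \<rho> (x - (2 * t0) *\<^sub>R im_a)" by (simp only: \<rho>_inv)
    moreover have "\<rho> (\<Lambda> w1) = - \<rho> x"
      using on_graph[OF w1] refl by (simp add: w1_def \<Lambda>0 x0_def)
    ultimately show ?thesis by (simp add: t0_def)
  qed
  with r'(1,2) show ?thesis by blast
qed

end

section \<open>Extension by reflection\<close>

definition conj_vec :: "complex ^ 'n \<Rightarrow> complex ^ 'n" where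
  "conj_vec x = (\<chi> i. cnj (x $ i))"

lemma conj_vec_nth [simp]: "conj_vec x $ i = cnj (x $ i)"
  by (simp add: conj_vec_def)

lemma conj_vec_conj_vec [simp]: "conj_vec (conj_vec x) = x"
  by (simp add: vec_eq_iff)

lemma bounded_linear_conj_vec: "bounded_linear (conj_vec :: complex ^ 'n \<Rightarrow> complex ^ 'n)"
proof -
  have "linear (conj_vec :: complex ^ 'n \<Rightarrow> complex ^ 'n)"
    by (rule linearI) (simp_all add: vec_eq_iff complex_eq_iff)
  then show ?thesis by (rule linear_conv_bounded_linear[THEN iffD1])
qed

lemma complex_structure_conj_vec: "J (conj_vec v) = - conj_vec (J v)"
  by (simp add: vec_eq_iff)

lemma has_derivative_conj_vec:
  assumes "(f has_derivative f') (at (conj_vec x))"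
  shows "((\<lambda>x. f (conj_vec x)) has_derivative (\<lambda>v. f' (conj_vec v))) (at x)"
  using has_derivative_compose[OF bounded_linear_imp_has_derivative[OF bounded_linear_conj_vec] assms] .

lemma lie_bracket_conj_vec:
  fixes X Y :: "complex ^ 'n \<Rightarrow> complex ^ 'n"
  assumes "X differentiable at (conj_vec x)" "Y differentiable at (conj_vec x)"
  shows "lie_bracket (\<lambda>x. conj_vec (X (conj_vec x))) (\<lambda>x. conj_vec (Y (conj_vec x))) x
    = conj_vec (lie_bracket X Y (conj_vec x))"
proof -
  have "Der (\<lambda>x. conj_vec (Z (conj_vec x))) x v
      = conj_vec (Der Z (conj_vec x) (conj_vec v))"
    if "Z differentiable at (conj_vec x)" for Z :: "complex ^ 'n \<Rightarrow> complex ^ 'n" and v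
    using Der_eqI[OF bounded_linear.has_derivative[OF bounded_linear_conj_vec
        has_derivative_conj_vec[OF that[unfolded frechet_derivative_works]]]] by simp
  then show ?thesis
    using assms by (simp add: lie_bracket_def linear_diff[OF bounded_linear.linear[OF bounded_linear_conj_vec]])
qed

context two_coords
begin

lemma pr_conj_vec: "pr (conj_vec x) = conj_vec (pr x)"
  by (simp add: vec_eq_iff pr_nth)

lemma conj_vec_in_cyl [simp]: "conj_vec x \<in> cyl s \<longleftrightarrow> x \<in> cyl s"
proof -
  have "norm (conj_vec y) = norm y" for y :: "complex ^ 'n" by (simp add: norm_vec_def)
  then show ?thesis by (simp add: cyl_def pr_conj_vec)
qed

end

section \<open>Jets of the graph function along the edge\<close>

text \<open>The sign \<sigma> selects the side occupied by the hypersurface. Smoothness of \<rho> is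
  two-sided, while commutation is assumed on that side alone.\<close>

locale edge_graph = graph_function a b \<rho> r for a b :: "'n::finite" and \<rho> :: "complex ^ 'n \<Rightarrow> real" and r +
  fixes \<sigma> :: real
  assumes \<sigma>: "\<sigma> * \<sigma> = 1"
    and edge: "\<And>x. x \<in> cyl r \<Longrightarrow> Im (x $ a) = 0 \<Longrightarrow> \<rho> x = 0"
    and comm: "\<And>x e e'. x \<in> cyl r \<Longrightarrow> 0 < \<sigma> * Im (x $ a) \<Longrightarrow> e $ b = 0 \<Longrightarrow> e' $ b = 0 \<Longrightarrow>
      lie_bracket (cr_lift e) (cr_lift e') x = 0"
begin

definition side :: "complex ^ 'n \<Rightarrow> real" where "side x = \<sigma> * Im (x $ a)"

lemma bounded_linear_side: "bounded_linear side"
  unfolding side_def[abs_def]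
  by (rule bounded_linear_compose[OF bounded_linear_mult_right bounded_linear_Im_nth])

lemma \<sigma>_nonzero [simp]: "\<sigma> \<noteq> 0" using \<sigma> by auto

lemma side_eq_0 [simp]: "side x = 0 \<longleftrightarrow> Im (x $ a) = 0" by (simp add: side_def)

lemma side_transversal: "side (\<sigma> *\<^sub>R im_a) = 1" using \<sigma> by (simp add: side_def)

abbreviation van :: "nat \<Rightarrow> (complex ^ 'n \<Rightarrow> real) \<Rightarrow> bool" where
  "van \<equiv> vanishes_to_order side (\<sigma> *\<^sub>R im_a) (cyl r)"

lemmas van_rules = bounded_linear_side side_transversal open_cyl[of r]

definition flat :: "nat \<Rightarrow> (complex ^ 'n \<Rightarrow> real) \<Rightarrow> bool" where
  "flat n f \<longleftrightarrow> smooth_on f (cyl r) \<and> van n f"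

lemma flat_add: "flat n f \<Longrightarrow> flat n g \<Longrightarrow> flat n (\<lambda>x. f x + g x)"
  unfolding flat_def using vanishes_to_order_add[OF van_rules] smooth_on_add[OF open_cyl] by blast

lemma flat_mult: "smooth_on g (cyl r) \<Longrightarrow> flat n f \<Longrightarrow> flat n (\<lambda>x. g x * f x)"
  unfolding flat_def using vanishes_to_order_mult[OF van_rules] smooth_on_mult[OF open_cyl] by blast

lemma flat_minus: "flat n f \<Longrightarrow> flat n (\<lambda>x. - f x)"
  using flat_mult[OF smooth_on_const[of "-1"]] by simp

lemma flat_diff: "flat n f \<Longrightarrow> flat n g \<Longrightarrow> flat n (\<lambda>x. f x - g x)"
  using flat_add[OF _ flat_minus] by simp

lemma flat_tangential: "flat n f \<Longrightarrow> Im (v $ a) = 0 \<Longrightarrow> flat n (\<lambda>x. Der f x v)"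
  unfolding flat_def using vanishes_to_order_tangential[OF van_rules, where f = f and n = n and v = v] smooth_on_derivative[where f = f and v = v] by simp

lemma flat_0: "flat 0 f \<longleftrightarrow> smooth_on f (cyl r) \<and> (\<forall>x\<in>cyl r. Im (x $ a) = 0 \<longrightarrow> f x = 0)"
  by (simp add: flat_def)

lemma flat_imp_eq_0: "flat n f \<Longrightarrow> x \<in> cyl r \<Longrightarrow> Im (x $ a) = 0 \<Longrightarrow> f x = 0"
  unfolding flat_def using vanishes_to_order_0[OF van_rules, where f = f and n = n and x = x] by simp

text \<open>This is the induction step for a system solved for the \<open>im_a\<close>-derivatives:
  if the right-hand side is flat of order \<open>n\<close>, the solution is flat of order
  \<open>n + 1\<close>. The factor \<sigma> adjusts the transversal direction.\<close>

lemma flat_SucI: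
  assumes f: "flat 0 f" and g: "flat n g"
    and eq: "\<And>x. x \<in> cyl r \<Longrightarrow> Der f x im_a = g x"
  shows "flat (Suc n) f"
proof -
  have sm: "smooth_on f (cyl r)" using f by (simp add: flat_def)
  have "flat n (\<lambda>x. \<sigma> * g x)" using g by (intro flat_mult smooth_on_const)
  then have *: "van n (\<lambda>x. \<sigma> * g x)" "smooth_on (\<lambda>x. \<sigma> * g x) (cyl r)" by (simp_all add: flat_def)
  have "\<sigma> * g x = Der f x (\<sigma> *\<^sub>R im_a)" if "x \<in> cyl r" for x
    using eq[OF that] linear_scale[OF smooth_on_linear_derivative[OF sm that]] by simp
  from vanishes_to_order_cong[OF van_rules this *]
  have "van n (\<lambda>x. Der f x (\<sigma> *\<^sub>R im_a))" .
  then show ?thesis using f by (simp add: flat_def)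
qed

lemma flat_if_zero_half_space:
  "smooth_on f (cyl r) \<Longrightarrow> (\<And>x. x \<in> cyl r \<Longrightarrow> 0 < side x \<Longrightarrow> f x = 0) \<Longrightarrow> flat n f"
  unfolding flat_def using vanishes_to_order_if_zero_half_space[OF van_rules] by blast

lemma conj_vec_dirs [simp]: "conj_vec re_a = re_a" "conj_vec im_a = - im_a" "conj_vec re_b = re_b"
  "conj_vec im_b = - im_b"
  by (simp_all add: vec_eq_iff)

lemma smooth_on_conj_vec: "smooth_on f (cyl r) \<Longrightarrow> smooth_on (\<lambda>x. f (conj_vec x)) (cyl r)"
  by (rule smooth_on_compose[OF open_cyl open_cyl _ _ smooth_on_bounded_linear[OF bounded_linear_conj_vec]]) auto

lemma D_conj_vec:
  assumes "smooth_on f (cyl r)" "x \<in> cyl r"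
  shows "Der (\<lambda>x. f (conj_vec x)) x v = Der f (conj_vec x) (conj_vec v)"
  using Der_eqI[OF has_derivative_conj_vec[OF smooth_on_has_derivative[OF assms(1)]]] assms(2)
  by simp

lemma D_minus:
  assumes "smooth_on f (cyl r)" "x \<in> cyl r"
  shows "Der f x (- v) = - Der f x v"
  using linear_neg[OF smooth_on_linear_derivative[OF assms]] .

lemma flat_conj_vec: "flat n f \<Longrightarrow> flat n (\<lambda>x. f (conj_vec x))"
proof (induction n arbitrary: f)
  case (0 f)
  then show ?case by (simp add: flat_0 smooth_on_conj_vec)
next
  case (Suc n f)
  have sm: "smooth_on f (cyl r)" using Suc.prems by (simp add: flat_def)
  have "flat n (\<lambda>x. Der f x (\<sigma> *\<^sub>R im_a))"
    using Suc.prems by (simp add: flat_def smooth_on_derivative)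
  then have "flat n (\<lambda>x. - \<sigma> * Der f (conj_vec x) (\<sigma> *\<^sub>R im_a))"
    by (intro flat_mult smooth_on_const Suc.IH)
  moreover have "Der (\<lambda>x. f (conj_vec x)) x im_a
      = - \<sigma> * Der f (conj_vec x) (\<sigma> *\<^sub>R im_a)" if "x \<in> cyl r" for x
    using that D_minus[OF sm, of "conj_vec x" im_a] \<sigma>
      linear_scale[OF smooth_on_linear_derivative[OF sm], of "conj_vec x" \<sigma> im_a]
    by (simp add: D_conj_vec[OF sm] mult.assoc[symmetric])
  moreover have "flat 0 (\<lambda>x. f (conj_vec x))"
    using Suc.prems by (simp add: flat_def smooth_on_conj_vec)
  ultimately show ?case by (rule flat_SucI[rotated])
qed

lemma flat_\<rho>: "flat 0 \<rho>"
  using edge smooth_\<rho> by (simp add: flat_0)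

text \<open>Derivatives of \<rho> tangential to the edge vanish, in particular that along
  \<open>re_b\<close>. What remains of \<open>p e\<close> is the derivative along
  \<open>J e\<close>, and of \<open>q e\<close> the one along \<open>e\<close>, whence the different
  conditions on \<open>e\<close>.\<close>

lemma pq_zero_on_edge:
  assumes x: "x \<in> cyl r" "Im (x $ a) = 0"
  shows "e $ a = 0 \<Longrightarrow> p e x = 0" "Im (e $ a) = 0 \<Longrightarrow> q e x = 0"
proof -
  have D0: "D\<rho> v x = 0" if "Im (v $ a) = 0" for v
    using flat_imp_eq_0[OF flat_tangential[OF flat_\<rho> that] x] .
  show "e $ a = 0 \<Longrightarrow> p e x = 0" "Im (e $ a) = 0 \<Longrightarrow> q e x = 0"
    by (simp_all add: p_def q_def D0)
qed

text \<open>These are the two coefficients of the bracket of lifts. They vanish on one open side,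
  hence to all orders on the edge.\<close>

lemma commutation:
  assumes e: "e $ b = 0" "e' $ b = 0"
  shows "flat n (\<lambda>x. Der (p e') x (cr_lift e x) - Der (p e) x (cr_lift e' x))" (is "flat n ?p")
    and "flat n (\<lambda>x. Der (q e') x (cr_lift e x) - Der (q e) x (cr_lift e' x))" (is "flat n ?q")
proof -
  have "?p x = 0 \<and> ?q x = 0" if x: "x \<in> cyl r" "0 < side x" for x
  proof -
    have "lie_bracket (cr_lift e) (cr_lift e') x $ b = 0"
      using comm[OF x(1) _ e] x(2) by (simp add: side_def)
    then show ?thesis by (simp add: lie_bracket_cr_lift[OF x(1)] complex_eq_iff)
  qed
  then show "flat n ?p" "flat n ?q"
    by (intro flat_if_zero_half_space smooth_on_diff smooth_on_derivative_apply smooth_p smooth_q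
        smooth_cr_lift open_cyl; simp)+
qed

abbreviation "P \<equiv> p re_a"
abbreviation "Q \<equiv> q re_a"

text \<open>The complex tangent spaces along the edge contain the directions of the remaining coordinates, so
  the slope \<open>P\<close> of the Levi foliation does not depend on these.\<close>

lemma D_P_edge:
  assumes x: "x \<in> cyl r" "Im (x $ a) = 0" and e: "e $ a = 0" "e $ b = 0"
  shows "Der P x e = 0"
proof -
  have "Der P x (cr_lift e x) - Der (p e) x (cr_lift re_a x) = 0"
    using flat_imp_eq_0[OF commutation(1)[of e re_a 0] x] e by simp
  moreover have "cr_lift e x = e"
    using pq_zero_on_edge[OF x, of e] e by (simp add: cr_lift_def)
  moreover have "flat 0 (p e)" using smooth_p pq_zero_on_edge(1) e by (simp add: flat_0)
  then have "Der (p e) x (cr_lift re_a x) = 0"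
    by (intro flat_imp_eq_0[OF flat_tangential x]) (auto simp: cr_lift_nth)
  ultimately show ?thesis by simp
qed

text \<open>\<open>conj_vec\<close> does not fix the edge pointwise, since it also conjugates the
  remaining coordinates. The segment from \<open>x\<close> to its image stays over the edge and
  moves only in those coordinates and in \<open>im_b\<close>; \<open>P\<close> is constant in all of
  these directions.\<close>

lemma P_conj_vec_edge:
  assumes x: "x \<in> cyl r" "Im (x $ a) = 0"
  shows "P (conj_vec x) = P x"
proof -
  define d where "d = conj_vec x - x"
  have d: "pr d $ a = 0" "pr d $ b = 0" using x(2) by (simp_all add: d_def pr_nth complex_eq_iff)
  have der: "((\<lambda>t. P (x + t *\<^sub>R d)) has_real_derivative 0) (at t)" if t: "0 \<le> t" "t \<le> 1" for t
  proof -
    have "(1 - t) *\<^sub>R x + t *\<^sub>R conj_vec x \<in> cyl r"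
      using x t convex_cyl by (intro convexD) auto
    then have y: "x + t *\<^sub>R d \<in> cyl r" by (simp add: d_def algebra_simps)
    have ya: "Im ((x + t *\<^sub>R d) $ a) = 0" using x(2) by (simp add: d_def)
    have DP: "(P has_derivative Der P (x + t *\<^sub>R d)) (at (x + t *\<^sub>R d))"
      using smooth_on_has_derivative[OF smooth_p y] .
    interpret linear "Der P (x + t *\<^sub>R d)" using smooth_on_linear_derivative[OF smooth_p y] .
    have "Der P (x + t *\<^sub>R d) im_b = 0"
      by (rule Der_eq_0_if_invariant[OF differentiableI[OF DP]]) (rule p_inv)
    moreover have "Der P (x + t *\<^sub>R d) (pr d) = 0" using D_P_edge[OF y ya d] .
    moreover have "Der P (x + t *\<^sub>R d) d =
        Der P (x + t *\<^sub>R d) (pr d) + Im (d $ b) * Der P (x + t *\<^sub>R d) im_b"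
      using add[of "pr d" "Im (d $ b) *\<^sub>R im_b"] by (simp add: pr_plus scale)
    ultimately have "Der P (x + t *\<^sub>R d) d = 0" by simp
    then show ?thesis
      using has_vector_derivative_along_line[OF DP] by (simp add: has_real_derivative_iff_has_vector_derivative)
  qed
  have "\<exists>z. (0::real) < z \<and> z < 1 \<and> P (x + 1 *\<^sub>R d) - P (x + 0 *\<^sub>R d) = (1 - 0) * 0"
  proof (rule MVT2[where f = "\<lambda>t. P (x + t *\<^sub>R d)" and f' = "\<lambda>_. 0"])
    show "((\<lambda>t. P (x + t *\<^sub>R d)) has_real_derivative 0) (at t)" if "0 \<le> t" "t \<le> 1" for t
      using der that .
  qed simp
  then show ?thesis by (auto simp: d_def)
qed

text \<open>The defects from the expected parity under conjugation: \<rho> and \<open>Q\<close> odd,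
  \<open>P\<close> even, so that the slope \<open>P + i Q\<close> is conjugated.\<close>

definition "\<delta>1 = (\<lambda>x. \<rho> x + \<rho> (conj_vec x))"
definition "\<delta>2 = (\<lambda>x. P x - P (conj_vec x))"
definition "\<delta>3 = (\<lambda>x. Q x + Q (conj_vec x))"

lemma smooth_\<delta>: "smooth_on \<delta>1 (cyl r)" "smooth_on \<delta>2 (cyl r)" "smooth_on \<delta>3 (cyl r)"
  unfolding \<delta>1_def \<delta>2_def \<delta>3_def
  by (intro smooth_on_add smooth_on_diff smooth_on_conj_vec smooth_\<rho> smooth_p smooth_q open_cyl)+

lemma has_derivative_reflected:
  assumes "x \<in> cyl r" "smooth_on f (cyl r)"
  shows "((\<lambda>x. f (conj_vec x)) has_derivative (\<lambda>v. Der f (conj_vec x) (conj_vec v))) (at x)"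
  using assms by (intro has_derivative_conj_vec smooth_on_has_derivative) auto

lemma D_\<delta>:
  assumes "x \<in> cyl r"
  shows "Der \<delta>1 x v = D\<rho> v x + D\<rho> (conj_vec v) (conj_vec x)"
    "Der \<delta>2 x v = Der P x v - Der P (conj_vec x) (conj_vec v)"
    "Der \<delta>3 x v = Der Q x v + Der Q (conj_vec x) (conj_vec v)"
  unfolding \<delta>1_def \<delta>2_def \<delta>3_def
  using Der_eqI[OF has_derivative_add[OF smooth_on_has_derivative[OF smooth_\<rho> assms] has_derivative_reflected[OF assms smooth_\<rho>]]]
    Der_eqI[OF has_derivative_diff[OF smooth_on_has_derivative[OF smooth_p assms] has_derivative_reflected[OF assms smooth_p]]]
    Der_eqI[OF has_derivative_add[OF smooth_on_has_derivative[OF smooth_q assms] has_derivative_reflected[OF assms smooth_q]]]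
  by simp_all

text \<open>With \<open>s = P + i Q\<close> and \<open>u = Re (x $ b)\<close>, the combination
  \<open>E2 + i E3\<close> is \<open>- i\<close> times
  \<open>2 ds/d(cnj z_a) + (cnj s) ds/du\<close>. These are thus the residuals of a Burgers-type
  equation for the slope, and equal the coefficients of the bracket of the lifts of
  \<open>im_a\<close> and \<open>re_a\<close>.\<close>

definition "E2 = (\<lambda>x. Der P x im_a - Q x * Der P x re_b
  + Der Q x re_a + P x * Der Q x re_b)"
definition "E3 = (\<lambda>x. Der Q x im_a - Q x * Der Q x re_b
  - Der P x re_a - P x * Der P x re_b)"

lemma flat_E: "flat n E2" "flat n E3"
proof -
  have eq: "E2 x = Der P x (cr_lift im_a x) - Der (p im_a) x (cr_lift re_a x)"
    "E3 x = Der Q x (cr_lift im_a x) - Der (q im_a) x (cr_lift re_a x)"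
    if x: "x \<in> cyl r" for x
  proof -
    have pq: "p im_a y = - Q y" "q im_a y = P y" if "y \<in> cyl r" for y
      using p_J[OF that, of re_a] q_J[OF that, of re_a] by simp_all
    have "(p im_a has_derivative (\<lambda>v. - Der Q x v)) (at x)"
      by (rule has_derivative_transform_within_open[OF has_derivative_minus[OF smooth_on_has_derivative[OF smooth_q x]] open_cyl x])
         (simp add: pq)
    then have Dp: "Der (p im_a) x = (\<lambda>v. - Der Q x v)"
      by (rule Der_eqI)
    have "(q im_a has_derivative Der P x) (at x)"
      by (rule has_derivative_transform_within_open[OF smooth_on_has_derivative[OF smooth_p x] open_cyl x])
         (simp add: pq)
    then have Dq: "Der (q im_a) x = Der P x"
      by (rule Der_eqI)
    show "E2 x = Der P x (cr_lift im_a x) - Der (p im_a) x (cr_lift re_a x)"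
      "E3 x = Der Q x (cr_lift im_a x) - Der (q im_a) x (cr_lift re_a x)"
      unfolding Dp Dq D_along_cr_lift[OF x smooth_p p_inv] D_along_cr_lift[OF x smooth_q q_inv]
      by (simp_all add: E2_def E3_def pq[OF x])
  qed
  have sm: "smooth_on E2 (cyl r)" "smooth_on E3 (cyl r)"
    unfolding E2_def E3_def
    by (intro smooth_on_add smooth_on_diff smooth_on_mult smooth_on_derivative smooth_p smooth_q open_cyl)+
  have C: "flat n (\<lambda>x. Der P x (cr_lift im_a x) - Der (p im_a) x (cr_lift re_a x))"
    "flat n (\<lambda>x. Der Q x (cr_lift im_a x) - Der (q im_a) x (cr_lift re_a x))"
    by (rule commutation; simp)+
  show "flat n E2"
    unfolding flat_def
    by (intro conjI sm(1), rule vanishes_to_order_cong[OF van_rules eq(1)[symmetric]])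
       (use C(1) in \<open>auto simp: flat_def\<close>)
  show "flat n E3"
    unfolding flat_def
    by (intro conjI sm(2), rule vanishes_to_order_cong[OF van_rules eq(2)[symmetric]])
       (use C(2) in \<open>auto simp: flat_def\<close>)
qed

text \<open>By the commutation relations \<open>E2\<close> and \<open>E3\<close>, the triple \<open>(\<rho>, P, Q)\<close> satisfies on the side of the hypersurface
  a first-order system that is solved for the \<open>im_a\<close>-derivatives and is invariant under the reflection. Hence the jets
  of the reflected triple along the edge agree with those of the original triple.\<close>

lemma flat_\<delta>: "flat n \<delta>1 \<and> flat n \<delta>2 \<and> flat n \<delta>3"
proof (induction n)
  case 0
  then show ?case
    using edge P_conj_vec_edge pq_zero_on_edge(2)[of _ re_a] smooth_\<delta>
    by (auto simp: flat_0 \<delta>1_def \<delta>2_def \<delta>3_def)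
next
  case (Suc n)
  then have IH: "flat n \<delta>1" "flat n \<delta>2" "flat n \<delta>3" by auto
  then have zero: "flat 0 \<delta>1" "flat 0 \<delta>2" "flat 0 \<delta>3"
    using flat_imp_eq_0 smooth_\<delta> unfolding flat_0 by blast+
  have sm_bar: "smooth_on (\<lambda>x. Der f (conj_vec x) v) (cyl r)"
    if "smooth_on f (cyl r)" for f :: "complex ^ 'n \<Rightarrow> real" and v
    using smooth_on_conj_vec[OF smooth_on_derivative[OF that]] .
  have tan: "flat n (\<lambda>x. Der f x re_b)" "flat n (\<lambda>x. Der f x re_a)"
    if "flat n f" for f using flat_tangential[OF that] by simp_all
  note intros = flat_add flat_diff flat_mult IH tan smooth_\<rho> smooth_p smooth_q sm_bar flat_conj_vec flat_E
  \<comment> \<open>Subtracting the relation \<open>D\<rho>_J_eq\<close> at the conjugate point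
    gives a difference of products; adding and subtracting a mixed product leaves a defect or one of
    its tangential derivatives in every term.\<close>
  let ?g1 = "\<lambda>x. \<delta>2 x + (Q x * Der \<delta>1 x re_b - D\<rho> re_b (conj_vec x) * \<delta>3 x)"
  have "Der \<delta>1 x im_a = ?g1 x" if x: "x \<in> cyl r" for x
    using D\<rho>_J_eq[of x re_a] D\<rho>_J_eq[of "conj_vec x" re_a] x
    by (simp add: D_\<delta> D_minus[OF smooth_\<rho>] \<delta>2_def \<delta>3_def) (simp add: algebra_simps)
  moreover have "flat n ?g1" by (intro intros)
  ultimately have 1: "flat (Suc n) \<delta>1" by (intro flat_SucI[OF zero(1)])
  \<comment> \<open>The same splitting for the quadratic terms. Conjugation reverses
    \<open>im_a\<close>, so the residual \<open>E2\<close> enters as a sum here and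
    \<open>E3\<close> as a difference below.\<close>
  let ?g2 = "\<lambda>x. E2 x + E2 (conj_vec x) + Q x * Der \<delta>2 x re_b + Der P (conj_vec x) re_b * \<delta>3 x
      - Der \<delta>3 x re_a - P x * Der \<delta>3 x re_b + Der Q (conj_vec x) re_b * \<delta>2 x"
  have "Der \<delta>2 x im_a = ?g2 x" if x: "x \<in> cyl r" for x
    using x unfolding D_\<delta>[OF x] conj_vec_dirs
    by (simp add: D_minus[OF smooth_p] \<delta>2_def \<delta>3_def E2_def) (simp add: algebra_simps)
  moreover have "flat n ?g2" by (intro intros)
  ultimately have 2: "flat (Suc n) \<delta>2" by (intro flat_SucI[OF zero(2)])
  let ?g3 = "\<lambda>x. E3 x - E3 (conj_vec x) + Q x * Der \<delta>3 x re_b - Der Q (conj_vec x) re_b * \<delta>3 x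
      + Der \<delta>2 x re_a + P x * Der \<delta>2 x re_b + Der P (conj_vec x) re_b * \<delta>2 x"
  have "Der \<delta>3 x im_a = ?g3 x" if x: "x \<in> cyl r" for x
    using x unfolding D_\<delta>[OF x] conj_vec_dirs
    by (simp add: D_minus[OF smooth_q] \<delta>2_def \<delta>3_def E3_def) (simp add: algebra_simps)
  moreover have "flat n ?g3" by (intro intros)
  ultimately have "flat (Suc n) \<delta>3" by (intro flat_SucI[OF zero(3)])
  with 1 2 show ?case by blast
qed

text \<open>Subtracting \<open>\<delta>1\<close> on the far side turns \<open>\<rho> x\<close> into
  \<open>- \<rho> (conj_vec x)\<close> there. As \<open>\<delta>1\<close> is flat to all orders, its
  cut-off is smooth.\<close>

lemma reflected_extension:
  obtains \<rho>' where "graph_function a b \<rho>' r"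
    "\<And>x. x \<in> cyl r \<Longrightarrow> 0 \<le> \<sigma> * Im (x $ a) \<Longrightarrow> \<rho>' x = \<rho> x"
    "\<And>x. x \<in> cyl r \<Longrightarrow> \<rho>' (conj_vec x) = - \<rho>' x"
proof
  define \<rho>' where "\<rho>' x = \<rho> x - (if side x < 0 then \<delta>1 x else 0)" for x
  have cut: "smooth_on (\<lambda>x. if side x < 0 then \<delta>1 x else 0) (cyl r)"
    using flat_\<delta> by (intro smooth_on_cut_off[OF van_rules]) (auto simp: flat_def)
  have inv: "\<rho>' (x + t *\<^sub>R im_b) = \<rho>' x" for x t
  proof -
    have "conj_vec (x + t *\<^sub>R im_b) = conj_vec x + (- t) *\<^sub>R im_b" by (simp add: vec_eq_iff)
    then have "\<delta>1 (x + t *\<^sub>R im_b) = \<delta>1 x" by (simp only: \<delta>1_def \<rho>_inv)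
    then show ?thesis by (simp add: \<rho>'_def \<rho>_inv side_def)
  qed
  show "graph_function a b \<rho>' r"
  proof
    show "smooth_on \<rho>' (cyl r)" unfolding \<rho>'_def by (intro smooth_on_diff open_cyl smooth_\<rho> cut)
  qed (rule inv)
  show "\<rho>' x = \<rho> x" if "x \<in> cyl r" "0 \<le> \<sigma> * Im (x $ a)" for x
    using that by (simp add: \<rho>'_def side_def)
  show "\<rho>' (conj_vec x) = - \<rho>' x" if x: "x \<in> cyl r" for x
  proof -
    have side: "side (conj_vec x) = - side x" by (simp add: side_def)
    consider "side x < 0" | "0 < side x" | "side x = 0" by linarith
    then show ?thesis
    proof cases
      case 3
      then have "\<rho> x = 0" "\<rho> (conj_vec x) = 0" using edge[OF x] edge[of "conj_vec x"] x by simp_all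
      with 3 show ?thesis by (simp add: \<rho>'_def side del: side_eq_0)
    qed (simp_all add: \<rho>'_def side \<delta>1_def)
  qed
qed

end

section \<open>Levi-flatness of the reflected graph\<close>

context graph_function
begin

text \<open>Involutivity quantifies over arbitrary ambient fields, so it is localized to
  \<open>W \<inter> V\<close> on the known side and applied to conjugated fields on the other. At
  edge points it matters that complex tangency of the bracket is a pair of equations between
  functions continuous in the base point.\<close>

lemma involutive_if_reflection_symmetric:
  assumes \<sigma>: "\<sigma> \<noteq> 0" and sym: "\<And>x. x \<in> cyl r \<Longrightarrow> \<rho> (conj_vec x) = - \<rho> x"
    and V: "open V" "M \<inter> V = graph \<inter> V" "\<And>x. x \<in> graph \<Longrightarrow> 0 < \<sigma> * Im (x $ a) \<Longrightarrow> x \<in> V"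
    and M: "involutive M (complex_tangent_space M)"
  shows "involutive graph (complex_tangent_space graph)"
proof -
  define T where "T x = {w. Im (w $ b) = D\<rho> w x \<and> Re (w $ b) = D\<rho> (J w) x}" for x
  have T: "complex_tangent_space graph x = T x" if "x \<in> graph" for x
    using complex_tangent_space_graph[OF open_UNIV _ _ that] by (simp add: T_def)
  have TM: "complex_tangent_space M x = T x" if "x \<in> graph" "x \<in> V" for x
    using complex_tangent_space_graph[OF V(1) that(2) V(2) that(1)] by (simp add: T_def)
  have pos: "lie_bracket X Y x \<in> T x"
    if W: "open W" and X: "smooth_on X W" and Y: "smooth_on Y W" and XY: "\<forall>x\<in>graph \<inter> W. X x \<in> T x \<and> Y x \<in> T x"
      and x: "x \<in> graph \<inter> W" "0 < \<sigma> * Im (x $ a)" for W X Y x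
  proof -
    have xV: "x \<in> V" using V(3) x by blast
    have "\<forall>y\<in>M \<inter> (W \<inter> V). X y \<in> complex_tangent_space M y \<and> Y y \<in> complex_tangent_space M y"
      using XY TM V(2) by blast
    moreover have "smooth_on X (W \<inter> V)" "smooth_on Y (W \<inter> V)" using X Y smooth_on_subset by blast+
    moreover have "x \<in> M \<inter> (W \<inter> V)" using x xV V(2) by blast
    ultimately have "lie_bracket X Y x \<in> complex_tangent_space M x"
      using M W V(1) unfolding involutive_def by (meson open_Int)
    then show ?thesis using TM xV x by simp
  qed
  have graph_conj: "conj_vec x \<in> graph" if "x \<in> graph" for x
    using that sym by (simp add: graph_def)
  \<comment> \<open>Oddness of \<rho> and anticommutation of \<open>J\<close> with
    \<open>conj_vec\<close> each contribute a sign, which match those of the conjugated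
    \<open>b\<close>-component.\<close>
  have T_conj: "conj_vec w \<in> T (conj_vec x)" if x: "x \<in> graph" and w: "w \<in> T x" for x w
  proof -
    have xr: "x \<in> cyl r" "conj_vec x \<in> cyl r" using x by (auto simp: graph_def)
    have "((\<lambda>x. - \<rho> (conj_vec x)) has_derivative (\<lambda>v. - D\<rho> (conj_vec v) (conj_vec x))) (at x)"
      by (intro has_derivative_minus has_derivative_conj_vec smooth_on_has_derivative[OF smooth_\<rho>] xr)
    then have "(\<rho> has_derivative (\<lambda>v. - D\<rho> (conj_vec v) (conj_vec x))) (at x)"
      by (rule has_derivative_transform_within_open[OF _ open_cyl xr(1)]) (simp add: sym)
    then have D: "D\<rho> v x = - D\<rho> (conj_vec v) (conj_vec x)" for v by (simp add: Der_eqI)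
    have "D\<rho> (J (conj_vec w)) (conj_vec x) = - D\<rho> (conj_vec (J w)) (conj_vec x)"
      using linear_neg[OF linear_D\<rho>[OF xr(2)]] by (simp add: complex_structure_conj_vec)
    then show ?thesis using w D[of w] D[of "J w"] by (simp add: T_def)
  qed
  show ?thesis
    unfolding involutive_def
  proof (intro allI impI ballI)
    fix W X Y x
    assume W: "open W" and X: "smooth_on X W" and Y: "smooth_on Y W"
      and "\<forall>x\<in>graph \<inter> W. X x \<in> complex_tangent_space graph x \<and> Y x \<in> complex_tangent_space graph x"
      and x: "x \<in> graph \<inter> W"
    then have XY: "\<forall>x\<in>graph \<inter> W. X x \<in> T x \<and> Y x \<in> T x" using T by auto
    have xr: "x \<in> cyl r" using x by (simp add: graph_def)
    consider "0 < \<sigma> * Im (x $ a)" | "\<sigma> * Im (x $ a) < 0" | "Im (x $ a) = 0"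
      using \<sigma> by (metis linorder_neqE_linordered_idom mult_eq_0_iff)
    then have "lie_bracket X Y x \<in> T x"
    proof cases
      case 1
      then show ?thesis using pos[OF W X Y XY x] by blast
    next
      case 2
      let ?X = "\<lambda>x. conj_vec (X (conj_vec x))" and ?Y = "\<lambda>x. conj_vec (Y (conj_vec x))"
      let ?W = "conj_vec -` W"
      have W': "open ?W"
        by (intro open_vimage W linear_continuous_on[OF bounded_linear_conj_vec])
      have sm: "smooth_on (\<lambda>x. conj_vec (Z (conj_vec x))) ?W" if "smooth_on Z W" for Z
        by (intro smooth_on_bounded_linear_compose[OF bounded_linear_conj_vec W']
            smooth_on_compose[OF W' W _ that smooth_on_bounded_linear[OF bounded_linear_conj_vec]]) auto
      have "\<forall>y\<in>graph \<inter> ?W. ?X y \<in> T y \<and> ?Y y \<in> T y"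
      proof
        fix y assume "y \<in> graph \<inter> ?W"
        then have "conj_vec y \<in> graph \<inter> W" using graph_conj by simp
        then show "?X y \<in> T y \<and> ?Y y \<in> T y" using XY T_conj[of "conj_vec y"] by fastforce
      qed
      then have "lie_bracket ?X ?Y (conj_vec x) \<in> T (conj_vec x)"
        using x graph_conj 2 by (intro pos[OF W' sm[OF X] sm[OF Y]]) auto
      moreover have "lie_bracket ?X ?Y (conj_vec x) = conj_vec (lie_bracket X Y x)"
        using lie_bracket_conj_vec[of X "conj_vec x" Y] smooth_on_has_derivative[OF X] smooth_on_has_derivative[OF Y] x
        by (auto simp: differentiable_def)
      ultimately show ?thesis using T_conj[of "conj_vec x"] graph_conj x by fastforce
    next
      case 3
      let ?B = "lie_bracket X Y"
      let ?S = "W \<inter> cyl r"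
      have S: "open ?S" "x \<in> ?S" using W open_cyl x xr by auto
      have smB: "smooth_on ?B ?S"
        using smooth_on_lie_bracket[OF W X Y] by (rule smooth_on_subset) simp
      have sm\<rho>: "smooth_on \<rho> ?S" using smooth_\<rho> by (rule smooth_on_subset) simp
      have sm: "smooth_on (\<lambda>y. Im (?B y $ b) - D\<rho> (?B y) y) ?S"
        "smooth_on (\<lambda>y. Re (?B y $ b) - D\<rho> (J (?B y)) y) ?S"
        by (intro smooth_on_diff S(1) smooth_on_derivative_apply sm\<rho> smB
            smooth_on_bounded_linear_compose[OF bounded_linear_complex_structure]
            smooth_on_bounded_linear_compose[OF bounded_linear_Im_nth]
            smooth_on_bounded_linear_compose[OF bounded_linear_Re_nth])+
      \<comment> \<open>A curve on the graph that approaches \<open>x\<close> from the side where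
        involutivity is known.\<close>
      define c where "c s = pr (x + s *\<^sub>R (\<sigma> *\<^sub>R im_a)) + \<rho> (x + s *\<^sub>R (\<sigma> *\<^sub>R im_a)) *\<^sub>R im_b" for s
      have line: "((\<lambda>s. x + s *\<^sub>R (\<sigma> *\<^sub>R im_a)) \<longlongrightarrow> x) (at_right 0)" by (auto intro!: tendsto_eq_intros)
      have "(c \<longlongrightarrow> pr x + \<rho> x *\<^sub>R im_b) (at_right 0)"
        unfolding c_def
        by (intro tendsto_intros bounded_linear.tendsto[OF bounded_linear_pr line]
            isCont_tendsto_compose[OF continuous_at_\<rho>[OF xr] line])
      then have c: "(c \<longlongrightarrow> x) (at_right 0)" using x by (simp add: graph_def pr_def algebra_simps)
      have "\<forall>\<^sub>F s in at_right 0. c s \<in> ?S" using topological_tendstoD[OF c S] .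
      moreover have "\<forall>\<^sub>F s in at_right 0. 0 < (s::real)" by (simp add: eventually_at_right_less)
      ultimately have ev: "\<forall>\<^sub>F s in at_right 0. ?B (c s) \<in> T (c s)"
      proof eventually_elim
        case (elim s)
        have "\<rho> (c s) = \<rho> (x + s *\<^sub>R (\<sigma> *\<^sub>R im_a))" by (simp only: c_def \<rho>_inv \<rho>_pr)
        then have "c s \<in> graph \<inter> W" using elim(1) by (simp add: graph_def) (simp add: c_def)
        moreover have "0 < \<sigma> * \<sigma>" using \<sigma> not_real_square_gt_zero by blast
        then have "0 < s * (\<sigma> * \<sigma>)" by (rule mult_pos_pos[OF elim(2)])
        then have "0 < \<sigma> * Im (c s $ a)" using 3 by (simp add: c_def pr_nth mult_ac)
        ultimately show ?case using pos[OF W X Y XY] by blast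
      qed
      have zero: "f x = 0" if f: "smooth_on f ?S" and z: "\<And>y. ?B y \<in> T y \<Longrightarrow> f y = 0" for f :: "complex ^ 'n \<Rightarrow> real"
      proof (rule tendsto_unique)
        have "continuous (at x) f"
          using smooth_on_continuous_on[OF f] S continuous_on_eq_continuous_at by blast
        then show "((\<lambda>s. f (c s)) \<longlongrightarrow> f x) (at_right 0)" using c isCont_tendsto_compose by blast
        have "\<forall>\<^sub>F s in at_right 0. 0 = f (c s)" using ev by eventually_elim (simp add: z)
        with tendsto_const show "((\<lambda>s. f (c s)) \<longlongrightarrow> 0) (at_right 0)" by (rule Lim_transform_eventually)
      qed simp
      show ?thesis using zero[OF sm(1)] zero[OF sm(2)] by (simp add: T_def)
    qed
    then show "lie_bracket X Y x \<in> complex_tangent_space graph x" using T x by simp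
  qed
qed

end

section \<open>Local normal forms\<close>

lemma open_Collect_pos_on:
  fixes f :: "'a::topological_space \<Rightarrow> real"
  assumes "open S" "continuous_on S f"
  shows "open {x \<in> S. 0 < f x}"
proof -
  have "{x \<in> S. 0 < f x} = S \<inter> f -` {0<..}" by auto
  then show ?thesis using continuous_open_preimage[OF assms(2,1), of "{0<..}"] by simp
qed

section \<open>Implicit functions and transversal signs\<close>

text \<open>A positive derivative persists near 0, giving strict monotonicity along lines, and
  opposite signs at the two ends persist for nearby lines, giving a zero. The lemma serves both to
  solve for the graph and to find the side of the edge.\<close>

lemma transversal_function_on_lines:
  fixes f :: "'a::real_normed_vector \<Rightarrow> real"
  assumes U: "open U" "0 \<in> U" and f: "smooth_on f U" "f 0 = 0" and pos: "0 < Der f 0 v" and v: "norm v = 1"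
  obtains c r where "0 < c" "0 < r" "r \<le> c"
    "\<And>y t. norm y < c \<Longrightarrow> \<bar>t\<bar> \<le> c \<Longrightarrow> y + t *\<^sub>R v \<in> U \<and> 0 < Der f (y + t *\<^sub>R v) v"
    "\<And>y t1 t2. norm y < c \<Longrightarrow> -c \<le> t1 \<Longrightarrow> t1 < t2 \<Longrightarrow> t2 \<le> c \<Longrightarrow> f (y + t1 *\<^sub>R v) < f (y + t2 *\<^sub>R v)"
    "\<And>y. norm y < r \<Longrightarrow> \<exists>t. \<bar>t\<bar> < c \<and> f (y + t *\<^sub>R v) = 0"
proof -
  let ?D = "\<lambda>x. Der f x v"
  have "open {x \<in> U. 0 < ?D x}"
    by (rule open_Collect_pos_on[OF U(1) smooth_on_continuous_on[OF smooth_on_derivative[OF f(1)]]])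
  moreover have "0 \<in> {x \<in> U. 0 < ?D x}" using U pos by simp
  ultimately obtain r1 where r1: "0 < r1" "ball 0 r1 \<subseteq> {x \<in> U. 0 < ?D x}" using openE by blast
  define c where "c = r1 / 2"
  have c: "0 < c" using r1 by (simp add: c_def)
  have good: "y + t *\<^sub>R v \<in> U" "0 < ?D (y + t *\<^sub>R v)" if "norm y < c" "\<bar>t\<bar> \<le> c" for y t
  proof -
    have "y + t *\<^sub>R v \<in> ball 0 r1"
      using norm_triangle_ineq[of y "t *\<^sub>R v"] that v by (simp add: c_def)
    then show "y + t *\<^sub>R v \<in> U" "0 < ?D (y + t *\<^sub>R v)" using r1(2) by auto
  qed
  have der: "((\<lambda>t. f (y + t *\<^sub>R v)) has_real_derivative ?D (y + t *\<^sub>R v)) (at t)"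
    if "norm y < c" "\<bar>t\<bar> \<le> c" for y t
    using has_vector_derivative_along_line[OF smooth_on_has_derivative[OF f(1) good(1)[OF that]]]
    by (simp add: has_real_derivative_iff_has_vector_derivative)
  have mono: "f (y + t1 *\<^sub>R v) < f (y + t2 *\<^sub>R v)"
    if "norm y < c" "-c \<le> t1" "t1 < t2" "t2 \<le> c" for y t1 t2
    using that(3)
  proof (rule DERIV_pos_imp_increasing)
    fix t assume "t1 \<le> t" "t \<le> t2"
    then have "\<bar>t\<bar> \<le> c" using that by auto
    then show "\<exists>d. ((\<lambda>t. f (y + t *\<^sub>R v)) has_real_derivative d) (at t) \<and> 0 < d"
      using der good(2) that(1) by blast
  qed
  have end_pts: "0 < f (c *\<^sub>R v)" "f ((-c) *\<^sub>R v) < 0"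
    using mono[of 0 0 c] mono[of 0 "-c" 0] c f(2) by auto
  have cont: "continuous (at (t *\<^sub>R v)) f" if "\<bar>t\<bar> \<le> c" for t
    using has_derivative_continuous[OF smooth_on_has_derivative[OF f(1) good(1)[of 0 t]]] c that by simp
  obtain d1 where d1: "0 < d1" "\<And>x. dist x (c *\<^sub>R v) < d1 \<Longrightarrow> dist (f x) (f (c *\<^sub>R v)) < f (c *\<^sub>R v)"
    using cont[of c] end_pts(1) c unfolding continuous_at_eps_delta by fastforce
  obtain d2 where d2: "0 < d2"
    "\<And>x. dist x ((-c) *\<^sub>R v) < d2 \<Longrightarrow> dist (f x) (f ((-c) *\<^sub>R v)) < - f ((-c) *\<^sub>R v)"
    using cont[of "-c"] end_pts(2) c unfolding continuous_at_eps_delta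
    by (metis abs_minus_cancel abs_of_pos neg_0_less_iff_less order_refl)
  define r where "r = min c (min d1 d2)"
  have r: "0 < r" "r \<le> c" "r \<le> d1" "r \<le> d2" using c d1 d2 by (auto simp: r_def)
  have "\<exists>t. \<bar>t\<bar> < c \<and> f (y + t *\<^sub>R v) = 0" if y: "norm y < r" for y
  proof -
    have yc: "norm y < c" using y r by simp
    have e: "0 < f (y + c *\<^sub>R v)" "f (y + (-c) *\<^sub>R v) < 0"
      using d1(2)[of "y + c *\<^sub>R v"] d2(2)[of "y + (-c) *\<^sub>R v"] y r by (auto simp: dist_norm dist_real_def)
    moreover have "continuous_on {-c..c} (\<lambda>t. f (y + t *\<^sub>R v))"
      using DERIV_isCont[OF der[OF yc]] by (intro continuous_at_imp_continuous_on) auto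
    ultimately obtain t where t: "-c \<le> t" "t \<le> c" "f (y + t *\<^sub>R v) = 0"
      using IVT'[of "\<lambda>t. f (y + t *\<^sub>R v)" "-c" 0 c] c by force
    moreover have "t \<noteq> c" "t \<noteq> -c" using t(3) e by auto
    ultimately show ?thesis by (intro exI[of _ t]) auto
  qed
  then show thesis using that[OF c r(1,2)] good mono by blast
qed

context two_coords
begin

lemma norm_im_b [simp]: "norm im_b = 1" and norm_im_a [simp]: "norm im_a = 1"
  by (simp_all add: im_a_def im_b_def norm_eq_sqrt_inner inner_axis_axis inner_complex_def)

lemma open_box: "open {x \<in> cyl r. \<bar>Im (x $ b)\<bar> < \<eta>}"
proof -
  have "open {x :: complex ^ 'n. \<bar>Im (x $ b)\<bar> < \<eta>}"
    by (intro open_Collect_less continuous_intros linear_continuous_on[OF bounded_linear_Im_nth])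
  then show ?thesis using open_cyl[of r] by (simp add: Collect_conj_eq open_Int)
qed

lemma graph_function_mono: "graph_function a b \<rho> r \<Longrightarrow> r' \<le> r \<Longrightarrow> graph_function a b \<rho> r'"
  unfolding graph_function_def graph_function_axioms_def using smooth_on_subset cyl_mono by blast

text \<open>Each line in direction \<open>im_b\<close> carries exactly one zero. The map
  \<open>\<Psi>\<close>, which replaces the \<open>im_b\<close>-component by \<open>f\<close>, has
  the inverse \<open>g\<close>, and this gives the derivative of \<rho>. That derivative is a smooth
  expression in \<open>G\<close>, which contains only \<rho> itself, so regularity improves by one
  order per step.\<close>

lemma implicit_function_pos:
  assumes U: "open U" "0 \<in> U" and f: "smooth_on f U" "f 0 = (0::real)"
    and pos: "0 < Der f 0 im_b"
  shows "\<exists>\<rho> r \<eta>. 0 < r \<and> 0 < \<eta> \<and> graph_function a b \<rho> r \<and> (\<forall>x\<in>cyl r. \<bar>\<rho> x\<bar> < \<eta>) \<and>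
    (\<forall>x\<in>cyl r. \<bar>Im (x $ b)\<bar> < \<eta> \<longrightarrow> x \<in> U \<and> (f x = 0 \<longleftrightarrow> Im (x $ b) = \<rho> x))"
proof -
  let ?D = "\<lambda>v x. Der f x v"
  obtain \<eta> r where \<eta>: "0 < \<eta>" and r: "0 < r" "r \<le> \<eta>"
    and good: "\<And>y v. norm y < \<eta> \<Longrightarrow> \<bar>v\<bar> \<le> \<eta> \<Longrightarrow> y + v *\<^sub>R im_b \<in> U \<and> 0 < ?D im_b (y + v *\<^sub>R im_b)"
    and mono: "\<And>y v1 v2. norm y < \<eta> \<Longrightarrow> -\<eta> \<le> v1 \<Longrightarrow> v1 < v2 \<Longrightarrow> v2 \<le> \<eta> \<Longrightarrow> f (y + v1 *\<^sub>R im_b) < f (y + v2 *\<^sub>R im_b)"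
    and ex_pre: "\<And>y. norm y < r \<Longrightarrow> \<exists>v. \<bar>v\<bar> < \<eta> \<and> f (y + v *\<^sub>R im_b) = 0"
    using transversal_function_on_lines[OF U f pos norm_im_b] by metis
  have pr_small: "norm (pr x) < \<eta>" if "x \<in> cyl r" for x using that r(2) by (simp add: cyl_def)
  have ex: "\<exists>v. \<bar>v\<bar> < \<eta> \<and> f (pr x + v *\<^sub>R im_b) = 0" if "x \<in> cyl r" for x
    using ex_pre[of "pr x"] that by (simp add: cyl_def)
  have uniq: "v1 = v2" if "norm y < \<eta>" "\<bar>v1\<bar> < \<eta>" "\<bar>v2\<bar> < \<eta>" "f (y + v1 *\<^sub>R im_b) = f (y + v2 *\<^sub>R im_b)" for y v1 v2
    using mono[OF that(1), of v1 v2] mono[OF that(1), of v2 v1] that(2-4) by (cases v1 v2 rule: linorder_cases) (auto simp: abs_less_iff)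
  \<comment> \<open>The equation is solved for every right-hand side \<open>Im (y $ b)\<close>, not
    only 0, because \<open>g\<close> has to invert \<open>\<Psi>\<close> on a full
    neighbourhood.\<close>
  define h where "h y = (SOME v. \<bar>v\<bar> < \<eta> \<and> f (pr y + v *\<^sub>R im_b) = Im (y $ b))" for y
  define \<rho> where "\<rho> x = h (pr x)" for x
  define g where "g y = pr y + h y *\<^sub>R im_b" for y
  define \<Psi> where "\<Psi> x = pr x + f x *\<^sub>R im_b" for x
  define box where "box = {x \<in> cyl r. \<bar>Im (x $ b)\<bar> < \<eta>}"
  have box: "open box" unfolding box_def by (rule open_box)
  have box_U: "x \<in> U" "0 < ?D im_b x" if "x \<in> box" for x
    using good[of "pr x" "Im (x $ b)"] pr_small[of x] that by (auto simp: box_def pr_plus)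
  have \<rho>: "\<bar>\<rho> x\<bar> < \<eta>" "f (pr x + \<rho> x *\<^sub>R im_b) = 0" if "x \<in> cyl r" for x
    using someI_ex[OF ex[OF that]] by (simp_all add: \<rho>_def h_def)
  have iff: "f x = 0 \<longleftrightarrow> Im (x $ b) = \<rho> x" if "x \<in> box" for x
  proof
    have x: "x \<in> cyl r" "\<bar>Im (x $ b)\<bar> < \<eta>" using that by (auto simp: box_def)
    show "Im (x $ b) = \<rho> x" if "f x = 0"
      using uniq[OF pr_small[OF x(1)] x(2) \<rho>(1)[OF x(1)]] \<rho>(2)[OF x(1)] that by (simp add: pr_plus)
    show "f x = 0" if "Im (x $ b) = \<rho> x"
      using \<rho>(2)[OF x(1)] unfolding that[symmetric] by (simp add: pr_plus)
  qed
  define G where "G x = pr x + \<rho> x *\<^sub>R im_b" for x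
  have G_box: "G x \<in> box" if "x \<in> cyl r" for x
    using that \<rho>(1)[OF that] by (simp add: G_def box_def)
  define \<rho>' where "\<rho>' x w = - ?D (pr w) (G x) / ?D im_b (G x)" for x w
  have der\<rho>: "(\<rho> has_derivative \<rho>' x) (at x)" if x: "x \<in> cyl r" for x
  proof -
    have GU: "G x \<in> U" and m: "0 < ?D im_b (G x)" using box_U[OF G_box[OF x]] by auto
    have "\<Psi> (G x) = pr x" using \<rho>(2)[OF x] by (simp add: \<Psi>_def) (simp add: G_def)
    define g' where "g' w = pr w + ((Im (w $ b) - ?D (pr w) (G x)) / ?D im_b (G x)) *\<^sub>R im_b" for w
    interpret linear "\<lambda>v. ?D v (G x)" using smooth_on_linear_derivative[OF f(1) GU] by simp
    have "(g has_derivative g') (at (\<Psi> (G x)))"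
    proof (rule has_derivative_inverse_strong[OF box G_box[OF x]])
      have "continuous_on box f"
        using smooth_on_continuous_on[OF f(1)] box_U(1) continuous_on_subset by blast
      then show "continuous_on box \<Psi>"
        unfolding \<Psi>_def by (intro continuous_intros linear_continuous_on[OF bounded_linear_pr])
      show "g (\<Psi> y) = y" if y: "y \<in> box" for y
      proof -
        have y': "y \<in> cyl r" "\<bar>Im (y $ b)\<bar> < \<eta>" using y by (auto simp: box_def)
        have fy: "f (pr y + Im (y $ b) *\<^sub>R im_b) = f y" by (simp add: pr_plus)
        have "h (\<Psi> y) = (SOME v. \<bar>v\<bar> < \<eta> \<and> f (pr y + v *\<^sub>R im_b) = f y)"
          by (simp add: h_def \<Psi>_def)
        also have "\<dots> = Im (y $ b)"
        proof (rule some_equality)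
          show "\<bar>Im (y $ b)\<bar> < \<eta> \<and> f (pr y + Im (y $ b) *\<^sub>R im_b) = f y" using y'(2) fy by blast
          show "v = Im (y $ b)" if "\<bar>v\<bar> < \<eta> \<and> f (pr y + v *\<^sub>R im_b) = f y" for v
            using uniq[OF pr_small[OF y'(1)] _ y'(2), of v] that fy by simp
        qed
        finally show ?thesis by (simp add: g_def \<Psi>_def) (simp add: pr_plus)
      qed
      show "(\<Psi> has_derivative (\<lambda>v. pr v + ?D v (G x) *\<^sub>R im_b)) (at (G x))"
        unfolding \<Psi>_def
        by (intro has_derivative_add has_derivative_pr
            has_derivative_scaleR_left smooth_on_has_derivative[OF f(1) GU])
      show "(\<lambda>v. pr v + ?D v (G x) *\<^sub>R im_b) \<circ> g' = id"
      proof
        fix w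
        have "?D (g' w) (G x) = Im (w $ b)"
          using m by (simp add: g'_def add scale)
        then show "((\<lambda>v. pr v + ?D v (G x) *\<^sub>R im_b) \<circ> g') w = id w"
          by (simp add: g'_def) (simp add: pr_plus)
      qed
    qed
    then have "(g has_derivative g') (at (pr x))" by (simp add: \<open>\<Psi> (G x) = pr x\<close>)
    from has_derivative_compose[OF has_derivative_pr this]
    have "((\<lambda>x. Im (g (pr x) $ b)) has_derivative (\<lambda>w. Im (g' (pr w) $ b))) (at x)"
      by (rule bounded_linear.has_derivative[OF bounded_linear_Im_nth])
    moreover have "(\<lambda>x. Im (g (pr x) $ b)) = \<rho>" by (simp add: g_def \<rho>_def fun_eq_iff)
    moreover have "(\<lambda>w. Im (g' (pr w) $ b)) = \<rho>' x" by (simp add: g'_def \<rho>'_def fun_eq_iff)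
    ultimately show ?thesis by simp
  qed
  have "Ck_on k \<rho> (cyl r)" for k
  proof (induction k)
    case 0
    show ?case
      using has_derivative_continuous[OF der\<rho>] by (auto intro: continuous_at_imp_continuous_on)
  next
    case (Suc k)
    show ?case
    proof (rule Ck_on_SucI[OF open_cyl der\<rho>])
      fix w
      have G: "Ck_on k G (cyl r)"
        unfolding G_def[abs_def]
        by (intro Ck_on_add Ck_on_bilinear[OF bounded_bilinear_scaleR] Ck_on_const
            Ck_on_bounded_linear[OF bounded_linear_pr] open_cyl Suc.IH)
      have "smooth_on f box" using f(1) box_U(1) smooth_on_subset by blast
      moreover have "?D im_b y \<noteq> 0" if "y \<in> box" for y using box_U(2)[OF that] by simp
      ultimately have "smooth_on (\<lambda>y. - ?D (pr w) y / ?D im_b y) box"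
        by (intro smooth_on_divide box smooth_on_minus smooth_on_derivative) auto
      then show "Ck_on k (\<lambda>x. \<rho>' x w) (cyl r)"
        unfolding \<rho>'_def
        by (intro Ck_on_compose[OF open_cyl box _ smooth_onD G, where f = "\<lambda>y. - ?D (pr w) y / ?D im_b y"])
           (use G_box in auto)
    qed
  qed
  then have gf: "graph_function a b \<rho> r"
    by unfold_locales (simp_all add: smooth_on_def \<rho>_def)
  show ?thesis
  proof (intro exI conjI ballI impI)
    show "0 < r" "0 < \<eta>" "graph_function a b \<rho> r" by fact+
    show "\<bar>\<rho> x\<bar> < \<eta>" if "x \<in> cyl r" for x using \<rho>(1)[OF that] .
    show "x \<in> U" "f x = 0 \<longleftrightarrow> Im (x $ b) = \<rho> x" if "x \<in> cyl r" "\<bar>Im (x $ b)\<bar> < \<eta>" for x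
      using box_U(1)[of x] iff[of x] that by (simp_all add: box_def)
  qed
qed

lemma implicit_function:
  assumes U: "open U" "0 \<in> U" and f: "smooth_on f U" "f 0 = (0::real)"
    and nz: "Der f 0 im_b \<noteq> 0"
  shows "\<exists>\<rho> r \<eta>. 0 < r \<and> 0 < \<eta> \<and> graph_function a b \<rho> r \<and> (\<forall>x\<in>cyl r. \<bar>\<rho> x\<bar> < \<eta>) \<and>
    (\<forall>x\<in>cyl r. \<bar>Im (x $ b)\<bar> < \<eta> \<longrightarrow> x \<in> U \<and> (f x = 0 \<longleftrightarrow> Im (x $ b) = \<rho> x))"
proof (cases "0 < Der f 0 im_b")
  case True
  show ?thesis using implicit_function_pos[OF U f True] .
next
  case False
  have "Der (\<lambda>x. - f x) 0 im_b = - Der f 0 im_b"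
    using Der_eqI[OF has_derivative_minus[OF smooth_on_has_derivative[OF f(1) U(2)]]] by simp
  then have "0 < Der (\<lambda>x. - f x) 0 im_b" using False nz by simp
  from implicit_function_pos[OF U smooth_on_minus[OF U(1) f(1)] _ this] f(2) show ?thesis by simp
qed

text \<open>Each line in direction \<open>im_a\<close> meets the zero set, which by hypothesis can
  only happen at \<open>Im (x $ a) = 0\<close>. So the whole hyperplane consists of zeros, and
  monotonicity fixes the sign on either side.\<close>

lemma sign_of_transversal_function:
  fixes h :: "complex ^ 'n \<Rightarrow> real"
  assumes r: "0 < r" and h: "smooth_on h (cyl r)" "\<And>x t. h (x + t *\<^sub>R im_b) = h x"
    and h0: "h 0 = 0" and pos: "0 < Der h 0 im_a"
    and zero: "\<And>x. x \<in> cyl r \<Longrightarrow> h x = 0 \<Longrightarrow> Im (x $ a) = 0"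
  shows "\<exists>r'>0. r' \<le> r \<and> (\<forall>x\<in>cyl r'. (h x = 0 \<longleftrightarrow> Im (x $ a) = 0) \<and> (0 < h x \<longleftrightarrow> 0 < Im (x $ a)))"
proof -
  obtain c r1 where c: "0 < c" and r1: "0 < r1" "r1 \<le> c"
    and good: "\<And>y t. norm y < c \<Longrightarrow> \<bar>t\<bar> \<le> c \<Longrightarrow> y + t *\<^sub>R im_a \<in> cyl r \<and> 0 < Der h (y + t *\<^sub>R im_a) im_a"
    and mono: "\<And>y t1 t2. norm y < c \<Longrightarrow> -c \<le> t1 \<Longrightarrow> t1 < t2 \<Longrightarrow> t2 \<le> c \<Longrightarrow> h (y + t1 *\<^sub>R im_a) < h (y + t2 *\<^sub>R im_a)"
    and ex: "\<And>y. norm y < r1 \<Longrightarrow> \<exists>t. \<bar>t\<bar> < c \<and> h (y + t *\<^sub>R im_a) = 0"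
    using transversal_function_on_lines[OF open_cyl zero_in_cyl[OF r] h(1) h0 pos norm_im_a] by metis
  \<comment> \<open>Removing the \<open>im_a\<close>-component of \<open>pr x\<close> can at most
    double the norm bound.\<close>
  define r2 where "r2 = min r r1 / 2"
  have r2: "0 < r2" "r2 \<le> r" "2 * r2 \<le> r1" using r r1 by (auto simp: r2_def)
  have "(h x = 0 \<longleftrightarrow> Im (x $ a) = 0) \<and> (0 < h x \<longleftrightarrow> 0 < Im (x $ a))" if x: "x \<in> cyl r2" for x
  proof -
    define t where "t = Im (x $ a)"
    define y where "y = pr x - t *\<^sub>R im_a"
    have prx: "norm (pr x) < r2" using x by (simp add: cyl_def)
    have "\<bar>t\<bar> \<le> norm (pr x $ a)" by (simp add: t_def pr_nth abs_Im_le_cmod)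
    also have "\<dots> \<le> norm (pr x)" by (rule Finite_Cartesian_Product.norm_nth_le)
    finally have t: "\<bar>t\<bar> < r2" using prx by simp
    have y: "norm y < 2 * r2" using norm_triangle_ineq4[of "pr x" "t *\<^sub>R im_a"] prx t by (simp add: y_def)
    then have yc: "norm y < c" using r2 r1 by simp
    have ya: "Im (y $ a) = 0" by (simp add: y_def t_def pr_nth)
    obtain s where s: "\<bar>s\<bar> < c" "h (y + s *\<^sub>R im_a) = 0" using ex[of y] y r2 by auto
    have "s = 0" using zero[of "y + s *\<^sub>R im_a"] good[OF yc, of s] s ya by simp
    then have hy: "h y = 0" using s(2) by simp
    have hx: "h x = h (y + t *\<^sub>R im_a)"
      using h(2)[of "pr x" "Im (x $ b)"] by (simp add: pr_plus y_def)
    consider "t = 0" | "0 < t" | "t < 0" by linarith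
    then show ?thesis
    proof cases
      case 1
      then show ?thesis using hx hy by (simp add: t_def)
    next
      case 2
      then have "0 < h x" using mono[OF yc, of 0 t] hx hy t r2 r1 by simp
      then show ?thesis using 2 by (simp add: t_def)
    next
      case 3
      then have "h x < 0" using mono[OF yc, of t 0] hx hy t r2 r1 by simp
      then show ?thesis using 3 by (simp add: t_def)
    qed
  qed
  then show ?thesis using r2 by blast
qed

end

section \<open>Boundary charts\<close>

lemma chart_image_iff:
  assumes "bij_betw \<phi> U V" "\<phi> ` (S \<inter> U) = A" "x \<in> U"
  shows "x \<in> S \<longleftrightarrow> \<phi> x \<in> A"
  using assms by (auto simp: bij_betw_def inj_on_def)

lemma chart_derivative_inverse:
  assumes "smooth_diffeo U UNIV \<phi>" "x \<in> U"
  shows "Der (inv_into U \<phi>) (\<phi> x) (Der \<phi> x v) = v"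
    and "Der \<phi> x (Der (inv_into U \<phi>) (\<phi> x) w) = w"
proof -
  let ?g = "inv_into U \<phi>"
  have U: "open U" and bij: "bij_betw \<phi> U UNIV" and \<phi>: "smooth_on \<phi> U" and g: "smooth_on ?g UNIV"
    using assms(1) by (auto simp: smooth_diffeo_def)
  have g\<phi>: "?g (\<phi> y) = y" if "y \<in> U" for y using bij that by (simp add: bij_betw_inv_into_left)
  have \<phi>g: "\<phi> (?g z) = z" for z using bij by (simp add: bij_betw_inv_into_right)
  note d\<phi> = smooth_on_has_derivative[OF \<phi> assms(2)] and dg = smooth_on_has_derivative[OF g, of "\<phi> x"]
  have "((\<lambda>y. y) has_derivative (\<lambda>v. Der ?g (\<phi> x) (Der \<phi> x v))) (at x)"
    by (rule has_derivative_transform_within_open[OF has_derivative_compose[OF d\<phi> dg] U assms(2)]) (simp_all add: g\<phi>)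
  then have "(\<lambda>v. Der ?g (\<phi> x) (Der \<phi> x v)) = (\<lambda>v. v)"
    using has_derivative_unique has_derivative_ident by blast
  then show "Der ?g (\<phi> x) (Der \<phi> x v) = v" by (rule fun_cong)
  have d\<phi>': "(\<phi> has_derivative Der \<phi> x) (at (?g (\<phi> x)))" using d\<phi> g\<phi>[OF assms(2)] by simp
  have "((\<lambda>z. z) has_derivative (\<lambda>w. Der \<phi> x (Der ?g (\<phi> x) w))) (at (\<phi> x))"
    using has_derivative_compose[OF dg d\<phi>'] by (simp add: \<phi>g)
  then have "(\<lambda>w. Der \<phi> x (Der ?g (\<phi> x) w)) = (\<lambda>w. w)"
    using has_derivative_unique has_derivative_ident by blast
  then show "Der \<phi> x (Der ?g (\<phi> x) w) = w" by (rule fun_cong)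
qed

lemma Der_chart_nth:
  assumes "smooth_diffeo U UNIV (\<phi> :: complex ^ 'n \<Rightarrow> real ^ ('n + 'n))" "x \<in> U"
  shows "Der (\<lambda>x. \<phi> x $ k) x v = Der \<phi> x v $ k"
  using Der_eqI[OF bounded_linear.has_derivative[OF bounded_linear_vec_nth
      smooth_on_has_derivative[of \<phi> U x]]] assms by (simp add: smooth_diffeo_def)

lemma smooth_on_chart_nth:
  assumes "smooth_diffeo U V (\<phi> :: complex ^ 'n \<Rightarrow> real ^ ('n + 'n))"
  shows "smooth_on (\<lambda>x. \<phi> x $ k) U"
  using assms by (auto simp: smooth_diffeo_def intro: smooth_on_bounded_linear_compose[OF bounded_linear_vec_nth])

text \<open>A straight line through \<open>\<phi> x\<close> in a direction killed by both chart
  functions pulls back to a curve in \<open>bd\<close>. Its \<open>k\<close>-th coordinate is real,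
  and so is that of its velocity \<open>v\<close>.\<close>

lemma boundary_chart_kernel:
  fixes \<phi> :: "complex ^ 'n \<Rightarrow> real ^ ('n + 'n)"
  assumes \<phi>: "smooth_diffeo U UNIV \<phi>" and x: "x \<in> U" "x \<in> bd"
    and bd: "\<phi> ` (bd \<inter> U) = {x. x $ i = 0 \<and> x $ j = 0}" and real: "\<And>y. y \<in> bd \<Longrightarrow> Im (y $ k) = 0"
    and v: "Der (\<lambda>x. \<phi> x $ i) x v = 0" "Der (\<lambda>x. \<phi> x $ j) x v = 0"
  shows "Im (v $ k) = 0"
proof -
  let ?g = "inv_into U \<phi>"
  have bij: "bij_betw \<phi> U UNIV" and g: "smooth_on ?g UNIV" using \<phi> by (auto simp: smooth_diffeo_def)
  define w where "w = Der \<phi> x v"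
  have w: "w $ i = 0" "w $ j = 0" using v Der_chart_nth[OF \<phi> x(1)] by (simp_all add: w_def)
  have \<phi>x: "\<phi> x $ i = 0" "\<phi> x $ j = 0" using chart_image_iff[OF bij bd x(1)] x(2) by auto
  have "Im (?g (\<phi> x + t *\<^sub>R w) $ k) = 0" for t
  proof -
    have "?g (\<phi> x + t *\<^sub>R w) \<in> U" "\<phi> (?g (\<phi> x + t *\<^sub>R w)) = \<phi> x + t *\<^sub>R w"
      using bij by (auto simp: bij_betw_inv_into_right bij_betw_def intro: inv_into_into)
    then have "?g (\<phi> x + t *\<^sub>R w) \<in> bd" using chart_image_iff[OF bij bd] \<phi>x w by simp
    then show ?thesis by (rule real)
  qed
  then have "((\<lambda>t. Im (?g (\<phi> x + t *\<^sub>R w) $ k)) has_vector_derivative 0) (at 0)" by simp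
  moreover have "(?g has_derivative Der ?g (\<phi> x)) (at (\<phi> x + 0 *\<^sub>R w))"
    using smooth_on_has_derivative[OF g, of "\<phi> x"] by simp
  from bounded_linear.has_vector_derivative[OF bounded_linear_Im_nth has_vector_derivative_along_line[OF this]]
  have "((\<lambda>t. Im (?g (\<phi> x + t *\<^sub>R w) $ k)) has_vector_derivative Im (Der ?g (\<phi> x) w $ k)) (at 0)" .
  ultimately have "Im (Der ?g (\<phi> x) w $ k) = 0" using vector_derivative_unique_at by blast
  then show ?thesis using chart_derivative_inverse(1)[OF \<phi> x(1)] by (simp add: w_def)
qed

context two_coords
begin

text \<open>The chart function \<open>?f\<close> cuts out the hypersurface and is solved for
  \<open>Im (x $ b)\<close>; \<open>?e\<close> decides the side and is pulled back to the hyperplane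
  by \<open>G\<close>. Its zeros come from edge points, which are real in
  \<open>z $ a\<close>.\<close>

lemma boundary_normal_form:
  fixes \<phi> :: "complex ^ 'n \<Rightarrow> real ^ ('n + 'n)"
  assumes \<phi>: "smooth_diffeo U UNIV \<phi>" and 0: "0 \<in> U" "0 \<in> bd" "bd \<subseteq> real_in_coords a b"
    and H: "\<phi> ` (H \<inter> U) = {x. 0 \<le> x $ i \<and> x $ j = 0}" and bd: "\<phi> ` (bd \<inter> U) = {x. x $ i = 0 \<and> x $ j = 0}"
    and nz: "Der (\<lambda>x. \<phi> x $ j) 0 im_b \<noteq> 0"
  obtains \<sigma> \<rho> r \<eta> where "\<sigma> * \<sigma> = 1" "0 < r" "0 < \<eta>" "graph_function a b \<rho> r"
    "\<And>x. x \<in> cyl r \<Longrightarrow> \<bar>\<rho> x\<bar> < \<eta>" "\<And>x. x \<in> cyl r \<Longrightarrow> Im (x $ a) = 0 \<Longrightarrow> \<rho> x = 0"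
    "\<And>x. x \<in> cyl r \<Longrightarrow> \<bar>Im (x $ b)\<bar> < \<eta> \<Longrightarrow> x \<in> H \<longleftrightarrow> Im (x $ b) = \<rho> x \<and> 0 \<le> \<sigma> * Im (x $ a)"
    "\<And>x. x \<in> cyl r \<Longrightarrow> \<bar>Im (x $ b)\<bar> < \<eta> \<Longrightarrow> x \<in> bd \<longleftrightarrow> Im (x $ b) = \<rho> x \<and> Im (x $ a) = 0"
proof -
  have U: "open U" and bij: "bij_betw \<phi> U UNIV" using \<phi> by (auto simp: smooth_diffeo_def)
  let ?f = "\<lambda>x. \<phi> x $ j" and ?e = "\<lambda>x. \<phi> x $ i"
  have f: "smooth_on ?f U" and e: "smooth_on ?e U" using smooth_on_chart_nth[OF \<phi>] by auto
  have iff: "x \<in> H \<longleftrightarrow> 0 \<le> ?e x \<and> ?f x = 0" "x \<in> bd \<longleftrightarrow> ?e x = 0 \<and> ?f x = 0" if "x \<in> U" for x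
    using chart_image_iff[OF bij H that] chart_image_iff[OF bij bd that] by auto
  have fe0: "?f 0 = 0" "?e 0 = 0" using iff(2)[OF 0(1)] 0(2) by auto
  have real: "Im (y $ a) = 0" "Im (y $ b) = 0" if "y \<in> bd" for y
    using that 0(3) by (auto simp: real_in_coords_def complex_is_Real_iff)
  obtain \<rho> r0 \<eta> where r0: "0 < r0" and \<eta>: "0 < \<eta>" and gf: "graph_function a b \<rho> r0"
    and 1: "\<forall>x\<in>cyl r0. \<bar>\<rho> x\<bar> < \<eta>"
    and 2: "\<forall>x\<in>cyl r0. \<bar>Im (x $ b)\<bar> < \<eta> \<longrightarrow> x \<in> U \<and> (?f x = 0 \<longleftrightarrow> Im (x $ b) = \<rho> x)"
    using implicit_function[OF U 0(1) f fe0(1) nz] by (elim exE conjE) (rule that; assumption)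
  have small: "\<bar>\<rho> x\<bar> < \<eta>" if "x \<in> cyl r0" for x using 1 that by blast
  have box_U: "x \<in> U" and f_iff: "?f x = 0 \<longleftrightarrow> Im (x $ b) = \<rho> x"
    if "x \<in> cyl r0" "\<bar>Im (x $ b)\<bar> < \<eta>" for x using bspec[OF 2 that(1)] that(2) by blast+
  interpret G: graph_function a b \<rho> r0 by (rule gf)
  define G where "G x = pr x + \<rho> x *\<^sub>R im_b" for x
  have G_cyl: "G x \<in> cyl r0 \<longleftrightarrow> x \<in> cyl r0" and G_b: "Im (G x $ b) = \<rho> x" and G_a: "Im (G x $ a) = Im (x $ a)"
    and \<rho>_G: "\<rho> (G x) = \<rho> x" for x
    unfolding G_def by (simp_all only: G.\<rho>_inv G.\<rho>_pr cyl_pr) (simp_all add: pr_nth)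
  have G_U: "G x \<in> U" if "x \<in> cyl r0" for x
    using box_U[of "G x"] small[OF that] that by (simp add: G_cyl G_b)
  have fG: "?f (G x) = 0" if "x \<in> cyl r0" for x
    using f_iff[of "G x"] small[OF that] that by (simp add: G_cyl G_b \<rho>_G)
  have zero0: "(0 :: complex ^ 'n) \<in> cyl r0" using zero_in_cyl[OF r0] .
  have "\<rho> 0 = 0" using f_iff[OF zero0] fe0(1) \<eta> by simp
  then have G0: "G 0 = 0" by (simp add: G_def)
  have smG: "smooth_on G (cyl r0)"
    unfolding G_def
    by (intro smooth_on_add smooth_on_scaleR smooth_on_const smooth_on_bounded_linear[OF bounded_linear_pr]
        G.smooth_\<rho> open_cyl)
  have sm_eG: "smooth_on (\<lambda>x. ?e (G x)) (cyl r0)"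
    by (rule smooth_on_compose[OF open_cyl U _ e smG]) (use G_U in auto)
  let ?\<kappa> = "Der (\<lambda>x. ?e (G x)) 0 im_a"
  \<comment> \<open>Otherwise the image of \<open>im_a\<close> under the derivative of
    \<open>G\<close> would be killed by both chart functions and have a real
    \<open>a\<close>-coordinate, although \<open>G\<close> leaves that coordinate equal to that of
    \<open>im_a\<close>.\<close>
  have "?\<kappa> \<noteq> 0"
  proof
    assume \<kappa>: "?\<kappa> = 0"
    define w where "w = Der G 0 im_a"
    have dG: "(G has_derivative Der G 0) (at 0)"
      using smooth_on_has_derivative[OF smG zero0] .
    have chain: "Der (\<lambda>x. F (G x)) 0 im_a = Der F 0 w"
      if F: "smooth_on F U" for F :: "complex ^ 'n \<Rightarrow> real"
    proof -
      have "(F has_derivative Der F 0) (at (G 0))"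
        using smooth_on_has_derivative[OF F 0(1)] by (simp add: G0)
      from has_derivative_compose[OF dG this] show ?thesis by (simp add: Der_eqI w_def)
    qed
    have "((\<lambda>x. ?f (G x)) has_derivative (\<lambda>v. 0)) (at 0)"
      by (rule has_derivative_transform_within_open[OF has_derivative_const[of 0] open_cyl zero0]) (simp add: fG)
    then have "Der ?f 0 w = 0" using chain[OF f] by (simp add: Der_eqI)
    moreover have "Der ?e 0 w = 0" using chain[OF e] \<kappa> by simp
    ultimately have "Im (w $ a) = 0"
      by (intro boundary_chart_kernel[OF \<phi> 0(1,2) bd real(1)])
    moreover have "((\<lambda>x. Im (G x $ a)) has_derivative (\<lambda>v. Im (Der G 0 v $ a))) (at 0)"
      by (rule bounded_linear.has_derivative[OF bounded_linear_Im_nth dG])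
    then have "(\<lambda>v. Im (Der G 0 v $ a)) = (\<lambda>v. Im (v $ a))"
      unfolding G_a
      using has_derivative_unique bounded_linear_imp_has_derivative[OF bounded_linear_Im_nth] by blast
    then have "Im (w $ a) = Im (im_a $ a)" unfolding w_def by (rule fun_cong)
    ultimately show False by simp
  qed
  define \<sigma> where "\<sigma> = sgn ?\<kappa>"
  have \<sigma>: "\<sigma> * \<sigma> = 1" "0 < \<sigma> * ?\<kappa>" using \<open>?\<kappa> \<noteq> 0\<close> by (auto simp: \<sigma>_def sgn_if)
  define h where "h x = \<sigma> * ?e (G x)" for x
  have D_h: "Der h 0 im_a = \<sigma> * ?\<kappa>"
    unfolding h_def[abs_def]
    using Der_eqI[OF has_derivative_mult_right[OF smooth_on_has_derivative[OF sm_eG zero0], of \<sigma>]] by simp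
  have "\<exists>r>0. r \<le> r0 \<and> (\<forall>x\<in>cyl r. (h x = 0 \<longleftrightarrow> Im (x $ a) = 0) \<and> (0 < h x \<longleftrightarrow> 0 < Im (x $ a)))"
  proof (rule sign_of_transversal_function[OF r0])
    show "smooth_on h (cyl r0)" unfolding h_def[abs_def] by (intro smooth_on_mult smooth_on_const sm_eG open_cyl)
    show "h (x + t *\<^sub>R im_b) = h x" for x t by (simp add: h_def G_def G.\<rho>_inv)
    show "h 0 = 0" by (simp add: h_def G0 fe0)
    show "0 < Der h 0 im_a" using \<sigma>(2) by (simp add: D_h)
    show "Im (x $ a) = 0" if "x \<in> cyl r0" "h x = 0" for x
    proof -
      have "\<sigma> \<noteq> 0" using \<sigma>(1) by auto
      then have "G x \<in> bd" using that fG[OF that(1)] iff(2)[OF G_U[OF that(1)]] by (simp add: h_def)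
      then show ?thesis using real(1) G_a by metis
    qed
  qed
  then obtain r where r: "0 < r" "r \<le> r0"
    and sign: "\<And>x. x \<in> cyl r \<Longrightarrow> h x = 0 \<longleftrightarrow> Im (x $ a) = 0" "\<And>x. x \<in> cyl r \<Longrightarrow> 0 < h x \<longleftrightarrow> 0 < Im (x $ a)" by blast
  have r_r0: "x \<in> cyl r0" if "x \<in> cyl r" for x using that cyl_mono[OF r(2)] by blast
  have e_sign: "?e (G x) = 0 \<longleftrightarrow> Im (x $ a) = 0" "0 \<le> ?e (G x) \<longleftrightarrow> 0 \<le> \<sigma> * Im (x $ a)" if "x \<in> cyl r" for x
  proof -
    consider "\<sigma> = 1" | "\<sigma> = -1" using \<sigma>(1) by (metis square_eq_1_iff)
    then show "?e (G x) = 0 \<longleftrightarrow> Im (x $ a) = 0" "0 \<le> ?e (G x) \<longleftrightarrow> 0 \<le> \<sigma> * Im (x $ a)"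
      using sign[OF that] by (cases; auto simp: h_def)+
  qed
  have eq_G: "x = G x" if "Im (x $ b) = \<rho> x" for x using that by (simp add: G_def pr_def)
  show thesis
  proof (rule that[OF \<sigma>(1) r(1) \<eta> graph_function_mono[OF gf r(2)]])
    show "\<bar>\<rho> x\<bar> < \<eta>" if "x \<in> cyl r" for x using small r_r0 that by blast
    show "\<rho> x = 0" if "x \<in> cyl r" "Im (x $ a) = 0" for x
    proof -
      have "G x \<in> bd" using iff(2)[OF G_U] fG e_sign(1) r_r0 that by simp
      then show ?thesis using real(2) G_b by metis
    qed
    fix x assume x: "x \<in> cyl r" "\<bar>Im (x $ b)\<bar> < \<eta>"
    have xU: "x \<in> U" using box_U r_r0 x by blast
    have fx: "?f x = 0 \<longleftrightarrow> Im (x $ b) = \<rho> x" using f_iff r_r0 x by blast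
    show "x \<in> H \<longleftrightarrow> Im (x $ b) = \<rho> x \<and> 0 \<le> \<sigma> * Im (x $ a)"
      using iff(1)[OF xU] fx e_sign(2)[OF x(1)] eq_G[of x] by metis
    show "x \<in> bd \<longleftrightarrow> Im (x $ b) = \<rho> x \<and> Im (x $ a) = 0"
      using iff(2)[OF xU] fx e_sign(1)[OF x(1)] eq_G[of x] by metis
  qed
qed

end

section \<open>Uniqueness of the germ and construction of the extension\<close>

context graph_function
begin

lemma odd_if_involutive:
  assumes r: "0 < r" and edge: "\<And>x. x \<in> cyl r \<Longrightarrow> Im (x $ a) = 0 \<Longrightarrow> \<rho> x = 0"
    and V: "open V" "M \<inter> V = graph \<inter> V" "graph \<subseteq> V" and M: "involutive M (complex_tangent_space M)"
  shows "\<exists>r'>0. r' \<le> r \<and> (\<forall>x\<in>cyl r'. \<rho> (x - (2 * Im (x $ a)) *\<^sub>R im_a) = - \<rho> x)"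
proof (rule odd_if_levi_flat[OF r edge])
  fix x assume x: "x \<in> cyl r"
  have "\<rho> (pr x + \<rho> x *\<^sub>R im_b) = \<rho> x" by (simp only: \<rho>_inv \<rho>_pr)
  then have "pr x + \<rho> x *\<^sub>R im_b \<in> V" using x V(3) by (auto simp: graph_def)
  then show "lie_bracket (cr_lift re_a) (cr_lift im_a) x = 0"
    using x by (intro lie_bracket_cr_lift_eq_0[OF V(1,2) M]) simp_all
qed

end

context two_coords
begin

lemma reflection_in_cyl: "x - (2 * Im (x $ a)) *\<^sub>R im_a \<in> cyl r \<longleftrightarrow> x \<in> cyl r"
proof -
  have "norm (pr (x - (2 * Im (x $ a)) *\<^sub>R im_a) $ i) = norm (pr x $ i)" for i
    by (auto simp: pr_nth cmod_def)
  then have "norm (pr (x - (2 * Im (x $ a)) *\<^sub>R im_a)) = norm (pr x)" by (simp add: norm_vec_def)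
  then show ?thesis by (simp add: cyl_def)
qed

text \<open>The competitor is shown to be a graph over the same hyperplane. The two graph functions
  agree on the side of \<open>H\<close>, and both are odd in \<open>Im (x $ a)\<close> near 0, so
  they agree on the other side too.\<close>

lemma levi_flat_germ_unique:
  assumes gf: "graph_function a b \<rho> r" and r: "0 < r" and \<sigma>: "\<sigma> * \<sigma> = 1"
    and edge: "\<And>x. x \<in> cyl r \<Longrightarrow> Im (x $ a) = 0 \<Longrightarrow> \<rho> x = 0"
    and levi: "involutive (graph_function.graph b \<rho> r) (complex_tangent_space (graph_function.graph b \<rho> r))"
    and H: "\<And>x. x \<in> cyl r \<Longrightarrow> Im (x $ b) = \<rho> x \<Longrightarrow> 0 \<le> \<sigma> * Im (x $ a) \<Longrightarrow> x \<in> H" and H0: "0 \<in> H"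
    and M': "levi_flat_hypersurface M'" "germ_subset 0 H M'"
  shows "germ_eq 0 M' (graph_function.graph b \<rho> r)"
proof -
  interpret G: graph_function a b \<rho> r by (rule gf)
  define side where "side x = \<sigma> * Im (x $ a)" for x :: "complex ^ 'n"
  have side: "bounded_linear side"
    unfolding side_def[abs_def]
    by (rule bounded_linear_compose[OF bounded_linear_mult_right bounded_linear_Im_nth])
  have side_e: "side (\<sigma> *\<^sub>R im_a) = 1" using \<sigma> by (simp add: side_def)
  obtain V0 where V0: "open V0" "0 \<in> V0" "H \<inter> V0 \<subseteq> M'"
    using M'(2) unfolding germ_subset_def by blast
  then have "0 \<in> M'" using H0 by blast
  then obtain U' \<phi> k where U': "0 \<in> U'" and \<phi>: "smooth_diffeo U' UNIV (\<phi> :: complex ^ 'n \<Rightarrow> real ^ ('n + 'n))"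
    and \<phi>M: "\<phi> ` (M' \<inter> U') = {x. x $ k = 0}"
    using M'(1) unfolding levi_flat_hypersurface_def smooth_hypersurface_def by meson
  have openU': "open U'" and bij: "bij_betw \<phi> U' UNIV" using \<phi> by (auto simp: smooth_diffeo_def)
  let ?f = "\<lambda>x. \<phi> x $ k"
  have f: "smooth_on ?f U'" using smooth_on_chart_nth[OF \<phi>] .
  have f_iff: "x \<in> M' \<longleftrightarrow> ?f x = 0" if "x \<in> U'" for x using chart_image_iff[OF bij \<phi>M that] by simp
  have f0: "?f 0 = 0" using f_iff[OF U'] \<open>0 \<in> M'\<close> by simp
  have zero_cyl: "(0 :: complex ^ 'n) \<in> cyl r" using zero_in_cyl[OF r] .
  define G where "G x = pr x + \<rho> x *\<^sub>R im_b" for x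
  have G0: "G 0 = 0" using edge[OF zero_cyl] by (simp add: G_def)
  have G_cyl: "G x \<in> cyl s \<longleftrightarrow> x \<in> cyl s" and G_b: "Im (G x $ b) = \<rho> x" and G_a: "Im (G x $ a) = Im (x $ a)"
    and \<rho>_G: "\<rho> (G x) = \<rho> x" and G_pr: "G (pr x) = G x" for x s
    unfolding G_def by (simp_all only: G.\<rho>_inv G.\<rho>_pr cyl_pr pr_simps) (simp_all add: pr_nth)
  have smG: "smooth_on G (cyl r)"
    unfolding G_def
    by (intro smooth_on_add smooth_on_scaleR smooth_on_const smooth_on_bounded_linear[OF bounded_linear_pr]
        G.smooth_\<rho> open_cyl)
  define S where "S = cyl r \<inter> G -` (V0 \<inter> U')"
  have S: "open S" "0 \<in> S"
    unfolding S_def using continuous_open_preimage[OF smooth_on_continuous_on[OF smG] open_cyl, of "V0 \<inter> U'"]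
      V0 U' openU' zero_cyl G0 by auto
  have fG: "?f (G x) = 0" if x: "x \<in> S" "0 \<le> \<sigma> * Im (x $ a)" for x
  proof -
    have "G x \<in> H" using x by (intro H) (auto simp: S_def G_cyl G_a G_b \<rho>_G)
    then show ?thesis using x(1) V0(3) f_iff[of "G x"] by (auto simp: S_def)
  qed
  \<comment> \<open>The defining function vanishes on one half of the graph, so its composition with
    \<open>G\<close> has zero derivative at 0. If the \<open>im_b\<close>-derivative vanished as
    well, a coordinate of a diffeomorphism would have zero differential.\<close>
  have nz: "Der ?f 0 im_b \<noteq> 0"
  proof
    assume z: "Der ?f 0 im_b = 0"
    interpret linear "Der ?f 0" using smooth_on_linear_derivative[OF f U'] .
    have smF: "smooth_on (\<lambda>x. ?f (G x)) S"
      by (rule smooth_on_compose[OF S(1) openU' _ f smooth_on_subset[OF smG]]) (auto simp: S_def)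
    have "vanishes_to_order side (\<sigma> *\<^sub>R im_a) S (Suc 0) (\<lambda>x. ?f (G x))"
      by (rule vanishes_to_order_if_zero_half_space[OF side side_e S(1) smF]) (rule fG, auto simp: side_def)
    then have DF: "Der (\<lambda>x. ?f (G x)) 0 v = 0" for v
      using vanishes_to_order_0[OF side side_e S(1) vanishes_to_order_derivative[OF side side_e S(1) smF], of 0 0 v] S(2)
      by (simp add: side_def)
    have dG: "(G has_derivative (\<lambda>v. pr v + Der \<rho> 0 v *\<^sub>R im_b)) (at 0)"
      unfolding G_def
      by (intro has_derivative_add has_derivative_pr
          has_derivative_scaleR_left smooth_on_has_derivative[OF G.smooth_\<rho> zero_cyl])
    have "(?f has_derivative Der ?f 0) (at (G 0))"
      using smooth_on_has_derivative[OF f U'] by (simp add: G0)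
    from has_derivative_compose[OF dG this]
    have "Der ?f 0 (pr v + Der \<rho> 0 v *\<^sub>R im_b) = 0" for v
      using DF[of v] by (simp add: Der_eqI)
    then have pr0: "Der ?f 0 (pr v) = 0" for v by (simp add: add scale z)
    have "Der ?f 0 v = 0" for v
      using pr0[of v] add[of "pr v" "Im (v $ b) *\<^sub>R im_b"] by (simp add: pr_plus scale z)
    then have "Der \<phi> 0 v $ k = 0" for v
      using Der_chart_nth[OF \<phi> U', of k v] by simp
    then have "axis k (1::real) $ k = 0"
      using chart_derivative_inverse(2)[OF \<phi> U', of "axis k 1"] by metis
    then show False by (simp add: axis_def)
  qed
  obtain \<rho>2 r2 \<eta> where r2: "0 < r2" and \<eta>: "0 < \<eta>" and gf2: "graph_function a b \<rho>2 r2"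
    and box: "\<forall>x\<in>cyl r2. \<bar>Im (x $ b)\<bar> < \<eta> \<longrightarrow> x \<in> U' \<and> (?f x = 0 \<longleftrightarrow> Im (x $ b) = \<rho>2 x)"
    and small2: "\<forall>x\<in>cyl r2. \<bar>\<rho>2 x\<bar> < \<eta>"
    using implicit_function[OF openU' U' f f0 nz] by (elim exE conjE) (rule that; assumption)
  have box_iff: "x \<in> M' \<longleftrightarrow> Im (x $ b) = \<rho>2 x" if "x \<in> cyl r2" "\<bar>Im (x $ b)\<bar> < \<eta>" for x
    using bspec[OF box that(1)] that(2) f_iff[of x] by blast
  \<comment> \<open>The competitor is known to be a graph only in a box of height \<eta>; the known
    graph must stay inside that box to be compared with it.\<close>
  have "0 < \<eta> - \<bar>\<rho> 0\<bar>" using edge[OF zero_cyl] \<eta> by simp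
  moreover have "continuous_on S (\<lambda>x. \<eta> - \<bar>\<rho> x\<bar>)"
    using smooth_on_continuous_on[OF G.smooth_\<rho>] by (intro continuous_intros) (auto simp: S_def intro: continuous_on_subset)
  ultimately obtain d where d: "0 < d" "ball 0 d \<subseteq> {x \<in> S. 0 < \<eta> - \<bar>\<rho> x\<bar>}"
    using openE[OF open_Collect_pos_on[OF S(1), of "\<lambda>x. \<eta> - \<bar>\<rho> x\<bar>"], of 0] S(2) by blast
  define r3 where "r3 = min r (min r2 d)"
  have r3: "0 < r3" "r3 \<le> r" "r3 \<le> r2" "r3 \<le> d" using r r2 d by (auto simp: r3_def)
  interpret G2: graph_function a b \<rho>2 r3 using graph_function_mono[OF gf2 r3(3)] .
  have cyl3: "x \<in> cyl r" "x \<in> cyl r2" if "x \<in> cyl r3" for x using that cyl_mono r3 by blast+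
  have agree: "\<rho>2 x = \<rho> x" if x: "x \<in> cyl r3" "0 \<le> \<sigma> * Im (x $ a)" for x
  proof -
    have "pr x \<in> ball 0 d" using x(1) r3(4) by (simp add: cyl_def)
    then have "pr x \<in> S" "\<bar>\<rho> x\<bar> < \<eta>" using d(2) by auto
    then have "?f (G x) = 0" using fG[of "pr x"] x(2) by (simp add: G_pr pr_nth)
    then have "Im (G x $ b) = \<rho>2 (G x)"
      using bspec[OF box, of "G x"] cyl3(2)[OF x(1)] \<open>\<bar>\<rho> x\<bar> < \<eta>\<close> by (simp add: G_cyl G_b)
    then show ?thesis by (simp add: G_b) (simp add: G_def G2.\<rho>_inv)
  qed
  have "\<exists>r'>0. r' \<le> r3 \<and> (\<forall>x\<in>cyl r'. \<rho>2 (x - (2 * Im (x $ a)) *\<^sub>R im_a) = - \<rho>2 x)"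
  proof (rule G2.odd_if_involutive[OF r3(1)])
    show "\<rho>2 x = 0" if "x \<in> cyl r3" "Im (x $ a) = 0" for x
      using agree[of x] edge[of x] cyl3 that by simp
    show "open {x \<in> cyl r3. \<bar>Im (x $ b)\<bar> < \<eta>}" by (rule open_box)
    show "M' \<inter> {x \<in> cyl r3. \<bar>Im (x $ b)\<bar> < \<eta>} = G2.graph \<inter> {x \<in> cyl r3. \<bar>Im (x $ b)\<bar> < \<eta>}"
      using box_iff cyl3 by (auto simp: G2.graph_def)
    show "G2.graph \<subseteq> {x \<in> cyl r3. \<bar>Im (x $ b)\<bar> < \<eta>}"
      using small2 cyl3 by (auto simp: G2.graph_def)
    show "involutive M' (complex_tangent_space M')" using M'(1) by (simp add: levi_flat_hypersurface_def)
  qed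
  then obtain r4 where r4: "0 < r4" "r4 \<le> r3"
    and odd2: "\<And>x. x \<in> cyl r4 \<Longrightarrow> \<rho>2 (x - (2 * Im (x $ a)) *\<^sub>R im_a) = - \<rho>2 x" by blast
  obtain r5 where r5: "0 < r5" "r5 \<le> r"
    and odd: "\<And>x. x \<in> cyl r5 \<Longrightarrow> \<rho> (x - (2 * Im (x $ a)) *\<^sub>R im_a) = - \<rho> x"
    using G.odd_if_involutive[OF r edge open_UNIV _ _ levi] by auto
  define r6 where "r6 = min r4 r5"
  have r6: "0 < r6" "r6 \<le> r4" "r6 \<le> r5" "r6 \<le> r3" using r4 r5 by (auto simp: r6_def)
  have cyl6: "x \<in> cyl r4" "x \<in> cyl r5" "x \<in> cyl r3" if "x \<in> cyl r6" for x using that cyl_mono r6 by blast+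
  have eq: "\<rho>2 x = \<rho> x" if x: "x \<in> cyl r6" for x
  proof (cases "0 \<le> \<sigma> * Im (x $ a)")
    case True
    then show ?thesis using agree cyl6 x by blast
  next
    case False
    let ?y = "x - (2 * Im (x $ a)) *\<^sub>R im_a"
    have "?y \<in> cyl r3" using cyl6(3)[OF x] by (simp add: reflection_in_cyl)
    moreover have "0 \<le> \<sigma> * Im (?y $ a)" using False by simp
    ultimately have "\<rho>2 ?y = \<rho> ?y" by (rule agree)
    then show ?thesis using odd2[OF cyl6(1)[OF x]] odd[OF cyl6(2)[OF x]] by simp
  qed
  have "x \<in> M' \<longleftrightarrow> x \<in> G.graph" if x: "x \<in> cyl r6" "\<bar>Im (x $ b)\<bar> < \<eta>" for x
    using box_iff[of x] eq[OF x(1)] cyl6[OF x(1)] cyl3[of x] x by (simp add: G.graph_def)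
  then have "M' \<inter> {x \<in> cyl r6. \<bar>Im (x $ b)\<bar> < \<eta>} = G.graph \<inter> {x \<in> cyl r6. \<bar>Im (x $ b)\<bar> < \<eta>}" by blast
  moreover have "0 \<in> {x \<in> cyl r6. \<bar>Im (x $ b)\<bar> < \<eta>}" using zero_in_cyl[OF r6(1)] \<eta> by simp
  ultimately show ?thesis unfolding germ_eq_def using open_box by blast
qed

lemma levi_flat_extension:
  fixes \<phi> :: "complex ^ 'n \<Rightarrow> real ^ ('n + 'n)"
  assumes LF: "levi_flat_hypersurface_with_boundary H bd"
    and \<phi>: "smooth_diffeo U UNIV \<phi>" and 0: "0 \<in> U" "0 \<in> bd" "bd \<subseteq> real_in_coords a b"
    and H: "\<phi> ` (H \<inter> U) = {x. 0 \<le> x $ i \<and> x $ j = 0}" and bd: "\<phi> ` (bd \<inter> U) = {x. x $ i = 0 \<and> x $ j = 0}"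
    and nz: "Der (\<lambda>x. \<phi> x $ j) 0 im_b \<noteq> 0"
  shows "\<exists>U M. open U \<and> 0 \<in> U \<and> levi_flat_hypersurface M \<and> H \<inter> U \<subseteq> M \<and>
           (\<forall>M'. levi_flat_hypersurface M' \<and> germ_subset 0 H M' \<longrightarrow> germ_eq 0 M' M)"
proof -
  obtain \<sigma> \<rho> r \<eta> where \<sigma>: "\<sigma> * \<sigma> = 1" and r: "0 < r" and \<eta>: "0 < \<eta>" and gf: "graph_function a b \<rho> r"
    and small: "\<And>x. x \<in> cyl r \<Longrightarrow> \<bar>\<rho> x\<bar> < \<eta>" and edge: "\<And>x. x \<in> cyl r \<Longrightarrow> Im (x $ a) = 0 \<Longrightarrow> \<rho> x = 0"
    and in_H: "\<And>x. x \<in> cyl r \<Longrightarrow> \<bar>Im (x $ b)\<bar> < \<eta> \<Longrightarrow> x \<in> H \<longleftrightarrow> Im (x $ b) = \<rho> x \<and> 0 \<le> \<sigma> * Im (x $ a)"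
    and in_bd: "\<And>x. x \<in> cyl r \<Longrightarrow> \<bar>Im (x $ b)\<bar> < \<eta> \<Longrightarrow> x \<in> bd \<longleftrightarrow> Im (x $ b) = \<rho> x \<and> Im (x $ a) = 0"
    by (rule boundary_normal_form[OF \<phi> 0 H bd nz]) (rule that; assumption)
  interpret G: graph_function a b \<rho> r by (rule gf)
  have invol: "involutive (H - bd) (complex_tangent_space (H - bd))"
    using LF by (simp add: levi_flat_hypersurface_with_boundary_def levi_flat_hypersurface_def)
  \<comment> \<open>The strict inequality leaves out the edge, so inside \<open>V\<close> the
    interior of \<open>H\<close> is the full graph of \<rho>.\<close>
  define V where "V = {x \<in> cyl r. \<bar>Im (x $ b)\<bar> < \<eta>} \<inter> {x. 0 < \<sigma> * Im (x $ a)}"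
  have V: "open V"
    unfolding V_def
    by (intro open_Int open_box open_Collect_less continuous_intros linear_continuous_on[OF bounded_linear_Im_nth])
  have HV: "(H - bd) \<inter> V = G.graph \<inter> V"
    using in_H in_bd by (auto simp: V_def G.graph_def)
  have comm: "lie_bracket (G.cr_lift e) (G.cr_lift e') x = 0"
    if "x \<in> cyl r" "0 < \<sigma> * Im (x $ a)" "e $ b = 0" "e' $ b = 0" for x e e'
    by (rule G.lie_bracket_cr_lift_eq_0[OF V HV invol that(1) _ that(3,4)])
       (use that(1,2) small in \<open>simp add: V_def pr_nth\<close>)
  interpret E: edge_graph a b \<rho> r \<sigma>
    by unfold_locales (use \<sigma> edge comm in auto)
  obtain \<rho>' where gf': "graph_function a b \<rho>' r"
    and ext: "\<And>x. x \<in> cyl r \<Longrightarrow> 0 \<le> \<sigma> * Im (x $ a) \<Longrightarrow> \<rho>' x = \<rho> x"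
    and refl: "\<And>x. x \<in> cyl r \<Longrightarrow> \<rho>' (conj_vec x) = - \<rho>' x"
    using E.reflected_extension by blast
  interpret G': graph_function a b \<rho>' r by (rule gf')
  have "involutive G'.graph (complex_tangent_space G'.graph)"
  proof (rule G'.involutive_if_reflection_symmetric[OF E.\<sigma>_nonzero refl V _ _ invol])
    show "(H - bd) \<inter> V = G'.graph \<inter> V"
      unfolding HV using ext by (auto simp: G.graph_def G'.graph_def V_def)
    show "x \<in> V" if "x \<in> G'.graph" "0 < \<sigma> * Im (x $ a)" for x
      using that ext[of x] small[of x] by (simp add: G'.graph_def V_def)
  qed
  then have LM: "levi_flat_hypersurface G'.graph"
    using G'.smooth_hypersurface_graph[OF r] by (simp add: levi_flat_hypersurface_def)
  show ?thesis
  proof (intro exI conjI allI impI)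
    show "open {x \<in> cyl r. \<bar>Im (x $ b)\<bar> < \<eta>}" by (rule open_box)
    show "0 \<in> {x \<in> cyl r. \<bar>Im (x $ b)\<bar> < \<eta>}" using zero_in_cyl[OF r] \<eta> by simp
    show "levi_flat_hypersurface G'.graph" by (rule LM)
    show "H \<inter> {x \<in> cyl r. \<bar>Im (x $ b)\<bar> < \<eta>} \<subseteq> G'.graph"
      using in_H ext by (auto simp: G'.graph_def)
    fix M' assume "levi_flat_hypersurface M' \<and> germ_subset 0 H M'"
    then have M': "levi_flat_hypersurface M'" "germ_subset 0 H M'" by auto
    show "germ_eq 0 M' G'.graph"
    proof (rule levi_flat_germ_unique[OF gf' r \<sigma> _ _ _ _ M'])
      show "\<rho>' x = 0" if "x \<in> cyl r" "Im (x $ a) = 0" for x using ext[of x] edge[of x] that by simp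
      show "involutive G'.graph (complex_tangent_space G'.graph)" by fact
      show "x \<in> H" if "x \<in> cyl r" "Im (x $ b) = \<rho>' x" "0 \<le> \<sigma> * Im (x $ a)" for x
        using in_H[of x] small[of x] ext[of x] that by simp
      show "0 \<in> H"
        using LF 0(2) by (auto simp: levi_flat_hypersurface_with_boundary_def smooth_hypersurface_with_boundary_def)
    qed
  qed
qed

end

theorem theorem1p2:
  fixes H bd :: "(complex ^ 'n) set" and a b :: 'n
  assumes "a \<noteq> b"
    and "levi_flat_hypersurface_with_boundary H bd"
    and "0 \<in> bd"
    and "bd \<subseteq> real_in_coords a b"
  shows "\<exists>U M. open U \<and> 0 \<in> U \<and> levi_flat_hypersurface M \<and> H \<inter> U \<subseteq> M \<and>
           (\<forall>M'. levi_flat_hypersurface M' \<and> germ_subset 0 H M' \<longrightarrow> germ_eq 0 M' M)"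
proof -
  interpret ab: two_coords a b using assms(1) by unfold_locales
  interpret ba: two_coords b a using assms(1) by unfold_locales auto
  obtain U and \<phi> :: "complex ^ 'n \<Rightarrow> real ^ ('n + 'n)" and i j where 0: "0 \<in> U" and \<phi>: "smooth_diffeo U UNIV \<phi>"
    and H: "\<phi> ` (H \<inter> U) = {x. 0 \<le> x $ i \<and> x $ j = 0}" and bd: "\<phi> ` (bd \<inter> U) = {x. x $ i = 0 \<and> x $ j = 0}"
    using assms(2,3)
    unfolding levi_flat_hypersurface_with_boundary_def smooth_hypersurface_with_boundary_def by meson
  let ?f = "\<lambda>x. \<phi> x $ j" and ?e = "\<lambda>x. \<phi> x $ i"
  have real: "Im (y $ a) = 0" "Im (y $ b) = 0" if "y \<in> bd" for y
    using that assms(4) by (auto simp: real_in_coords_def complex_is_Real_iff)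
  \<comment> \<open>The span of \<open>im_a\<close> and \<open>im_b\<close> would otherwise lie in
    the kernel of \<open>?f\<close>. Since \<open>?e\<close> is a single linear condition on this
    plane, some nonzero vector in it would be killed by both and hence have real \<open>a\<close>-
    and \<open>b\<close>-coordinates, which is impossible.\<close>
  have "Der ?f 0 ab.im_b \<noteq> 0 \<or> Der ?f 0 ab.im_a \<noteq> 0"
  proof (rule ccontr)
    assume "\<not> ?thesis"
    then have f0: "Der ?f 0 ab.im_b = 0" "Der ?f 0 ab.im_a = 0" by auto
    interpret f: linear "Der ?f 0"
      using smooth_on_linear_derivative[OF smooth_on_chart_nth[OF \<phi>] 0] .
    interpret e: linear "Der ?e 0"
      using smooth_on_linear_derivative[OF smooth_on_chart_nth[OF \<phi>] 0] .
    define s where "s = Der ?e 0 ab.im_b"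
    define t where "t = Der ?e 0 ab.im_a"
    have ker: "x = 0 \<and> y = 0" if "x * t + y * s = 0" for x y
    proof -
      have "Der ?e 0 (x *\<^sub>R ab.im_a + y *\<^sub>R ab.im_b) = 0"
        using that by (simp add: e.add e.scale s_def t_def)
      moreover have "Der ?f 0 (x *\<^sub>R ab.im_a + y *\<^sub>R ab.im_b) = 0"
        by (simp add: f.add f.scale f0)
      ultimately have "Im ((x *\<^sub>R ab.im_a + y *\<^sub>R ab.im_b) $ a) = 0" "Im ((x *\<^sub>R ab.im_a + y *\<^sub>R ab.im_b) $ b) = 0"
        using boundary_chart_kernel[OF \<phi> 0 assms(3) bd] real by blast+
      then show ?thesis by simp
    qed
    \<comment> \<open>The pair \<open>(s, -t)\<close> always solves the linear condition, so
      \<open>s\<close> and \<open>t\<close> vanish; then every pair solves it, in particular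
      \<open>(1, 1)\<close>.\<close>
    have "s = 0 \<and> t = 0" using ker[of s "-t"] by simp
    then show False using ker[of 1 1] by simp
  qed
  then show ?thesis
  proof
    assume "Der ?f 0 ab.im_b \<noteq> 0"
    then show ?thesis by (rule ab.levi_flat_extension[OF assms(2) \<phi> 0 assms(3,4) H bd])
  next
    assume "Der ?f 0 ab.im_a \<noteq> 0"
    \<comment> \<open>The hypotheses are symmetric in the two real coordinates, so the hypersurface
      is treated as a graph over \<open>im_a\<close> by exchanging their roles.\<close>
    moreover have "ab.im_a = ba.im_b" by (simp add: ab.im_a_def ba.im_b_def)
    moreover have "bd \<subseteq> real_in_coords b a" using assms(4) by (auto simp: real_in_coords_def)
    ultimately show ?thesis using ba.levi_flat_extension[OF assms(2) \<phi> 0 assms(3) _ H bd] by simp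
  qed
qed

end
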